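(* Let $W$ satisfy (W-i), (W-ii), (W-iii), (W-iv), let $V$ satisfy (V-i), (V-ii), and let $q>0$ be sufficiently small, so that for some $\delta_\infty>0$ the dynamical system $(X,\gamma)$ described by (A), (B), (C) has a family $\mathbf{u}_\delta=(u_\delta,\Theta_\delta,\mathbf{E}_\delta,\mathbf{H}_\delta)$, $\delta\in(0,\delta_\infty)$, of hylomorphic solitons satisfying $\Lambda(\mathbf{u}_{\delta_1})<\Lambda(\mathbf{u}_{\delta_2})$ and $\|u_{\delta_1}\|_{L^2}>\|u_{\delta_2}\|_{L^2}$ whenever $\delta_1<\delta_2$. Then the solitons $\mathbf{u}_\delta$ are stationary solutions of (A), (B), (C); that is, $\Theta_\delta=\mathbf{H}_\delta=0$, $\mathbf{E}_\delta=-\nabla\varphi_\delta$, the functions $u_\delta,\varphi_\delta$ do not depend on $t$, and they solve, for a suitable real number $\omega$ (depending on $\delta$), the nonlinear Schrödinger–Poisson system $$-\tfrac12\Delta u_\delta+V(x)u_\delta+\tfrac12W'(u_\delta)+q\varphi_\delta u_\delta=-\omega u_\delta,$$ $$-\Delta\varphi_\delta=qu_\delta^2.$$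
   Context: **Assumptions on $W$.** $W$ is a real function on $[0,\infty)$ (extended by $W(\psi)=W(|\psi|)$; likewise for $N$ below) such that: (W-i) $W$ is $C^2$, $W(0)=W'(0)=0$ and $W''(0)=2E_0>0$; (W-ii) writing $W(s)=E_0s^2+N(s)$, there exists $s_0>0$ with $N(s_0)<-V_0s_0^2$, where $V_0=\max V$; (W-iii) there exist exponents $r,\ell\in(2,6)$ and constants $c_1,c_2$ such that $|N'(s)|\le c_1s^{r-1}+c_2s^{\ell-1}$; (W-iv) there are $c\ge 0$ and $2<p<2+\frac43$ such that $N(s)\ge -cs^p$ for $s$ large. **Assumptions on $V:\mathbb{R}^3\to\mathbb{R}$.** (V-i) $V$ is continuous and $V(x)\ge0$ for all $x$; (V-ii) $V(x)=V(x+Az)$ for all $x\in\mathbb{R}^3$, $z\in\mathbb{Z}^3$, where $A$ is an invertible $3\times3$ matrix. **System.** For real functions $u,S,\varphi$ and an $\mathbb{R}^3$-valued field $\mathbf{A}$ of $(x,t)$, with $q>0$ the coupling constant: (A) $-\frac12\Delta u+\frac12W'(u)+\left[\frac12|\nabla S-q\mathbf{A}|^2+\left(\frac{\partial S}{\partial t}+q\varphi+V(x)\right)\right]u=0$, (B) $-\nabla\cdot\left(\frac{\partial\mathbf{A}}{\partial t}+\nabla\varphi\right)=qu^2$, (C) $\nabla\times(\nabla\times\mathbf{A})+\frac{\partial}{\partial t}\left(\frac{\partial\mathbf{A}}{\partial t}+\nabla\varphi\right)=q(\nabla S-q\mathbf{A})u^2$. (Here the matter field is $\psi=ue^{iS}$;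 (B) and (C) imply the continuity equation $\partial_t(u^2)+\nabla\cdot[(\nabla S-q\mathbf{A})u^2]=0$.) **Phase space.** Set $\mathbf{E}=-\frac{\partial\mathbf{A}}{\partial t}-\nabla\varphi$, $\mathbf{H}=\nabla\times\mathbf{A}$, $\Theta=(\nabla S-q\mathbf{A})u$. States are $\mathbf{u}=(u,\Theta,\mathbf{E},\mathbf{H})$ in $$X=\{(u,\Theta,\mathbf{E},\mathbf{H})\in H^1(\mathbb{R}^3)\times L^2(\mathbb{R}^3)^9:\ \nabla\cdot\mathbf{E}=qu^2\},$$ with $\|\mathbf{u}\|^2=\int\left(|\nabla u|^2+2E_0u^2+\Theta^2+\mathbf{E}^2+\mathbf{H}^2\right)dx$ and distance $d(\mathbf{u},\mathbf{v})=\|\mathbf{u}-\mathbf{v}\|$. Standing assumption: the Cauchy problem for (A), (B), (C) is well posed in $X$; $\gamma_t:X\to X$, $t\in\mathbb{R}$, denotes the resulting time evolution. The energy $$E(\mathbf{u})=\int\left(\tfrac12|\nabla u|^2+V(x)u^2+W(u)+\tfrac12(\Theta^2+\mathbf{E}^2+\mathbf{H}^2)\right)dx$$ and the hylenic charge $C(\mathbf{u})=\int u^2dx$ are constants of the motion. The hylenic ratio is $\Lambda(\mathbf{u})=E(\mathbf{u})/C(\mathbf{u})$. **Solitons.** For $\tau\in\mathbb{R}^3$ let $(T_\tau\mathbf{u})(x)=\mathbf{u}(x-\tau)$. A set $\Gamma\subset X$ is $\mathcal{T}$-compact if every sequence $\mathbf{u}_n\in\Gamma$ has a subsequence $\mathbf{u}_{n_k}$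 and $\tau_k\in\mathbb{R}^3$ with $T_{\tau_k}\mathbf{u}_{n_k}$ convergent. $\Gamma$ is invariant if $\gamma_t\mathbf{u}\in\Gamma$ for all $\mathbf{u}\in\Gamma$, $t\in\mathbb{R}$. An invariant set $\Gamma$ is stable if for every $\varepsilon>0$ there is $\delta'>0$ such that $d(\mathbf{u},\Gamma)\le\delta'$ implies $d(\gamma_t\mathbf{u},\Gamma)\le\varepsilon$ for all $t\ge0$. A state $\mathbf{u}\in X$ is a soliton if $\mathbf{u}\in\Gamma$ for some $\Gamma\subset X$ (the soliton manifold) that is invariant, stable, $\mathcal{T}$-compact and satisfies $0\notin\Gamma$. A soliton is a hylomorphic soliton if its soliton manifold has the form $\Gamma=\{\mathbf{u}\in X: E(\mathbf{u})=e_0,\ |C(\mathbf{u})|=c_0\}$ with $e_0=\min\{E(\mathbf{u}): |C(\mathbf{u})|=c_0\}$. *)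

theory Defs
  imports "HOL-Analysis.Analysis"
begin

section \<open>Distributions and weak derivatives\<close>

definition dir_deriv :: "'a::euclidean_space \<Rightarrow> ('a \<Rightarrow> real) \<Rightarrow> 'a \<Rightarrow> real" where
  "dir_deriv b f = (\<lambda>x. frechet_derivative f (at x) b)"

text \<open>\<open>C\<^sup>\<infinity>\<close>: every iterated directional derivative exists and is again (Frechet) differentiable.\<close>

definition C_infinity :: "('a::euclidean_space \<Rightarrow> real) \<Rightarrow> bool" where
  "C_infinity f \<longleftrightarrow> (\<forall>bs x. foldr dir_deriv bs f differentiable (at x))"

definition test_function :: "('a::euclidean_space \<Rightarrow> real) \<Rightarrow> bool" where
  "test_function \<eta> \<longleftrightarrow> C_infinity \<eta> \<and> compact (closure {x. \<eta> x \<noteq> 0})"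

definition locally_integrable :: "('a::euclidean_space \<Rightarrow> real) \<Rightarrow> bool" where
  "locally_integrable f \<longleftrightarrow>
     f \<in> borel_measurable borel \<and> (\<forall>K. compact K \<longrightarrow> set_integrable lborel K f)"

text \<open>A distribution is represented by its action on test functions; two distributions are
  identified when they agree on all test functions.\<close>

type_synonym 'a distribution = "('a \<Rightarrow> real) \<Rightarrow> real"

definition distr_of :: "('a::euclidean_space \<Rightarrow> real) \<Rightarrow> 'a distribution" where
  "distr_of f \<eta> = (LINT x|lborel. f x * \<eta> x)"

definition distr_deriv :: "'a::euclidean_space \<Rightarrow> 'a distribution \<Rightarrow> 'a distribution" where
  "distr_deriv b T \<eta> = - T (dir_deriv b \<eta>)"

definition distr_eq :: "'a::euclidean_space distribution \<Rightarrow> 'a distribution \<Rightarrow> bool" where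
  "distr_eq S T \<longleftrightarrow> (\<forall>\<eta>. test_function \<eta> \<longrightarrow> S \<eta> = T \<eta>)"

definition has_weak_deriv ::
  "('a::euclidean_space \<Rightarrow> real) \<Rightarrow> 'a \<Rightarrow> ('a \<Rightarrow> real) \<Rightarrow> bool" where
  "has_weak_deriv f b g \<longleftrightarrow> locally_integrable f \<and> locally_integrable g \<and>
     distr_eq (distr_deriv b (distr_of f)) (distr_of g)"

text \<open>Vector operators on distributions. The family \<open>e\<close> consists of the three spatial directions:
  \<open>dx\<close> on \<open>\<real>\<^sup>3\<close>, and \<open>sx\<close> on space-time \<open>\<real>\<^sup>3 \<times> \<real>\<close>, whose time direction is \<open>st\<close>. Indices of
  type \<open>3\<close> are added modulo 3, so the curl formula below is the usual one.\<close>

definition dx :: "3 \<Rightarrow> real^3" where "dx i = axis i 1"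

definition sx :: "3 \<Rightarrow> (real^3) \<times> real" where "sx i = (axis i 1, 0)"

definition st :: "(real^3) \<times> real" where "st = (0, 1)"

definition distr_laplacian ::
  "(3 \<Rightarrow> 'a::euclidean_space) \<Rightarrow> 'a distribution \<Rightarrow> 'a distribution" where
  "distr_laplacian e T \<eta> = (\<Sum>i\<in>UNIV. distr_deriv (e i) (distr_deriv (e i) T) \<eta>)"

definition distr_div ::
  "(3 \<Rightarrow> 'a::euclidean_space) \<Rightarrow> (3 \<Rightarrow> 'a distribution) \<Rightarrow> 'a distribution" where
  "distr_div e F \<eta> = (\<Sum>i\<in>UNIV. distr_deriv (e i) (F i) \<eta>)"

definition distr_curl ::
  "(3 \<Rightarrow> 'a::euclidean_space) \<Rightarrow> (3 \<Rightarrow> 'a distribution) \<Rightarrow> 3 \<Rightarrow> 'a distribution" where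
  "distr_curl e F i \<eta> =
     distr_deriv (e (i + 1)) (F (i + 2)) \<eta> - distr_deriv (e (i + 2)) (F (i + 1)) \<eta>"

definition distr_of_vec :: "('a::euclidean_space \<Rightarrow> real^3) \<Rightarrow> 3 \<Rightarrow> 'a distribution" where
  "distr_of_vec F i = distr_of (\<lambda>x. F x $ i)"

definition has_weak_grad :: "(real^3 \<Rightarrow> real) \<Rightarrow> (real^3 \<Rightarrow> real^3) \<Rightarrow> bool" where
  "has_weak_grad f g \<longleftrightarrow> (\<forall>i. has_weak_deriv f (dx i) (\<lambda>x. g x $ i))"

text \<open>The weak gradient is determined only almost everywhere; \<open>weak_grad\<close> picks a version.\<close>

definition weak_grad :: "(real^3 \<Rightarrow> real) \<Rightarrow> real^3 \<Rightarrow> real^3" where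
  "weak_grad f = (SOME g. has_weak_grad f g)"

definition L2 :: "(real^3 \<Rightarrow> 'b::euclidean_space) \<Rightarrow> bool" where
  "L2 f \<longleftrightarrow> f \<in> borel_measurable borel \<and> integrable lborel (\<lambda>x. (norm (f x))\<^sup>2)"

definition L2_norm :: "(real^3 \<Rightarrow> 'b::euclidean_space) \<Rightarrow> real" where
  "L2_norm f = sqrt (LINT x|lborel. (norm (f x))\<^sup>2)"

definition H1 :: "(real^3 \<Rightarrow> real) \<Rightarrow> bool" where
  "H1 f \<longleftrightarrow> L2 f \<and> (\<exists>g. has_weak_grad f g \<and> L2 g)"


section \<open>Assumptions on the nonlinearity and the potential\<close>

text \<open>\<open>W\<close> is given on \<open>[0,\<infinity>)\<close> and extended evenly, so that \<open>deriv W\<close> is odd. Regularity is imposed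
  on \<open>[0,\<infinity>)\<close>, with one-sided derivatives at 0; as \<open>W'(0) = 0\<close>, the even extension is \<open>C\<^sup>2\<close> on \<open>\<real>\<close>.\<close>

definition even_extended :: "(real \<Rightarrow> real) \<Rightarrow> bool" where
  "even_extended W \<longleftrightarrow> (\<forall>s. W s = W \<bar>s\<bar>)"

definition W_i :: "real \<Rightarrow> (real \<Rightarrow> real) \<Rightarrow> bool" where
  "W_i E0 W \<longleftrightarrow> (\<exists>W1 W2.
     (\<forall>s\<ge>0. (W has_real_derivative W1 s) (at s within {0..})) \<and>
     (\<forall>s\<ge>0. (W1 has_real_derivative W2 s) (at s within {0..})) \<and>
     continuous_on {0..} W2 \<and>
     W 0 = 0 \<and> W1 0 = 0 \<and> W2 0 = 2 * E0 \<and> 2 * E0 > 0)"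

definition N_of :: "real \<Rightarrow> (real \<Rightarrow> real) \<Rightarrow> real \<Rightarrow> real" where
  "N_of E0 W s = W s - E0 * s\<^sup>2"

definition W_ii :: "real \<Rightarrow> (real \<Rightarrow> real) \<Rightarrow> (real^3 \<Rightarrow> real) \<Rightarrow> bool" where
  "W_ii E0 W V \<longleftrightarrow> (\<exists>s0>0. N_of E0 W s0 < - (SUP x. V x) * s0\<^sup>2)"

definition W_iii :: "real \<Rightarrow> (real \<Rightarrow> real) \<Rightarrow> bool" where
  "W_iii E0 W \<longleftrightarrow> (\<exists>r\<in>{2<..<6}. \<exists>l\<in>{2<..<6}. \<exists>c1 c2. \<forall>s\<ge>0.
     \<bar>deriv (N_of E0 W) s\<bar> \<le> c1 * s powr (r - 1) + c2 * s powr (l - 1))"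

definition W_iv :: "real \<Rightarrow> (real \<Rightarrow> real) \<Rightarrow> bool" where
  "W_iv E0 W \<longleftrightarrow> (\<exists>c\<ge>0. \<exists>p. 2 < p \<and> p < 2 + 4 / 3 \<and>
     (\<forall>\<^sub>F s in at_top. N_of E0 W s \<ge> - c * s powr p))"

definition V_i :: "(real^3 \<Rightarrow> real) \<Rightarrow> bool" where
  "V_i V \<longleftrightarrow> continuous_on UNIV V \<and> (\<forall>x. V x \<ge> 0)"

definition V_ii :: "real^3^3 \<Rightarrow> (real^3 \<Rightarrow> real) \<Rightarrow> bool" where
  "V_ii M V \<longleftrightarrow> invertible M \<and> (\<forall>x z. (\<forall>i. z $ i \<in> \<int>) \<longrightarrow> V x = V (x + M *v z))"


section \<open>Phase space\<close>

text \<open>States are represented by functions; elements of the phase space proper are their classes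
  modulo \<open>state_eq\<close>, which on \<open>X\<close> is the relation \<open>state_dist E0 x y = 0\<close>.\<close>

record state =
  amp :: "real^3 \<Rightarrow> real"
  cur :: "real^3 \<Rightarrow> real^3"
  elec :: "real^3 \<Rightarrow> real^3"
  magn :: "real^3 \<Rightarrow> real^3"

definition state_eq :: "state \<Rightarrow> state \<Rightarrow> bool" where
  "state_eq x y \<longleftrightarrow> (AE a in lborel. amp x a = amp y a \<and> cur x a = cur y a \<and>
     elec x a = elec y a \<and> magn x a = magn y a)"

definition state_diff :: "state \<Rightarrow> state \<Rightarrow> state" where
  "state_diff x y = \<lparr>amp = (\<lambda>a. amp x a - amp y a), cur = (\<lambda>a. cur x a - cur y a),
     elec = (\<lambda>a. elec x a - elec y a), magn = (\<lambda>a. magn x a - magn y a)\<rparr>"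

definition translate :: "real^3 \<Rightarrow> state \<Rightarrow> state" where
  "translate \<tau> x = \<lparr>amp = (\<lambda>a. amp x (a - \<tau>)), cur = (\<lambda>a. cur x (a - \<tau>)),
     elec = (\<lambda>a. elec x (a - \<tau>)), magn = (\<lambda>a. magn x (a - \<tau>))\<rparr>"

definition phase_space :: "real \<Rightarrow> state set" where
  "phase_space q = {x. H1 (amp x) \<and> L2 (cur x) \<and> L2 (elec x) \<and> L2 (magn x) \<and>
     distr_eq (distr_div dx (distr_of_vec (elec x))) (distr_of (\<lambda>a. q * (amp x a)\<^sup>2))}"

definition state_norm :: "real \<Rightarrow> state \<Rightarrow> real" where
  "state_norm E0 x = sqrt (LINT a|lborel. (norm (weak_grad (amp x) a))\<^sup>2 + 2 * E0 * (amp x a)\<^sup>2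
     + (norm (cur x a))\<^sup>2 + (norm (elec x a))\<^sup>2 + (norm (magn x a))\<^sup>2)"

definition state_dist :: "real \<Rightarrow> state \<Rightarrow> state \<Rightarrow> real" where
  "state_dist E0 x y = state_norm E0 (state_diff x y)"

definition set_dist :: "real \<Rightarrow> state \<Rightarrow> state set \<Rightarrow> real" where
  "set_dist E0 x \<Gamma> = (INF y\<in>\<Gamma>. state_dist E0 x y)"

definition energy :: "(real \<Rightarrow> real) \<Rightarrow> (real^3 \<Rightarrow> real) \<Rightarrow> state \<Rightarrow> real" where
  "energy W V x = (LINT a|lborel. 1/2 * (norm (weak_grad (amp x) a))\<^sup>2 + V a * (amp x a)\<^sup>2
     + W (amp x a) + 1/2 * ((norm (cur x a))\<^sup>2 + (norm (elec x a))\<^sup>2 + (norm (magn x a))\<^sup>2))"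

definition charge :: "state \<Rightarrow> real" where
  "charge x = (LINT a|lborel. (amp x a)\<^sup>2)"

definition hylenic_ratio :: "(real \<Rightarrow> real) \<Rightarrow> (real^3 \<Rightarrow> real) \<Rightarrow> state \<Rightarrow> real" where
  "hylenic_ratio W V x = energy W V x / charge x"


section \<open>The field equations and their Cauchy problem\<close>

text \<open>The fields \<open>u, S, \<phi>, A\<close> solve the system in the sense of distributions on space-time. The
  functions \<open>p\<close> and \<open>\<sigma>\<close> are the weak derivatives \<open>\<nabla>S\<close> and \<open>\<partial>\<^sub>tS\<close>; the family \<open>P\<close> is
  \<open>\<partial>\<^sub>tA + \<nabla>\<phi>\<close>, which in general is only a distribution. The last three conjuncts are the
  matter equation, the Gauss equation and the Ampere equation.\<close>

definition field_equations :: "(real \<Rightarrow> real) \<Rightarrow> (real^3 \<Rightarrow> real) \<Rightarrow> real \<Rightarrow>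
    ((real^3) \<times> real \<Rightarrow> real) \<Rightarrow> ((real^3) \<times> real \<Rightarrow> real) \<Rightarrow> ((real^3) \<times> real \<Rightarrow> real) \<Rightarrow>
    ((real^3) \<times> real \<Rightarrow> real^3) \<Rightarrow> ((real^3) \<times> real \<Rightarrow> real^3) \<Rightarrow>
    ((real^3) \<times> real \<Rightarrow> real) \<Rightarrow> bool" where
  "field_equations W V q u S \<phi> A p \<sigma> \<longleftrightarrow>
    (let P = (\<lambda>i \<eta>. distr_deriv st (distr_of_vec A i) \<eta> + distr_deriv (sx i) (distr_of \<phi>) \<eta>) in
     locally_integrable u \<and> locally_integrable \<phi> \<and> (\<forall>i. locally_integrable (\<lambda>z. A z $ i)) \<and>
     (\<forall>i. has_weak_deriv S (sx i) (\<lambda>z. p z $ i)) \<and> has_weak_deriv S st \<sigma> \<and>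
     locally_integrable (\<lambda>z. deriv W (u z)) \<and>
     locally_integrable (\<lambda>z. (norm (p z - q *\<^sub>R A z))\<^sup>2 * u z) \<and>
     locally_integrable (\<lambda>z. (\<sigma> z + q * \<phi> z + V (fst z)) * u z) \<and>
     locally_integrable (\<lambda>z. (u z)\<^sup>2) \<and>
     (\<forall>i. locally_integrable (\<lambda>z. (p z - q *\<^sub>R A z) $ i * (u z)\<^sup>2)) \<and>
     distr_eq
       (\<lambda>\<eta>. - 1/2 * distr_laplacian sx (distr_of u) \<eta>
         + distr_of (\<lambda>z. 1/2 * deriv W (u z)
             + (1/2 * (norm (p z - q *\<^sub>R A z))\<^sup>2 + (\<sigma> z + q * \<phi> z + V (fst z))) * u z) \<eta>)
       (\<lambda>\<eta>. 0) \<and>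
     distr_eq (\<lambda>\<eta>. - distr_div sx P \<eta>) (distr_of (\<lambda>z. q * (u z)\<^sup>2)) \<and>
     (\<forall>i. distr_eq
       (\<lambda>\<eta>. distr_curl sx (distr_curl sx (distr_of_vec A)) i \<eta> + distr_deriv st (P i) \<eta>)
       (distr_of (\<lambda>z. q * (p z - q *\<^sub>R A z) $ i * (u z)\<^sup>2))))"

text \<open>A curve \<open>U\<close> in phase space is generated by \<open>(S, \<phi>, A)\<close> if these solve the equations with
  \<open>u = amp (U t)\<close>, and \<open>\<Theta> = (\<nabla>S - qA)u\<close>, \<open>E = -\<partial>\<^sub>tA - \<nabla>\<phi>\<close>, \<open>H = \<nabla> \<times> A\<close>.\<close>

definition solves :: "real \<Rightarrow> (real \<Rightarrow> real) \<Rightarrow> (real^3 \<Rightarrow> real) \<Rightarrow> real \<Rightarrow> (real \<Rightarrow> state) \<Rightarrow>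
    ((real^3) \<times> real \<Rightarrow> real) \<Rightarrow> ((real^3) \<times> real \<Rightarrow> real) \<Rightarrow> ((real^3) \<times> real \<Rightarrow> real^3) \<Rightarrow> bool" where
  "solves E0 W V q U S \<phi> A \<longleftrightarrow>
    (\<forall>t. U t \<in> phase_space q) \<and>
    (\<forall>t. ((\<lambda>s. state_dist E0 (U s) (U t)) \<longlongrightarrow> 0) (at t)) \<and>
    (\<exists>p \<sigma>. field_equations W V q (\<lambda>(x, t). amp (U t) x) S \<phi> A p \<sigma> \<and>
       (AE (x, t) in lborel. cur (U t) x = amp (U t) x *\<^sub>R (p (x, t) - q *\<^sub>R A (x, t)))) \<and>
    (\<forall>i. locally_integrable (\<lambda>(x, t). elec (U t) x $ i) \<and>
       distr_eq (distr_of (\<lambda>(x, t). elec (U t) x $ i))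
         (\<lambda>\<eta>. - distr_deriv st (distr_of_vec A i) \<eta> - distr_deriv (sx i) (distr_of \<phi>) \<eta>)) \<and>
    (\<forall>i. locally_integrable (\<lambda>(x, t). magn (U t) x $ i) \<and>
       distr_eq (distr_of (\<lambda>(x, t). magn (U t) x $ i)) (distr_curl sx (distr_of_vec A) i))"

text \<open>Initial data that come from fields. The relations \<open>\<Theta> = (\<nabla>S - qA)u\<close> and \<open>H = \<nabla> \<times> A\<close> are
  constraints on the data (e.g. \<open>\<nabla> \<cdot> H = 0\<close>); \<open>E\<close> is not restricted further, since
  \<open>\<partial>\<^sub>tA\<close> is free at the initial time.\<close>

definition from_fields :: "real \<Rightarrow> state \<Rightarrow> bool" where
  "from_fields q x \<longleftrightarrow> (\<exists>S A p. has_weak_grad S p \<and> (\<forall>i. locally_integrable (\<lambda>a. A a $ i)) \<and>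
     (AE a in lborel. cur x a = amp x a *\<^sub>R (p a - q *\<^sub>R A a)) \<and>
     (\<forall>i. distr_eq (distr_of_vec (magn x) i) (distr_curl dx (distr_of_vec A) i)))"

text \<open>\<open>\<gamma>\<close> is the time evolution of the well-posed Cauchy problem in the phase space: it is a
  flow, continuous in time and in the datum; it conserves energy and charge; every datum
  coming from fields is continued by a solution lying on its orbit (existence); and every
  solution lies on a single orbit (uniqueness).\<close>

definition well_posed_evolution :: "real \<Rightarrow> (real \<Rightarrow> real) \<Rightarrow> (real^3 \<Rightarrow> real) \<Rightarrow> real \<Rightarrow>
    (real \<Rightarrow> state \<Rightarrow> state) \<Rightarrow> bool" where
  "well_posed_evolution E0 W V q \<gamma> \<longleftrightarrow>
    (\<forall>t. \<forall>x\<in>phase_space q. \<gamma> t x \<in> phase_space q) \<and>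
    (\<forall>x\<in>phase_space q. state_eq (\<gamma> 0 x) x) \<and>
    (\<forall>s t. \<forall>x\<in>phase_space q. state_eq (\<gamma> (s + t) x) (\<gamma> s (\<gamma> t x))) \<and>
    (\<forall>t. \<forall>x\<in>phase_space q. ((\<lambda>s. state_dist E0 (\<gamma> s x) (\<gamma> t x)) \<longlongrightarrow> 0) (at t)) \<and>
    (\<forall>t. \<forall>x\<in>phase_space q. \<forall>\<epsilon>>0. \<exists>\<delta>>0. \<forall>y\<in>phase_space q.
       state_dist E0 x y < \<delta> \<longrightarrow> state_dist E0 (\<gamma> t x) (\<gamma> t y) < \<epsilon>) \<and>
    (\<forall>t. \<forall>x\<in>phase_space q. energy W V (\<gamma> t x) = energy W V x \<and> charge (\<gamma> t x) = charge x) \<and>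
    (\<forall>x\<in>phase_space q. from_fields q x \<longrightarrow>
       (\<exists>U S \<phi> A. solves E0 W V q U S \<phi> A \<and> (\<forall>t. state_eq (U t) (\<gamma> t x)))) \<and>
    (\<forall>U S \<phi> A. solves E0 W V q U S \<phi> A \<longrightarrow> (\<forall>t. state_eq (U t) (\<gamma> t (U 0))))"


section \<open>Solitons\<close>

definition T_compact :: "real \<Rightarrow> real \<Rightarrow> state set \<Rightarrow> bool" where
  "T_compact E0 q \<Gamma> \<longleftrightarrow> (\<forall>x :: nat \<Rightarrow> state. (\<forall>n. x n \<in> \<Gamma>) \<longrightarrow>
     (\<exists>k \<tau>. \<exists>y\<in>phase_space q. strict_mono (k :: nat \<Rightarrow> nat) \<and>
        (\<lambda>n. state_dist E0 (translate (\<tau> n) (x (k n))) y) \<longlonglongrightarrow> 0))"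

definition invariant_set :: "(real \<Rightarrow> state \<Rightarrow> state) \<Rightarrow> state set \<Rightarrow> bool" where
  "invariant_set \<gamma> \<Gamma> \<longleftrightarrow> (\<forall>x\<in>\<Gamma>. \<forall>t. \<gamma> t x \<in> \<Gamma>)"

definition stable_set :: "real \<Rightarrow> real \<Rightarrow> (real \<Rightarrow> state \<Rightarrow> state) \<Rightarrow> state set \<Rightarrow> bool" where
  "stable_set E0 q \<gamma> \<Gamma> \<longleftrightarrow> (\<forall>\<epsilon>>0. \<exists>\<delta>'>0. \<forall>x\<in>phase_space q.
     set_dist E0 x \<Gamma> \<le> \<delta>' \<longrightarrow> (\<forall>t\<ge>0. set_dist E0 (\<gamma> t x) \<Gamma> \<le> \<epsilon>))"

text \<open>\<open>0 \<notin> \<Gamma>\<close> is expressed through the norm, because states are representatives.\<close>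

definition soliton_manifold :: "real \<Rightarrow> real \<Rightarrow> (real \<Rightarrow> state \<Rightarrow> state) \<Rightarrow> state set \<Rightarrow> bool" where
  "soliton_manifold E0 q \<gamma> \<Gamma> \<longleftrightarrow> \<Gamma> \<subseteq> phase_space q \<and> invariant_set \<gamma> \<Gamma> \<and>
     stable_set E0 q \<gamma> \<Gamma> \<and> T_compact E0 q \<Gamma> \<and> (\<forall>x\<in>\<Gamma>. state_norm E0 x \<noteq> 0)"

definition hylomorphic_soliton :: "real \<Rightarrow> (real \<Rightarrow> real) \<Rightarrow> (real^3 \<Rightarrow> real) \<Rightarrow> real \<Rightarrow>
    (real \<Rightarrow> state \<Rightarrow> state) \<Rightarrow> state \<Rightarrow> bool" where
  "hylomorphic_soliton E0 W V q \<gamma> x \<longleftrightarrow> (\<exists>\<Gamma> e0 c0. x \<in> \<Gamma> \<and> soliton_manifold E0 q \<gamma> \<Gamma> \<and>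
     \<Gamma> = {y \<in> phase_space q. energy W V y = e0 \<and> \<bar>charge y\<bar> = c0} \<and>
     (\<exists>y\<in>phase_space q. \<bar>charge y\<bar> = c0 \<and> energy W V y = e0) \<and>
     (\<forall>y\<in>phase_space q. \<bar>charge y\<bar> = c0 \<longrightarrow> e0 \<le> energy W V y))"


section \<open>The Schroedinger--Poisson system\<close>

definition schroedinger_poisson :: "(real \<Rightarrow> real) \<Rightarrow> (real^3 \<Rightarrow> real) \<Rightarrow> real \<Rightarrow> real \<Rightarrow>
    (real^3 \<Rightarrow> real) \<Rightarrow> (real^3 \<Rightarrow> real) \<Rightarrow> bool" where
  "schroedinger_poisson W V q \<omega> u \<phi> \<longleftrightarrow>
     locally_integrable u \<and> locally_integrable \<phi> \<and> locally_integrable (\<lambda>x. (u x)\<^sup>2) \<and>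
     locally_integrable (\<lambda>x. V x * u x) \<and> locally_integrable (\<lambda>x. deriv W (u x)) \<and>
     locally_integrable (\<lambda>x. \<phi> x * u x) \<and>
     distr_eq
       (\<lambda>\<eta>. - 1/2 * distr_laplacian dx (distr_of u) \<eta>
         + distr_of (\<lambda>x. V x * u x + 1/2 * deriv W (u x) + q * \<phi> x * u x) \<eta>)
       (distr_of (\<lambda>x. - \<omega> * u x)) \<and>
     distr_eq (\<lambda>\<eta>. - distr_laplacian dx (distr_of \<phi>) \<eta>) (distr_of (\<lambda>x. q * (u x)\<^sup>2))"

end

theory Submission
  imports Defs "HOL-Computational_Algebra.Polynomial"
begin

text \<open>A hylomorphic soliton minimises the energy among the states of the same charge. Dropping
  \<open>\<Theta>\<close> and \<open>H\<close> keeps the charge and lowers the energy, so both vanish. Adding a divergence-free field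
  to \<open>E\<close> is also admissible, so \<open>E\<close> is orthogonal to all such fields. With the Newtonian kernel
  \<open>G w = w / (4 \<pi> |w|\<^sup>3)\<close> put \<open>\<phi> y = \<integral> G (x - y) \<bullet> E x dx\<close>; by duality \<open>\<integral> \<phi> h = \<integral> E \<bullet> (G * h)\<close>, and since
  \<open>div (G * h) = h\<close>, the field \<open>G * \<partial>\<^sub>i\<eta> - \<eta> e\<^sub>i\<close> is divergence-free, which gives \<open>E = - \<nabla>\<phi>\<close>. Varying \<open>u\<close> to
  \<open>\<mu> (u + s \<eta>)\<close> and correcting \<open>E\<close> by \<open>G * (2 q s u \<eta> + q s\<^sup>2 \<eta>\<^sup>2)\<close> respects both constraints and yields the
  Schroedinger equation, the multiplier of the charge being \<open>\<omega>\<close>. Finiteness of the energy terms needs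
  \<open>H\<^sup>1 \<subseteq> L\<^sup>r\<close> for \<open>2 < r < 6\<close>, which follows from \<open>u = \<Sum>\<^sub>i G\<^sub>i * \<partial>\<^sub>iu\<close> and Young's inequality. The stationary fields
  thus solve the evolution equations, and uniqueness shows that the flow fixes the soliton.\<close>

subsection \<open>Calculus of smooth functions\<close>

text \<open>The obstacle is low regularity: \<open>E\<close> is merely in L2, and the kernel, of
  size \<open>|w|^-2\<close>, is in no Lp on the whole space, since near 0 it asks for p < 3/2 and
  at infinity for p > 3/2. It is therefore cut at \<open>|w| = 1\<close>. The near part is in L1 and
  acts on L2, the far part is in L2 and acts on L1, so pairings of an L2 function with the
  convolution of a function in both spaces converge absolutely; potentials and divergences are
  handled through such pairings. The border 3/2 is also that of the embedding:
  \<open>q = 2 r / (r + 2)\<close> is below 3/2 exactly for \<open>r < 6\<close>. Both constraints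
  are solved exactly along an explicit curve, so the multiplier is a computed number: the rate of
  the energy, per charge, under dilation. Two conventions shape the comparison of energies:
  \<open>energy\<close> uses an arbitrary version of the weak gradient, and a divergent integral has
  the value 0. Hence the uniqueness almost everywhere and the integrability of every single term.
  Time enters only through the phase \<open>S = \<omega> t\<close>, and Fubini reduces the equations
  on space-time to time slices of the test function.\<close>

lemma C_infinity_differentiable: "C_infinity f \<Longrightarrow> f differentiable (at x)"
  unfolding C_infinity_def by (metis foldr_Nil id_apply)

lemma C_infinity_dir_deriv: "C_infinity f \<Longrightarrow> C_infinity (dir_deriv b f)"
  unfolding C_infinity_def
proof (intro allI)
  fix bs x assume "\<forall>bs x. foldr dir_deriv bs f differentiable at x"
  then have "foldr dir_deriv (bs @ [b]) f differentiable at x" by blast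
  then show "foldr dir_deriv bs (dir_deriv b f) differentiable at x" by simp
qed

text \<open>\<open>C_infinity\<close> quantifies over iterated derivatives, so closure under an
  operation is hard to prove one derivative at a time. It is enough to find some class of
  differentiable functions that contains \<open>f\<close> and is mapped into itself by every
  \<open>dir_deriv b\<close>.\<close>

lemma C_infinity_coinduct:
  assumes "P f" and "\<And>g x. P g \<Longrightarrow> g differentiable (at x)" and "\<And>g b. P g \<Longrightarrow> P (dir_deriv b g)"
  shows "C_infinity f"
proof -
  have "P (foldr dir_deriv bs f)" for bs
    by (induction bs) (auto simp: assms)
  then show ?thesis using assms(2) by (auto simp: C_infinity_def)
qed

lemma has_derivative_dir_deriv:
  "f differentiable (at x) \<Longrightarrow> (f has_derivative (\<lambda>b. dir_deriv b f x)) (at x)"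
  unfolding dir_deriv_def by (simp add: frechet_derivative_works)

lemma dir_deriv_eqI: "(f has_derivative f') (at x) \<Longrightarrow> dir_deriv b f x = f' b"
  by (metis dir_deriv_def frechet_derivative_at)

lemma dir_deriv_scaleR_direction:
  "f differentiable (at x) \<Longrightarrow> dir_deriv (c *\<^sub>R b) f x = c * dir_deriv b f x"
  using linear_scale[OF has_derivative_linear[OF has_derivative_dir_deriv[of f x]]] by simp

lemma dir_deriv_mult:
  assumes "f differentiable (at x)" "g differentiable (at x)"
  shows "dir_deriv b (\<lambda>x. f x * g x) x = f x * dir_deriv b g x + dir_deriv b f x * g x"
  by (rule dir_deriv_eqI[OF has_derivative_mult[OF assms[THEN has_derivative_dir_deriv]]])

lemma dir_deriv_add:
  assumes "f differentiable (at x)" "g differentiable (at x)"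
  shows "dir_deriv b (\<lambda>x. f x + g x) x = dir_deriv b f x + dir_deriv b g x"
  by (rule dir_deriv_eqI[OF has_derivative_add[OF assms[THEN has_derivative_dir_deriv]]])

text \<open>By the Leibniz rule the derivative of a product is a sum of two products; finite sums of
  products are closed under \<open>dir_deriv\<close>, as the coinduction for
  \<open>C_infinity_mult\<close> requires.\<close>

inductive sum_of_products :: "('a::euclidean_space \<Rightarrow> real) \<Rightarrow> bool" where
  prod: "C_infinity f \<Longrightarrow> C_infinity g \<Longrightarrow> sum_of_products (\<lambda>x. f x * g x)"
| sum: "sum_of_products f \<Longrightarrow> sum_of_products g \<Longrightarrow> sum_of_products (\<lambda>x. f x + g x)"

lemma sum_of_products_differentiable: "sum_of_products f \<Longrightarrow> f differentiable (at x)"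
  by (induction rule: sum_of_products.induct)
     (simp_all add: C_infinity_differentiable)

lemma sum_of_products_dir_deriv: "sum_of_products f \<Longrightarrow> sum_of_products (dir_deriv b f)"
proof (induction rule: sum_of_products.induct)
  case (prod f g)
  then have "dir_deriv b (\<lambda>x. f x * g x) = (\<lambda>x. f x * dir_deriv b g x + dir_deriv b f x * g x)"
    by (auto simp: dir_deriv_mult C_infinity_differentiable)
  then show ?case using prod by (auto intro!: sum_of_products.intros C_infinity_dir_deriv)
next
  case (sum f g)
  then have "dir_deriv b (\<lambda>x. f x + g x) = (\<lambda>x. dir_deriv b f x + dir_deriv b g x)"
    by (auto simp: dir_deriv_add sum_of_products_differentiable)
  then show ?case using sum by (auto intro: sum_of_products.intros)
qed

lemma C_infinity_mult:
  assumes "C_infinity f" "C_infinity g" shows "C_infinity (\<lambda>x. f x * g x)"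
  by (rule C_infinity_coinduct[OF sum_of_products.prod[OF assms]
        sum_of_products_differentiable sum_of_products_dir_deriv])

lemma C_infinity_const: "C_infinity (\<lambda>x::'a::euclidean_space. c)"
proof (rule C_infinity_coinduct[where P = "\<lambda>g. \<exists>c. g = (\<lambda>_. c)"])
  fix g :: "'a \<Rightarrow> real" and b assume "\<exists>c. g = (\<lambda>_. c)"
  then obtain c where g: "g = (\<lambda>_. c)" by blast
  have "dir_deriv b g = (\<lambda>_. 0)"
    unfolding g by (rule ext) (rule dir_deriv_eqI[OF has_derivative_const])
  then show "\<exists>c. dir_deriv b g = (\<lambda>_. c)" by blast
qed auto

lemma C_infinity_prod:
  assumes "finite I" "\<And>i. i \<in> I \<Longrightarrow> C_infinity (f i)"
  shows "C_infinity (\<lambda>x. \<Prod>i\<in>I. f i x)"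
  using assms by (induction I) (auto intro: C_infinity_mult C_infinity_const)

lemma has_derivative_affine_comp:
  assumes f: "f differentiable (at (a + L x))" and L: "bounded_linear L"
  shows "((\<lambda>x. f (a + L x)) has_derivative (\<lambda>b. dir_deriv (L b) f (a + L x))) (at x)"
proof -
  have "((\<lambda>x. a + L x) has_derivative L) (at x)"
    using L by (auto intro!: derivative_eq_intros bounded_linear_imp_has_derivative)
  from diff_chain_at[OF this has_derivative_dir_deriv[OF f]]
  show ?thesis by (simp add: o_def)
qed

lemma dir_deriv_affine_comp:
  assumes f: "f differentiable (at (a + L x))" and L: "bounded_linear L"
  shows "dir_deriv b (\<lambda>x. f (a + L x)) x = dir_deriv (L b) f (a + L x)"
  by (rule dir_deriv_eqI[OF has_derivative_affine_comp[OF assms]])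

text \<open>The class \<open>g (a + L x)\<close> with smooth \<open>g\<close> is closed under
  derivatives, because the direction \<open>b\<close> merely becomes \<open>L b\<close>.
  Translations, and slices of space-time test functions at a fixed time or place, are the cases
  used.\<close>

lemma C_infinity_affine_comp:
  fixes f :: "'a::euclidean_space \<Rightarrow> real" and L :: "'b::euclidean_space \<Rightarrow> 'a"
  assumes f: "C_infinity f" and L: "bounded_linear L"
  shows "C_infinity (\<lambda>x. f (a + L x))"
proof (rule C_infinity_coinduct[where P = "\<lambda>h. \<exists>g. C_infinity g \<and> h = (\<lambda>x. g (a + L x))"])
  fix h :: "'b \<Rightarrow> real" and b x assume "\<exists>g. C_infinity g \<and> h = (\<lambda>x. g (a + L x))"
  then obtain g where g: "C_infinity g" "h = (\<lambda>x. g (a + L x))" by blast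
  show "h differentiable (at x)"
    using has_derivative_affine_comp[OF C_infinity_differentiable[OF g(1)] L]
    unfolding g(2) differentiable_def by blast
  have "dir_deriv b h = (\<lambda>x. dir_deriv (L b) g (a + L x))"
    using g by (auto simp: dir_deriv_affine_comp[OF C_infinity_differentiable[OF g(1)] L])
  then show "\<exists>g. C_infinity g \<and> dir_deriv b h = (\<lambda>x. g (a + L x))"
    using C_infinity_dir_deriv[OF g(1)] by blast
qed (intro exI[of _ f] conjI f refl)

lemma C_infinity_continuous_on: "C_infinity f \<Longrightarrow> continuous_on S f"
  by (intro continuous_at_imp_continuous_on ballI differentiable_imp_continuous_within C_infinity_differentiable)

lemma C_infinity_measurable: "C_infinity f \<Longrightarrow> f \<in> borel_measurable borel"
  by (intro borel_measurable_continuous_onI C_infinity_continuous_on)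

subsection \<open>Test functions\<close>

lemma test_functionI:
  assumes "C_infinity f" "bounded S" "\<And>x. x \<notin> S \<Longrightarrow> f x = 0"
  shows "test_function f"
proof -
  have "bounded {x. f x \<noteq> 0}" by (rule bounded_subset[OF assms(2)]) (use assms(3) in auto)
  then show ?thesis using assms(1) by (auto simp: test_function_def compact_closure)
qed

lemma test_functionE:
  assumes "test_function f"
  obtains R where "R > 0" "\<And>x. norm x \<ge> R \<Longrightarrow> f x = 0"
proof -
  have "bounded {x. f x \<noteq> 0}" using assms by (auto simp: test_function_def compact_closure)
  then obtain R where R: "R > 0" "\<And>x. f x \<noteq> 0 \<Longrightarrow> norm x < R"
    by (auto simp: bounded_pos_less)
  show ?thesis using that[of R] R by force
qed

lemma test_function_C_infinity: "test_function f \<Longrightarrow> C_infinity f"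
  by (simp add: test_function_def)

lemma test_function_differentiable: "test_function f \<Longrightarrow> f differentiable (at x)"
  by (simp add: test_function_def C_infinity_differentiable)

lemma test_function_dir_deriv:
  fixes f :: "'a::euclidean_space \<Rightarrow> real"
  assumes f: "test_function f" shows "test_function (dir_deriv b f)"
proof -
  obtain R where R: "R > 0" "\<And>x. norm x \<ge> R \<Longrightarrow> f x = 0" by (rule test_functionE[OF f]) (rule that)
  show ?thesis
  proof (rule test_functionI)
    show "C_infinity (dir_deriv b f)" using f by (simp add: test_function_def C_infinity_dir_deriv)
    show "bounded (cball (0::'a) R)" by simp
    fix x :: 'a assume x: "x \<notin> cball 0 R"
    have "(f has_derivative (\<lambda>_. 0)) (at x)"
    proof (rule has_derivative_transform_within_open)
      show "((\<lambda>_. 0) has_derivative (\<lambda>_. 0)) (at x)" by simp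
      show "open (- cball 0 R)" by auto
    qed (use x R in auto)
    then show "dir_deriv b f x = 0" by (rule dir_deriv_eqI)
  qed
qed

lemma test_function_mult:
  assumes "test_function f" "C_infinity g" shows "test_function (\<lambda>x. f x * g x)"
proof -
  obtain R where R: "R > 0" "\<And>x. norm x \<ge> R \<Longrightarrow> f x = 0" by (rule test_functionE[OF assms(1)]) (rule that)
  show ?thesis
    by (rule test_functionI[where S = "ball 0 R"])
       (use R assms in \<open>auto intro: C_infinity_mult test_function_C_infinity\<close>)
qed

lemma test_function_translate:
  assumes "test_function f" shows "test_function (\<lambda>x. f (a + x))"
proof -
  obtain R where R: "R > 0" "\<And>x. norm x \<ge> R \<Longrightarrow> f x = 0" by (rule test_functionE[OF assms]) (rule that)
  show ?thesis
  proof (rule test_functionI)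
    show "C_infinity (\<lambda>x. f (a + x))"
      using C_infinity_affine_comp[OF test_function_C_infinity[OF assms] bounded_linear_ident] by simp
    show "bounded (ball (-a) R)" by simp
    fix x assume "x \<notin> ball (- a) R"
    then have "norm (a + x) \<ge> R" by (auto simp: dist_norm norm_minus_commute[of "-a"] add.commute)
    then show "f (a + x) = 0" using R by auto
  qed
qed

lemma test_function_measurable [measurable_dest]: "test_function f \<Longrightarrow> f \<in> borel_measurable borel"
  by (simp add: test_function_def C_infinity_measurable)

lemma dir_deriv_translate:
  assumes "f differentiable (at (a + x))"
  shows "dir_deriv b (\<lambda>x. f (a + x)) x = dir_deriv b f (a + x)"
  using dir_deriv_affine_comp[OF assms bounded_linear_ident] by simp

lemma test_function_bounded:
  assumes "test_function f"
  obtains C where "C > 0" "\<And>x. \<bar>f x\<bar> \<le> C"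
proof -
  obtain R where R: "R > 0" "\<And>x. norm x \<ge> R \<Longrightarrow> f x = 0" by (rule test_functionE[OF assms]) (rule that)
  have "bounded (f ` cball 0 R)"
    by (intro compact_imp_bounded compact_continuous_image C_infinity_continuous_on
        test_function_C_infinity assms) auto
  then obtain C where C: "C > 0" "\<And>x. norm x \<le> R \<Longrightarrow> \<bar>f x\<bar> \<le> C"
    unfolding bounded_pos by (auto)
  show ?thesis
  proof (rule that[OF C(1)])
    fix x show "\<bar>f x\<bar> \<le> C" using C R(2)[of x] by (cases "norm x \<le> R") auto
  qed
qed

lemma integrable_bounded_support:
  fixes f :: "'a::euclidean_space \<Rightarrow> 'b::{banach,second_countable_topology}"
  assumes [measurable]: "f \<in> borel_measurable borel"
    and R: "\<And>x. norm x \<ge> R \<Longrightarrow> f x = 0" and C: "\<And>x. norm (f x) \<le> C"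
  shows "integrable lborel f"
proof (rule Bochner_Integration.integrable_bound)
  show "integrable lborel (\<lambda>x. C * indicator (cball (0::'a) R) x)"
    by (intro integrable_mult_right integrable_real_indicator) (auto simp: emeasure_lborel_cball_finite[unfolded infinity_ennreal_def])
  show "AE x in lborel. norm (f x) \<le> norm (C * indicator (cball 0 R) x)"
  proof (rule AE_I2)
    fix x show "norm (f x) \<le> norm (C * indicator (cball 0 R) x)"
    proof (cases "norm x \<le> R")
      case False then show ?thesis using R[of x] by auto
    qed (use C[of x] in auto)
  qed
qed auto

lemma test_function_integrable: 
  assumes "test_function f" shows "integrable lborel f"
proof -
  obtain R where R: "R > 0" "\<And>x. norm x \<ge> R \<Longrightarrow> f x = 0" by (rule test_functionE[OF assms]) (rule that)
  obtain C where "C > 0" "\<And>x. \<bar>f x\<bar> \<le> C" by (rule test_function_bounded[OF assms]) (rule that)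
  then show ?thesis using R test_function_measurable[OF assms]
    by (intro integrable_bounded_support[where R=R and C=C]) auto
qed

lemma test_function_square: "test_function f \<Longrightarrow> test_function (\<lambda>x. (f x)\<^sup>2)"
  unfolding power2_eq_square by (intro test_function_mult test_function_C_infinity)

section \<open>Translation invariance and integration by parts\<close>

lemma nn_integral_translate:
  fixes a :: "'a::euclidean_space"
  assumes [measurable]: "f \<in> borel_measurable borel"
  shows "(\<integral>\<^sup>+x. f (a + x) \<partial>lborel) = (\<integral>\<^sup>+x. f x \<partial>lborel)"
  by (subst (2) lborel_distr_plus[of a, symmetric], subst nn_integral_distr) auto

lemma integral_translate:
  fixes a :: "'a::euclidean_space" and f :: "'a \<Rightarrow> 'b::{banach,second_countable_topology}"
  assumes [measurable]: "f \<in> borel_measurable borel"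
  shows "(\<integral>x. f (a + x) \<partial>lborel) = (\<integral>x. f x \<partial>lborel)"
  by (subst (2) lborel_distr_plus[of a, symmetric], subst integral_distr) auto

lemma integrable_translate:
  fixes a :: "'a::euclidean_space" and f :: "'a \<Rightarrow> 'b::{banach,second_countable_topology}"
  assumes "integrable lborel f"
  shows "integrable lborel (\<lambda>x. f (a + x))"
proof -
  have [measurable]: "f \<in> borel_measurable borel" using assms by auto
  have "integrable (distr lborel borel ((+) a)) f" using assms by (simp add: lborel_distr_plus)
  then show ?thesis by (subst (asm) integrable_distr_eq) auto
qed

text \<open>By translation invariance, \<open>\<integral>\<^sub>0\<^sup>1 \<integral> \<partial>\<^sub>b f (x + t b) dx dt = \<integral> (f (x + b) - f x) dx = 0\<close>.\<close>

lemma integral_dir_deriv: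
  fixes f :: "'a::euclidean_space \<Rightarrow> real"
  assumes f: "test_function f"
  shows "(\<integral>x. dir_deriv b f x \<partial>lborel) = 0"
proof -
  define d where "d = dir_deriv b f"
  have d: "test_function d" unfolding d_def by (rule test_function_dir_deriv[OF f])
  have [measurable]: "d \<in> borel_measurable borel" "f \<in> borel_measurable borel"
    using d f by auto
  obtain C where C: "C > 0" "\<And>x. \<bar>d x\<bar> \<le> C" by (rule test_function_bounded[OF d]) (rule that)
  have FTC: "(\<integral>t. indicator {0..1} t *\<^sub>R d (t *\<^sub>R b + x) \<partial>lborel) = f (b + x) - f x" for x
  proof -
    have "((\<lambda>t. f (t *\<^sub>R b + x)) has_vector_derivative d (t *\<^sub>R b + x)) (at t within {0..1})" for t
    proof -
      have L: "bounded_linear (\<lambda>t::real. t *\<^sub>R b)" by (rule bounded_linear_scaleR_left)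
      have "((\<lambda>t. f (x + t *\<^sub>R b)) has_derivative (\<lambda>s. dir_deriv (s *\<^sub>R b) f (x + t *\<^sub>R b))) (at t)"
        by (rule has_derivative_affine_comp[OF test_function_differentiable[OF f] L])
      then show ?thesis
        by (auto simp: has_vector_derivative_def d_def add.commute
            dir_deriv_scaleR_direction[OF test_function_differentiable[OF f]] intro: has_derivative_at_withinI)
    qed
    moreover have "continuous_on {0..1} (\<lambda>t. d (t *\<^sub>R b + x))"
      by (rule continuous_on_compose2[OF C_infinity_continuous_on[OF test_function_C_infinity[OF d], of UNIV]])
         (auto intro!: continuous_intros)
    ultimately show ?thesis
      by (subst integral_FTC_Icc[where F = "\<lambda>t. f (t *\<^sub>R b + x)"]) auto
  qed
  have int: "integrable (lborel \<Otimes>\<^sub>M lborel) (\<lambda>(t, x). indicator {0..1::real} t *\<^sub>R d (t *\<^sub>R b + x))"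
  proof (rule lborel_pair.Fubini_integrable)
    have eq: "(\<integral>x. norm (case (t, x) of (t, x) \<Rightarrow> indicator {0..1::real} t *\<^sub>R d (t *\<^sub>R b + x)) \<partial>lborel) =
        indicator {0..1} t * (\<integral>x. norm (d x) \<partial>lborel)" for t
      using integral_translate[of "\<lambda>x. norm (d x)" "t *\<^sub>R b"] by (simp add: abs_mult)
    show "integrable lborel (\<lambda>t. \<integral>x. norm (case (t, x) of (t, x) \<Rightarrow> indicator {0..1::real} t *\<^sub>R d (t *\<^sub>R b + x)) \<partial>lborel)"
      unfolding eq by (intro integrable_mult_left integrable_real_indicator) auto
    show "AE t in lborel. integrable lborel (\<lambda>x. case (t, x) of (t, x) \<Rightarrow> indicator {0..1::real} t *\<^sub>R d (t *\<^sub>R b + x))"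
      using integrable_translate[OF test_function_integrable[OF d]] by auto
  qed (simp add: split_beta')
  have "(\<integral>x. f (b + x) - f x \<partial>lborel) = (\<integral>t. (\<integral>x. indicator {0..1::real} t *\<^sub>R d (t *\<^sub>R b + x) \<partial>lborel) \<partial>lborel)"
    using lborel_pair.Fubini_integral[OF int] unfolding FTC by simp
  also have "\<dots> = (\<integral>t. indicator {0..1::real} t * (\<integral>x. d x \<partial>lborel) \<partial>lborel)"
    using integral_translate[of d] by simp
  also have "\<dots> = (\<integral>x. d x \<partial>lborel)" by simp
  also have "(\<integral>x. f (b + x) - f x \<partial>lborel) = 0"
    using test_function_integrable[OF f] integrable_translate[OF test_function_integrable[OF f]]
    by (subst Bochner_Integration.integral_diff) (auto simp: integral_translate)
  finally show ?thesis by (simp add: d_def)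
qed

lemma integral_dir_deriv_by_parts:
  assumes f: "test_function f" and g: "C_infinity g"
  shows "(\<integral>x. f x * dir_deriv b g x \<partial>lborel) = - (\<integral>x. dir_deriv b f x * g x \<partial>lborel)"
proof -
  have "0 = (\<integral>x. dir_deriv b (\<lambda>x. f x * g x) x \<partial>lborel)"
    by (rule integral_dir_deriv[symmetric, OF test_function_mult[OF f g]])
  also have "\<dots> = (\<integral>x. f x * dir_deriv b g x + dir_deriv b f x * g x \<partial>lborel)"
    by (simp add: dir_deriv_mult[OF test_function_differentiable[OF f] C_infinity_differentiable[OF g]])
  also have "\<dots> = (\<integral>x. f x * dir_deriv b g x \<partial>lborel) + (\<integral>x. dir_deriv b f x * g x \<partial>lborel)"
    by (intro Bochner_Integration.integral_add test_function_integrable test_function_mult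
        test_function_dir_deriv f g C_infinity_dir_deriv)
  finally show ?thesis by simp
qed

subsection \<open>Bump functions and the fundamental lemma of the calculus of variations\<close>

text \<open>The functions \<open>p (1/t) exp (-1/t)\<close>, cut off at 0, form a class closed under
  differentiation: \<open>p\<close> turns into \<open>X^2 (p - p')\<close>. Smoothness of a bump
  thus follows without any formula for higher derivatives.\<close>

definition flat :: "real poly \<Rightarrow> real \<Rightarrow> real" where
  "flat p t = (if t > 0 then poly p (1 / t) * exp (- (1 / t)) else 0)"

lemma poly_exp_tendsto_0: "((\<lambda>y::real. poly p y * exp (- y)) \<longlongrightarrow> 0) at_top"
proof -
  have *: "((\<lambda>y::real. y ^ k * exp (- y)) \<longlongrightarrow> 0) at_top" for k
    using tendsto_power_div_exp_0[of k] by (simp add: exp_minus field_simps)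
  have "((\<lambda>y::real. \<Sum>i\<le>degree p. coeff p i * (y ^ i * exp (- y))) \<longlongrightarrow> (\<Sum>i\<le>degree p. coeff p i * 0)) at_top"
    by (intro tendsto_sum tendsto_mult tendsto_const *)
  then show ?thesis by (simp add: poly_altdef sum_distrib_right mult.assoc)
qed

lemma flat_right_limit: "((\<lambda>t::real. flat p t) \<longlongrightarrow> 0) (at_right 0)"
proof -
  have "((\<lambda>t::real. poly p (inverse t) * exp (- inverse t)) \<longlongrightarrow> 0) (at_right 0)"
    by (rule filterlim_compose[OF poly_exp_tendsto_0 filterlim_inverse_at_top_right])
  moreover have "\<forall>\<^sub>F t in at_right 0. poly p (inverse t) * exp (- inverse t) = flat p t"
    by (auto simp: flat_def eventually_at_filter inverse_eq_divide)
  ultimately show ?thesis by (rule Lim_transform_eventually)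
qed

lemma flat_has_derivative:
  "(flat p has_real_derivative flat ([:0, 0, 1:] * (p - pderiv p)) t) (at t)"
proof -
  consider "t > 0" | "t < 0" | "t = 0" by linarith
  then show ?thesis
  proof cases
    case 1
    have "((\<lambda>t. poly p (1 / t) * exp (- (1 / t))) has_real_derivative
        flat ([:0, 0, 1:] * (p - pderiv p)) t) (at t)"
      using 1 by (auto intro!: derivative_eq_intros DERIV_chain2[OF poly_DERIV]
          simp: flat_def field_simps power2_eq_square)
    then show ?thesis
      by (rule DERIV_cong_ev[THEN iffD1, OF refl _ refl, rotated])
         (use 1 in \<open>auto simp: flat_def intro!: eventually_mono[OF eventually_nhds_in_open[of "{0<..}"]]\<close>)
  next
    case 2
    have "((\<lambda>t. 0) has_real_derivative flat ([:0, 0, 1:] * (p - pderiv p)) t) (at t)"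
      using 2 by (auto simp: flat_def)
    then show ?thesis
      by (rule DERIV_cong_ev[THEN iffD1, OF refl _ refl, rotated])
         (use 2 in \<open>auto simp: flat_def intro!: eventually_mono[OF eventually_nhds_in_open[of "{..<0}"]]\<close>)
  next
    case 3
    have "((\<lambda>h. (flat p (0 + h) - flat p 0) / h) \<longlongrightarrow> 0) (at 0)"
    proof (rule filterlim_split_at)
      have "\<forall>\<^sub>F h in at_left 0. 0 = (flat p (0 + h) - flat p 0) / h"
        by (auto simp: flat_def eventually_at_filter)
      then show "((\<lambda>h. (flat p (0 + h) - flat p 0) / h) \<longlongrightarrow> 0) (at_left 0)"
        by (rule Lim_transform_eventually[OF tendsto_const])
      \<comment> \<open>Dividing by \<open>h\<close> multiplies the polynomial by \<open>X\<close>,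
        so the difference quotient at 0 is again a flat function and tends to 0.\<close>
      have "\<forall>\<^sub>F h in at_right 0. flat ([:0, 1:] * p) h = (flat p (0 + h) - flat p 0) / h"
        by (auto simp: flat_def eventually_at_filter field_simps)
      then show "((\<lambda>h. (flat p (0 + h) - flat p 0) / h) \<longlongrightarrow> 0) (at_right 0)"
        by (rule Lim_transform_eventually[OF flat_right_limit])
    qed
    then show ?thesis using 3 by (simp add: DERIV_def flat_def)
  qed
qed

lemma C_infinity_flat: "C_infinity (\<lambda>x::'a::euclidean_space. flat p (a + v \<bullet> x))"
proof (rule C_infinity_coinduct[where P = "\<lambda>h. \<exists>p. h = (\<lambda>x. flat p (a + v \<bullet> x))"])
  fix h :: "'a \<Rightarrow> real" and b x assume "\<exists>p. h = (\<lambda>x. flat p (a + v \<bullet> x))"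
  then obtain p where h: "h = (\<lambda>x. flat p (a + v \<bullet> x))" by blast
  let ?q = "[:0, 0, 1:] * (p - pderiv p)"
  have D: "(h has_derivative (\<lambda>b. flat ?q (a + v \<bullet> x) * (v \<bullet> b))) (at x)" for x
  proof -
    have "((\<lambda>x. a + v \<bullet> x) has_derivative (\<lambda>b. v \<bullet> b)) (at x)"
      by (auto intro!: derivative_eq_intros)
    from diff_chain_at[OF this flat_has_derivative[of p "a + v \<bullet> x", unfolded has_field_derivative_def]]
    show ?thesis by (simp add: h o_def)
  qed
  then show "h differentiable (at x)" by (auto simp: differentiable_def)
  have "dir_deriv b h = (\<lambda>x. flat (smult (v \<bullet> b) ?q) (a + v \<bullet> x))"
    by (rule ext) (simp add: dir_deriv_eqI[OF D] flat_def)
  then show "\<exists>p. dir_deriv b h = (\<lambda>x. flat p (a + v \<bullet> x))" by (rule exI)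
qed (intro exI[of _ p] refl)

text \<open>The factor \<open>Suc n\<close> steepens each one-dimensional profile towards the
  indicator of the half-line, so the bumps stay between 0 and 1, vanish off the open box and
  converge to its indicator at every point.\<close>

definition box_bump :: "'a::euclidean_space \<Rightarrow> 'a \<Rightarrow> nat \<Rightarrow> 'a \<Rightarrow> real" where
  "box_bump a b n x = (\<Prod>i\<in>Basis. flat 1 (real (Suc n) * (x \<bullet> i - a \<bullet> i)) * flat 1 (real (Suc n) * (b \<bullet> i - x \<bullet> i)))"

lemma flat_1_bounds: "0 \<le> flat 1 t" "flat 1 t \<le> 1"
  by (auto simp: flat_def)

lemma flat_1_tendsto: "(\<lambda>n. flat 1 (real (Suc n) * t)) \<longlonglongrightarrow> indicator {0<..} t"
proof (cases "t > 0")
  case True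
  have "(\<lambda>n. exp (- (1 / real (Suc n) * (1 / t)))) \<longlonglongrightarrow> exp (- (0 * (1 / t)))"
    by (intro tendsto_exp tendsto_minus tendsto_mult tendsto_const LIMSEQ_Suc[OF lim_1_over_n])
  then show ?thesis using True by (simp add: flat_def)
next
  case False
  then have "flat 1 (real (Suc n) * t) = 0" for n
    by (auto simp: flat_def zero_less_mult_iff)
  then show ?thesis using False by simp
qed

lemma box_bump_bounds: "0 \<le> box_bump a b n x" "box_bump a b n x \<le> 1"
  unfolding box_bump_def
  by (auto intro!: prod_nonneg prod_le_1 mult_nonneg_nonneg mult_le_one flat_1_bounds)

lemma box_bump_outside: "x \<notin> box a b \<Longrightarrow> box_bump a b n x = 0"
  unfolding box_bump_def mem_box
  by (rule prod_zero) (auto simp: flat_def zero_less_mult_iff)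

lemma box_bump_tendsto: "(\<lambda>n. box_bump a b n x) \<longlonglongrightarrow> indicator (box a b) x"
proof -
  have "(\<lambda>n. box_bump a b n x) \<longlonglongrightarrow>
      (\<Prod>i\<in>Basis. indicator {0<..} (x \<bullet> i - a \<bullet> i) * indicator {0<..} (b \<bullet> i - x \<bullet> i))"
    unfolding box_bump_def by (intro tendsto_prod tendsto_mult flat_1_tendsto)
  also have "(\<Prod>i\<in>Basis. indicator {0<..} (x \<bullet> i - a \<bullet> i) * indicator {0<..} (b \<bullet> i - x \<bullet> i)) =
      (indicator (box a b) x :: real)"
    by (auto simp: indicator_def mem_box prod_zero_iff)
  finally show ?thesis .
qed

lemma test_function_box_bump: "test_function (box_bump a b n)"
proof (rule test_functionI[OF _ bounded_box box_bump_outside])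
  have *: "C_infinity (\<lambda>x::'a. flat 1 (real (Suc n) * (x \<bullet> i - a \<bullet> i)))" for i a
    using C_infinity_flat[of 1 "- real (Suc n) * (a \<bullet> i)" "real (Suc n) *\<^sub>R i"]
    by (simp add: algebra_simps inner_commute)
  have **: "C_infinity (\<lambda>x::'a. flat 1 (real (Suc n) * (b \<bullet> i - x \<bullet> i)))" for i
    using C_infinity_flat[of 1 "real (Suc n) * (b \<bullet> i)" "- real (Suc n) *\<^sub>R i"]
    by (simp add: algebra_simps inner_commute)
  show "C_infinity (box_bump a b n)"
    unfolding box_bump_def[abs_def] by (intro C_infinity_prod C_infinity_mult * **) auto
qed

text \<open>Dominated convergence along \<open>box_bump\<close>, with \<open>f\<close> on the closed
  box as the majorant, carries the orthogonality over from test functions to indicators.\<close>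

lemma integral_mult_box_eq_0:
  fixes f :: "'a::euclidean_space \<Rightarrow> real"
  assumes f: "locally_integrable f" and 0: "\<And>\<eta>. test_function \<eta> \<Longrightarrow> (LINT x|lborel. f x * \<eta> x) = 0"
  shows "(LINT x|lborel. f x * indicator (box a b) x) = 0"
proof -
  have [measurable]: "f \<in> borel_measurable borel" using f by (simp add: locally_integrable_def)
  have [measurable]: "box_bump a b n \<in> borel_measurable borel" for n
    by (rule test_function_measurable[OF test_function_box_bump])
  have "(\<lambda>n. LINT x|lborel. f x * box_bump a b n x) \<longlonglongrightarrow> (LINT x|lborel. f x * indicator (box a b) x)"
  proof (rule integral_dominated_convergence[where w = "\<lambda>x. norm (indicator (cbox a b) x *\<^sub>R f x)"])
    show "integrable lborel (\<lambda>x. norm (indicator (cbox a b) x *\<^sub>R f x))"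
      using f compact_cbox[of a b] unfolding locally_integrable_def set_integrable_def
      by (intro integrable_norm) auto
    show "AE x in lborel. norm (f x * box_bump a b n x) \<le> norm (indicator (cbox a b) x *\<^sub>R f x)" for n
    proof (rule AE_I2)
      fix x :: 'a
      show "norm (f x * box_bump a b n x) \<le> norm (indicator (cbox a b) x *\<^sub>R f x)"
      proof (cases "x \<in> box a b")
        case True
        then have "x \<in> cbox a b" using box_subset_cbox by blast
        then show ?thesis using box_bump_bounds[of a b n x]
          by (auto simp: abs_mult intro: mult_left_le)
      qed (auto simp: box_bump_outside)
    qed
    show "AE x in lborel. (\<lambda>n. f x * box_bump a b n x) \<longlonglongrightarrow> f x * indicator (box a b) x"
      by (auto intro!: tendsto_mult box_bump_tendsto)
  qed auto
  then show ?thesis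
    by (simp add: 0[OF test_function_box_bump] LIMSEQ_const_iff)
qed

text \<open>The positive and negative parts of \<open>g\<close> are densities of two measures that
  agree on open boxes, an intersection-stable generator of the Borel sets. The measures coincide, so
  the densities agree almost everywhere. As \<open>ennreal\<close> truncates negative values to 0,
  at most one of the two parts is nonzero at a point, and both vanish.\<close>

lemma AE_eq_0_if_box_integrals_eq_0:
  fixes g :: "'a::euclidean_space \<Rightarrow> real"
  assumes g: "integrable lborel g" and 0: "\<And>a b. (LINT x|lborel. g x * indicator (box a b) x) = 0"
  shows "AE x in lborel. g x = 0"
proof -
  have [measurable]: "g \<in> borel_measurable borel" using g by auto
  have nn: "(\<integral>\<^sup>+x. ennreal (h x) * indicator (box a b) x \<partial>lborel) =
      ennreal (LINT x|lborel. max 0 (h x) * indicator (box a b) x)"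
    if "integrable lborel h" for h and a b :: 'a
  proof -
    have "(\<integral>\<^sup>+x. ennreal (h x) * indicator (box a b) x \<partial>lborel) =
        (\<integral>\<^sup>+x. ennreal (max 0 (h x) * indicator (box a b) x) \<partial>lborel)"
      by (intro nn_integral_cong) (auto simp: indicator_def max_def ennreal_neg)
    also have "\<dots> = ennreal (LINT x|lborel. max 0 (h x) * indicator (box a b) x)"
      using that by (intro nn_integral_eq_integral integrable_real_mult_indicator integrable_max) auto
    finally show ?thesis .
  qed
  have eq: "emeasure (density lborel (\<lambda>x. ennreal (g x))) (box a b) =
      emeasure (density lborel (\<lambda>x. ennreal (- g x))) (box a b)" for a b
  proof -
    have "(LINT x|lborel. max 0 (g x) * indicator (box a b) x) - (LINT x|lborel. max 0 (- g x) * indicator (box a b) x)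
        = (LINT x|lborel. max 0 (g x) * indicator (box a b) x - max 0 (- g x) * indicator (box a b) x)"
      using g by (intro Bochner_Integration.integral_diff[symmetric] integrable_real_mult_indicator integrable_max) auto
    also have "\<dots> = (LINT x|lborel. g x * indicator (box a b) x)"
      by (intro Bochner_Integration.integral_cong) (auto simp: max_def indicator_def)
    finally show ?thesis
      using 0 nn[OF g] nn[of "\<lambda>x. - g x"] g by (simp add: emeasure_density)
  qed
  have "density lborel (\<lambda>x. ennreal (g x)) = density lborel (\<lambda>x. ennreal (- g x))"
  proof (rule measure_eqI_generator_eq)
    let ?E = "range (\<lambda>(a, b). box a b :: 'a set)"
    show "Int_stable ?E" by (auto simp: Int_stable_def box_Int_box)
    show "?E \<subseteq> Pow UNIV" by auto
    show "sets (density lborel (\<lambda>x. ennreal (g x))) = sigma_sets UNIV ?E"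
      "sets (density lborel (\<lambda>x. ennreal (- g x))) = sigma_sets UNIV ?E"
      by (simp_all add: borel_eq_box)
    let ?A = "\<lambda>n::nat. box (- (real n *\<^sub>R One)) (real n *\<^sub>R One) :: 'a set"
    show "range ?A \<subseteq> ?E" "(\<Union>i. ?A i) = UNIV" unfolding UN_box_eq_UNIV by auto
    show "emeasure (density lborel (\<lambda>x. ennreal (g x))) (?A i) \<noteq> \<infinity>" for i
      using nn[OF g] by (simp add: emeasure_density)
    show "emeasure (density lborel (\<lambda>x. ennreal (g x))) X = emeasure (density lborel (\<lambda>x. ennreal (- g x))) X"
      if "X \<in> ?E" for X using that eq by auto
  qed
  moreover have "(\<integral>\<^sup>+x. ennreal (g x) \<partial>lborel) \<noteq> \<infinity>"
  proof -
    have "(\<integral>\<^sup>+x. ennreal (g x) \<partial>lborel) \<le> (\<integral>\<^sup>+x. ennreal (norm (g x)) \<partial>lborel)"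
      by (intro nn_integral_mono ennreal_leI) auto
    also have "\<dots> < \<infinity>" using g by (simp add: integrable_iff_bounded)
    finally show ?thesis by simp
  qed
  ultimately have "AE x in lborel. ennreal (g x) = ennreal (- g x)"
    by (subst (asm) finite_density_unique) auto
  then show ?thesis
  proof eventually_elim
    case (elim x)
    then show ?case by (cases "g x" "0::real" rule: linorder_cases) (auto simp: ennreal_neg)
  qed
qed

text \<open>A locally integrable function is cut down to boxes that exhaust the space, where it is
  integrable. The cut-off is harmless since the intersection of two boxes is a box.\<close>

lemma fundamental_lemma_calculus_of_variations:
  fixes f :: "'a::euclidean_space \<Rightarrow> real"
  assumes f: "locally_integrable f" and 0: "\<And>\<eta>. test_function \<eta> \<Longrightarrow> (LINT x|lborel. f x * \<eta> x) = 0"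
  shows "AE x in lborel. f x = 0"
proof -
  let ?A = "\<lambda>n::nat. box (- (real n *\<^sub>R One)) (real n *\<^sub>R One) :: 'a set"
  have [measurable]: "f \<in> borel_measurable borel" using f by (simp add: locally_integrable_def)
  have "AE x in lborel. f x * indicator (?A n) x = 0" for n
  proof (rule AE_eq_0_if_box_integrals_eq_0)
    let ?C = "cbox (- (real n *\<^sub>R One)) (real n *\<^sub>R One) :: 'a set"
    have "integrable lborel (\<lambda>x. indicator ?C x *\<^sub>R f x)"
      using f compact_cbox[of "- (real n *\<^sub>R One)" "real n *\<^sub>R One :: 'a"]
      unfolding locally_integrable_def set_integrable_def by blast
    then show "integrable lborel (\<lambda>x. f x * indicator (?A n) x)"
    proof (rule Bochner_Integration.integrable_bound)
      show "AE x in lborel. norm (f x * indicator (?A n) x) \<le> norm (indicator ?C x *\<^sub>R f x)"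
        using box_subset_cbox by (intro AE_I2) (fastforce simp: indicator_def)
    qed auto
    fix a b :: 'a
    have "(LINT x|lborel. f x * indicator (?A n) x * indicator (box a b) x) =
        (LINT x|lborel. f x * indicator (?A n \<inter> box a b) x)"
      by (intro Bochner_Integration.integral_cong) (auto simp: indicator_def)
    then show "(LINT x|lborel. f x * indicator (?A n) x * indicator (box a b) x) = 0"
      using integral_mult_box_eq_0[OF f 0] by (simp only: box_Int_box)
  qed
  then have "AE x in lborel. \<forall>n. f x * indicator (?A n) x = 0"
    unfolding AE_all_countable by blast
  then show ?thesis
  proof eventually_elim
    case (elim x)
    have "x \<in> (\<Union>n. ?A n)" unfolding UN_box_eq_UNIV by simp
    then obtain n where "x \<in> ?A n" by blast
    then show ?case using elim[rule_format, of n] by simp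
  qed
qed

subsection \<open>Locally integrable and square integrable functions\<close>

lemma locally_integrable_measurable [measurable_dest]:
  "locally_integrable f \<Longrightarrow> f \<in> borel_measurable borel"
  by (simp add: locally_integrable_def)

lemma locally_integrable_set:
  "locally_integrable f \<Longrightarrow> compact K \<Longrightarrow> integrable lborel (\<lambda>x. indicator K x *\<^sub>R f x)"
  by (simp add: locally_integrable_def set_integrable_def)

lemma locally_integrableI:
  assumes "f \<in> borel_measurable borel" "\<And>K. compact K \<Longrightarrow> integrable lborel (\<lambda>x. indicator K x *\<^sub>R f x)"
  shows "locally_integrable f"
  using assms by (simp add: locally_integrable_def set_integrable_def)

lemma locally_integrable_bound:
  fixes f g :: "'a::euclidean_space \<Rightarrow> real"
  assumes g: "locally_integrable g" and [measurable]: "f \<in> borel_measurable borel"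
    and le: "\<And>x. \<bar>f x\<bar> \<le> \<bar>g x\<bar>"
  shows "locally_integrable f"
proof (rule locally_integrableI)
  fix K :: "'a set" assume K: "compact K"
  then have [measurable]: "K \<in> sets borel" by (simp add: borel_compact)
  show "integrable lborel (\<lambda>x. indicator K x *\<^sub>R f x)"
    by (rule Bochner_Integration.integrable_bound[OF locally_integrable_set[OF g K]])
       (use le in \<open>auto simp: indicator_def\<close>)
qed fact

lemma locally_integrable_add:
  "locally_integrable f \<Longrightarrow> locally_integrable g \<Longrightarrow> locally_integrable (\<lambda>x. f x + g x)"
  by (intro locally_integrableI)
     (auto simp: scaleR_add_right simp del: real_scaleR_def intro!: Bochner_Integration.integrable_add locally_integrable_set)

lemma locally_integrable_cmult:
  assumes f: "locally_integrable f" shows "locally_integrable (\<lambda>x. c * f x)"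
proof (rule locally_integrableI)
  fix K :: "'a set" assume K: "compact K"
  show "integrable lborel (\<lambda>x. indicator K x *\<^sub>R (c * f x))"
    using integrable_mult_right[OF locally_integrable_set[OF f K], of c] by (simp add: ac_simps)
qed (use f in measurable)

lemma integrable_imp_locally_integrable:
  assumes f: "integrable lborel f" shows "locally_integrable f"
proof (rule locally_integrableI)
  fix K :: "'a set" assume "compact K"
  then show "integrable lborel (\<lambda>x. indicator K x *\<^sub>R f x)"
    using f by (intro integrable_mult_indicator) (auto simp: borel_compact)
qed (use f in auto)

lemma continuous_imp_locally_integrable:
  assumes "continuous_on UNIV f" shows "locally_integrable f"
proof (rule locally_integrableI)
  show "f \<in> borel_measurable borel" using assms by (rule borel_measurable_continuous_onI)
  fix K :: "'a set" assume "compact K"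
  then show "integrable lborel (\<lambda>x. indicator K x *\<^sub>R f x)"
    using assms by (intro borel_integrable_compact) (auto intro: continuous_on_subset)
qed

lemma locally_integrable_times_test_function:
  assumes f: "locally_integrable f" and \<eta>: "test_function \<eta>"
  shows "integrable lborel (\<lambda>x. f x * \<eta> x)"
proof -
  obtain R where R: "R > 0" "\<And>x. norm x \<ge> R \<Longrightarrow> \<eta> x = 0" by (rule test_functionE[OF \<eta>]) (rule that)
  obtain C where C: "C > 0" "\<And>x. \<bar>\<eta> x\<bar> \<le> C" by (rule test_function_bounded[OF \<eta>]) (rule that)
  have [measurable]: "f \<in> borel_measurable borel" "\<eta> \<in> borel_measurable borel" using f \<eta> by auto
  show ?thesis
  proof (rule Bochner_Integration.integrable_bound)
    show "integrable lborel (\<lambda>x. C * (indicator (cball 0 R) x *\<^sub>R f x))"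
      by (intro integrable_mult_right locally_integrable_set f) auto
    show "AE x in lborel. norm (f x * \<eta> x) \<le> norm (C * (indicator (cball 0 R) x *\<^sub>R f x))"
    proof (rule AE_I2)
      fix x show "norm (f x * \<eta> x) \<le> norm (C * (indicator (cball 0 R) x *\<^sub>R f x))"
      proof (cases "norm x \<le> R")
        case True then show ?thesis using C(1) mult_left_mono[OF C(2)[of x], of "\<bar>f x\<bar>"]
          by (simp add: abs_mult mult.commute)
      next
        case False then show ?thesis using R(2)[of x] by simp
      qed
    qed
  qed auto
qed

lemma AE_eq_if_distr_eq:
  assumes "locally_integrable f" "locally_integrable g" "distr_eq (distr_of f) (distr_of g)"
  shows "AE x in lborel. f x = g x"
proof -
  have "AE x in lborel. f x + (- 1) * g x = 0"
  proof (rule fundamental_lemma_calculus_of_variations)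
    show "locally_integrable (\<lambda>x. f x + (- 1) * g x)"
      by (intro locally_integrable_add locally_integrable_cmult assms)
    fix \<eta> :: "'a \<Rightarrow> real" assume \<eta>: "test_function \<eta>"
    have "(LINT x|lborel. (f x + (- 1) * g x) * \<eta> x) = (LINT x|lborel. f x * \<eta> x - g x * \<eta> x)"
      by (simp add: algebra_simps)
    also have "\<dots> = 0"
      using assms(3) \<eta> by (subst Bochner_Integration.integral_diff)
        (auto intro: locally_integrable_times_test_function assms simp: distr_eq_def distr_of_def)
    finally show "(LINT x|lborel. (f x + (- 1) * g x) * \<eta> x) = 0" .
  qed
  then show ?thesis by simp
qed

section \<open>Square integrable functions and vector fields\<close>

lemma L2_measurable [measurable_dest]: "L2 f \<Longrightarrow> f \<in> borel_measurable borel"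
  by (simp add: L2_def)

lemma L2_integrable_square: "L2 f \<Longrightarrow> integrable lborel (\<lambda>x. (norm (f x))\<^sup>2)"
  by (simp add: L2_def)

lemma L2_bound:
  fixes f :: "real^3 \<Rightarrow> 'b::euclidean_space" and g :: "real^3 \<Rightarrow> 'c::euclidean_space"
  assumes g: "L2 g" and f [measurable]: "f \<in> borel_measurable borel" and le: "\<And>x. norm (f x) \<le> norm (g x)"
  shows "L2 f"
  unfolding L2_def
proof
  show "integrable lborel (\<lambda>x. (norm (f x))\<^sup>2)"
    by (rule Bochner_Integration.integrable_bound[OF L2_integrable_square[OF g]])
       (use le in \<open>auto intro!: power_mono\<close>)
qed fact

lemma L2_scaleR: "L2 f \<Longrightarrow> L2 (\<lambda>x. c *\<^sub>R f x)"
  by (auto simp: L2_def power_mult_distrib)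

lemma L2_add:
  assumes f: "L2 f" and g: "L2 g" shows "L2 (\<lambda>x. f x + g x)"
  unfolding L2_def
proof
  have [measurable]: "f \<in> borel_measurable borel" "g \<in> borel_measurable borel" using f g by auto
  show "(\<lambda>x. f x + g x) \<in> borel_measurable borel" by measurable
  show "integrable lborel (\<lambda>x. (norm (f x + g x))\<^sup>2)"
  proof (rule Bochner_Integration.integrable_bound)
    show "integrable lborel (\<lambda>x. 2 * (norm (f x))\<^sup>2 + 2 * (norm (g x))\<^sup>2)"
      by (intro Bochner_Integration.integrable_add integrable_mult_right L2_integrable_square f g)
    have "(norm (f x + g x))\<^sup>2 \<le> 2 * (norm (f x))\<^sup>2 + 2 * (norm (g x))\<^sup>2" for x
    proof -
      have "(norm (f x + g x))\<^sup>2 \<le> (norm (f x) + norm (g x))\<^sup>2"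
        by (intro power_mono norm_triangle_ineq) auto
      also have "\<dots> \<le> 2 * (norm (f x))\<^sup>2 + 2 * (norm (g x))\<^sup>2"
        using zero_le_power2[of "norm (f x) - norm (g x)"] by (simp add: power2_eq_square algebra_simps)
      finally show ?thesis .
    qed
    then show "AE x in lborel. norm ((norm (f x + g x))\<^sup>2) \<le> norm (2 * (norm (f x))\<^sup>2 + 2 * (norm (g x))\<^sup>2)"
      by (intro AE_I2) simp
  qed auto
qed

lemma L2_inner:
  assumes f: "L2 f" and g: "L2 g" shows "integrable lborel (\<lambda>x. f x \<bullet> g x)"
proof (rule Bochner_Integration.integrable_bound)
  have [measurable]: "f \<in> borel_measurable borel" "g \<in> borel_measurable borel" using f g by auto
  show "integrable lborel (\<lambda>x. (norm (f x))\<^sup>2 + (norm (g x))\<^sup>2)"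
    by (intro Bochner_Integration.integrable_add L2_integrable_square f g)
  have "\<bar>f x \<bullet> g x\<bar> \<le> (norm (f x))\<^sup>2 + (norm (g x))\<^sup>2" for x
  proof -
    have "\<bar>f x \<bullet> g x\<bar> \<le> norm (f x) * norm (g x)" by (rule Cauchy_Schwarz_ineq2)
    also have "\<dots> \<le> (norm (f x))\<^sup>2 + (norm (g x))\<^sup>2"
      using sum_squares_bound[of "norm (f x)" "norm (g x)"] mult_nonneg_nonneg[OF norm_ge_zero norm_ge_zero, of "f x" "g x"]
      by linarith
    finally show ?thesis .
  qed
  then show "AE x in lborel. norm (f x \<bullet> g x) \<le> norm ((norm (f x))\<^sup>2 + (norm (g x))\<^sup>2)"
    by (intro AE_I2) simp
qed (use assms in measurable)

lemma L2_mult: "L2 f \<Longrightarrow> L2 g \<Longrightarrow> integrable lborel (\<lambda>x. f x * g x)" for f g :: "real^3 \<Rightarrow> real"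
  using L2_inner[of f g] by simp

lemma L2_square: "L2 f \<Longrightarrow> integrable lborel (\<lambda>x. (f x)\<^sup>2)" for f :: "real^3 \<Rightarrow> real"
  using L2_integrable_square[of f] by simp

lemma measurable_vec_nth [measurable (raw)]:
  fixes F :: "'a \<Rightarrow> real^3"
  assumes [measurable]: "F \<in> borel_measurable M"
  shows "(\<lambda>x. F x $ i) \<in> borel_measurable M"
proof -
  have "(\<lambda>x. F x \<bullet> axis i 1) \<in> borel_measurable M" by measurable
  then show ?thesis by (simp add: inner_axis)
qed

lemma L2_component: "L2 F \<Longrightarrow> L2 (\<lambda>x. F x $ i)" for F :: "real^3 \<Rightarrow> real^3"
  by (rule L2_bound) (auto simp: component_le_norm_cart dest!: L2_measurable)

lemma measurable_vec_components:
  fixes F :: "'a \<Rightarrow> real^3"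
  assumes "\<And>i. (\<lambda>x. F x $ i) \<in> borel_measurable M"
  shows "F \<in> borel_measurable M"
proof -
  have "F x = (\<Sum>i\<in>UNIV. F x $ i *\<^sub>R axis i 1)" for x
    by (simp add: vec_eq_iff axis_def if_distrib[of "\<lambda>t. _ * t"] cong: if_cong)
  then have "F = (\<lambda>x. \<Sum>i\<in>UNIV. F x $ i *\<^sub>R axis i 1)" by blast
  moreover have "(\<lambda>x. \<Sum>i\<in>UNIV. F x $ i *\<^sub>R (axis i 1 :: real^3)) \<in> borel_measurable M"
    using assms by measurable
  ultimately show ?thesis by simp
qed

lemma L2_vec_components:
  fixes F :: "real^3 \<Rightarrow> real^3"
  assumes "\<And>i. L2 (\<lambda>x. F x $ i)"
  shows "L2 F"
  unfolding L2_def
proof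
  show "F \<in> borel_measurable borel" using assms by (intro measurable_vec_components) auto
  have "(norm (F x))\<^sup>2 = (\<Sum>i\<in>UNIV. (F x $ i)\<^sup>2)" for x
    by (simp add: norm_vec_def L2_set_def sum_nonneg)
  then show "integrable lborel (\<lambda>x. (norm (F x))\<^sup>2)"
    using assms by (auto intro!: Bochner_Integration.integrable_sum L2_square)
qed

lemma L2_indicator_compact:
  assumes K: "compact K" shows "L2 (indicator K :: real^3 \<Rightarrow> real)" "integrable lborel (indicator K :: real^3 \<Rightarrow> real)"
proof -
  have [measurable]: "K \<in> sets borel" using K by (simp add: borel_compact)
  show i: "integrable lborel (indicator K :: real^3 \<Rightarrow> real)"
    using emeasure_compact_finite[OF K] by (intro integrable_real_indicator) auto
  show "L2 (indicator K :: real^3 \<Rightarrow> real)"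
    unfolding L2_def
  proof
    show "integrable lborel (\<lambda>x. (norm (indicator K x :: real))\<^sup>2)"
      by (rule Bochner_Integration.integrable_cong[THEN iffD1, OF refl _ i]) (simp add: indicator_def)
  qed measurable
qed

lemma L2_locally_integrable: "L2 f \<Longrightarrow> locally_integrable f" for f :: "real^3 \<Rightarrow> real"
proof (rule locally_integrableI)
  assume f: "L2 f"
  then show "f \<in> borel_measurable borel" by auto
  fix K :: "(real^3) set" assume K: "compact K"
  show "integrable lborel (\<lambda>x. indicator K x *\<^sub>R f x)"
    using L2_mult[OF L2_indicator_compact(1)[OF K] f] by simp
qed

lemma test_function_L2: "test_function \<eta> \<Longrightarrow> L2 \<eta>"
  unfolding L2_def by (auto dest: test_function_square test_function_integrable)

lemma L2_times_test_function:
  fixes f :: "real^3 \<Rightarrow> real"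
  assumes f: "L2 f" and \<eta>: "test_function \<eta>" shows "L2 (\<lambda>x. f x * \<eta> x)"
proof -
  have [measurable]: "f \<in> borel_measurable borel" "\<eta> \<in> borel_measurable borel" using f \<eta> by auto
  obtain C where C: "C > 0" "\<And>x. \<bar>\<eta> x\<bar> \<le> C" by (rule test_function_bounded[OF \<eta>]) (rule that)
  show ?thesis
  proof (rule L2_bound)
    show "L2 (\<lambda>x. C *\<^sub>R f x)" by (rule L2_scaleR[OF f])
    show "norm (f x * \<eta> x) \<le> norm (C *\<^sub>R f x)" for x
      using C(1) mult_left_mono[OF C(2)[of x], of "\<bar>f x\<bar>"] by (simp add: abs_mult mult.commute)
  qed measurable
qed

subsection \<open>Weak gradients\<close>

lemma has_weak_deriv_iff:
  "has_weak_deriv f b g \<longleftrightarrow> locally_integrable f \<and> locally_integrable g \<and>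
    (\<forall>\<eta>. test_function \<eta> \<longrightarrow> - (LINT x|lborel. f x * dir_deriv b \<eta> x) = (LINT x|lborel. g x * \<eta> x))"
  by (simp add: has_weak_deriv_def distr_eq_def distr_deriv_def distr_of_def)

text \<open>Permits the arbitrary choice inside \<open>weak_grad\<close> to be replaced by an
  explicit gradient under an integral.\<close>

lemma has_weak_grad_AE_unique:
  assumes "has_weak_grad f g" "has_weak_grad f h"
  shows "AE x in lborel. g x = h x"
proof -
  have "AE x in lborel. g x $ i = h x $ i" for i
    using assms by (intro AE_eq_if_distr_eq) (auto simp: has_weak_grad_def has_weak_deriv_def distr_eq_def)
  then have "AE x in lborel. \<forall>i. g x $ i = h x $ i" by (simp add: AE_all_countable)
  then show ?thesis by (simp add: vec_eq_iff)
qed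

lemma has_weak_deriv_add:
  assumes "has_weak_deriv f b g" "has_weak_deriv f' b g'"
  shows "has_weak_deriv (\<lambda>x. f x + f' x) b (\<lambda>x. g x + g' x)"
  using assms unfolding has_weak_deriv_iff
  by (auto intro!: locally_integrable_add simp: distrib_right Bochner_Integration.integral_add
       locally_integrable_times_test_function test_function_dir_deriv)

lemma has_weak_deriv_cmult:
  assumes "has_weak_deriv f b g"
  shows "has_weak_deriv (\<lambda>x. c * f x) b (\<lambda>x. c * g x)"
  unfolding has_weak_deriv_iff
proof (intro conjI allI impI)
  fix \<eta> :: "'a \<Rightarrow> real" assume "test_function \<eta>"
  then have "- (LINT x|lborel. f x * dir_deriv b \<eta> x) = (LINT x|lborel. g x * \<eta> x)"
    using assms by (simp add: has_weak_deriv_iff)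
  then have "c * - (LINT x|lborel. f x * dir_deriv b \<eta> x) = c * (LINT x|lborel. g x * \<eta> x)" by simp
  then show "- (LINT x|lborel. c * f x * dir_deriv b \<eta> x) = (LINT x|lborel. c * g x * \<eta> x)"
    by (simp add: mult.assoc)
qed (use assms in \<open>auto simp: has_weak_deriv_iff intro: locally_integrable_cmult\<close>)

lemma C_infinity_has_weak_deriv:
  assumes f: "C_infinity f" shows "has_weak_deriv f b (dir_deriv b f)"
  unfolding has_weak_deriv_iff
proof (intro conjI allI impI)
  show "locally_integrable f" "locally_integrable (dir_deriv b f)"
    by (intro continuous_imp_locally_integrable C_infinity_continuous_on C_infinity_dir_deriv f)+
  show "- (LINT x|lborel. f x * dir_deriv b \<eta> x) = (LINT x|lborel. dir_deriv b f x * \<eta> x)"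
    if "test_function \<eta>" for \<eta>
    using integral_dir_deriv_by_parts[OF that f, of b] by (simp add: mult.commute)
qed

lemma has_weak_grad_add:
  "has_weak_grad f g \<Longrightarrow> has_weak_grad f' g' \<Longrightarrow> has_weak_grad (\<lambda>x. f x + f' x) (\<lambda>x. g x + g' x)"
  by (simp add: has_weak_grad_def has_weak_deriv_add)

lemma has_weak_grad_cmult: "has_weak_grad f g \<Longrightarrow> has_weak_grad (\<lambda>x. c * f x) (\<lambda>x. c *\<^sub>R g x)"
  by (simp add: has_weak_grad_def has_weak_deriv_cmult)

definition smooth_grad :: "(real^3 \<Rightarrow> real) \<Rightarrow> real^3 \<Rightarrow> real^3" where
  "smooth_grad f x = (\<chi> i. dir_deriv (dx i) f x)"

lemma has_weak_grad_smooth: "C_infinity f \<Longrightarrow> has_weak_grad f (smooth_grad f)"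
  by (simp add: has_weak_grad_def smooth_grad_def C_infinity_has_weak_deriv)

lemma L2_smooth_grad: "test_function f \<Longrightarrow> L2 (smooth_grad f)"
  by (rule L2_vec_components) (simp add: smooth_grad_def test_function_L2 test_function_dir_deriv)

lemma inner_smooth_grad:
  assumes "f differentiable (at x)" shows "v \<bullet> smooth_grad f x = dir_deriv v f x"
proof -
  have lin: "linear (\<lambda>b. dir_deriv b f x)"
    using has_derivative_linear[OF has_derivative_dir_deriv[OF assms]] .
  have "v = (\<Sum>i\<in>UNIV. v $ i *\<^sub>R dx i)"
    by (simp add: vec_eq_iff dx_def axis_def if_distrib[of "\<lambda>t. _ * t"] cong: if_cong)
  then have "dir_deriv v f x = dir_deriv (\<Sum>i\<in>UNIV. v $ i *\<^sub>R dx i) f x" by simp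
  also have "\<dots> = (\<Sum>i\<in>UNIV. v $ i * dir_deriv (dx i) f x)"
    using linear_sum[OF lin, of "\<lambda>i. v $ i *\<^sub>R dx i" UNIV] by (simp add: linear_scale[OF lin])
  finally show ?thesis by (simp add: inner_vec_def smooth_grad_def)
qed

text \<open>The choice operator only guarantees some weak gradient; square integrability is carried
  over from a square integrable one by uniqueness almost everywhere.\<close>

lemma H1_weak_grad:
  assumes "H1 f"
  shows "has_weak_grad f (weak_grad f)" and "L2 (weak_grad f)"
proof -
  obtain g where g: "has_weak_grad f g" "L2 g" using assms by (auto simp: H1_def)
  show *: "has_weak_grad f (weak_grad f)" unfolding weak_grad_def by (rule someI[of "has_weak_grad f", OF g(1)])
  have m [measurable]: "weak_grad f \<in> borel_measurable borel"
    using * by (intro measurable_vec_components) (auto simp: has_weak_grad_def has_weak_deriv_def intro: locally_integrable_measurable)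
  have [measurable]: "g \<in> borel_measurable borel" using g by auto
  have "AE x in lborel. (norm (g x))\<^sup>2 = (norm (weak_grad f x))\<^sup>2"
    using has_weak_grad_AE_unique[OF g(1) *] by eventually_elim simp
  then have "integrable lborel (\<lambda>x. (norm (weak_grad f x))\<^sup>2)"
    using L2_integrable_square[OF g(2)] by (subst (asm) integrable_cong_AE) auto
  then show "L2 (weak_grad f)" using m by (simp add: L2_def)
qed

subsection \<open>The Newtonian kernel\<close>

abbreviation vol3 :: real where "vol3 \<equiv> unit_ball_vol 3"

lemma ball_borel [measurable]: "ball c r \<in> sets borel"
  by simp

lemma vol3_pos: "vol3 > 0" by simp

lemma vol3_nonzero [simp]: "vol3 \<noteq> 0"
  using vol3_pos by (rule less_imp_neq[THEN not_sym])

lemma emeasure_ball3: "r \<ge> 0 \<Longrightarrow> emeasure lborel (ball (0::real^3) r) = ennreal (vol3 * r ^ 3)"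
  using emeasure_ball[of r "0::real^3"] by simp

section \<open>Dyadic estimates for powers of the norm\<close>

lemma summable_imp_suminf_ennreal_finite:
  "(\<And>k. 0 \<le> a k) \<Longrightarrow> summable a \<Longrightarrow> (\<Sum>k. ennreal (a k)) < \<infinity>"
  by (simp add: suminf_ennreal2)

text \<open>Almost everywhere \<open>f\<close> is below the sum of \<open>c k\<close> times the
  indicator of the ball of radius \<open>r k\<close>, whose integral is a multiple of the given
  series. Shrinking radii control a singularity at 0, growing radii the decay at infinity.\<close>

lemma nn_integral_dyadic_bound:
  fixes f :: "real^3 \<Rightarrow> ennreal" and c r :: "nat \<Rightarrow> real"
  assumes nn: "\<And>k. 0 \<le> c k" "\<And>k. 0 \<le> r k" and sm: "summable (\<lambda>k. c k * r k ^ 3)"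
    and le: "\<And>w. w \<noteq> 0 \<Longrightarrow> f w > 0 \<Longrightarrow> \<exists>k. norm w < r k \<and> f w \<le> ennreal (c k)"
  shows "(\<integral>\<^sup>+w. f w \<partial>lborel) < \<infinity>"
proof -
  have "AE w in lborel. f w \<le> (\<Sum>k. ennreal (c k) * indicator (ball 0 (r k)) w)"
    using AE_lborel_singleton[of "0::real^3"]
  proof eventually_elim
    case (elim w)
    show ?case
    proof (cases "f w > 0")
      case True
      then obtain k where k: "norm w < r k" "f w \<le> ennreal (c k)" using le elim by blast
      have "s k \<le> (\<Sum>k. s k)" for s :: "nat \<Rightarrow> ennreal"
        using sum_le_suminf[of s "{k}"] by simp
      from this[of "\<lambda>k. ennreal (c k) * indicator (ball 0 (r k)) w"]
      have "ennreal (c k) * indicator (ball 0 (r k)) w \<le> (\<Sum>k. ennreal (c k) * indicator (ball 0 (r k)) w)" .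
      then show ?thesis using k by (auto intro: order_trans)
    qed (simp add: not_gr_zero)
  qed
  then have "(\<integral>\<^sup>+w. f w \<partial>lborel) \<le> (\<integral>\<^sup>+w. (\<Sum>k. ennreal (c k) * indicator (ball 0 (r k)) w) \<partial>(lborel :: (real^3) measure))"
    by (rule nn_integral_mono_AE)
  also have "\<dots> = (\<Sum>k. \<integral>\<^sup>+w. ennreal (c k) * indicator (ball 0 (r k)) w \<partial>(lborel :: (real^3) measure))"
    by (rule nn_integral_suminf) auto
  also have "\<dots> = (\<Sum>k. ennreal (c k * (vol3 * r k ^ 3)))"
    using nn by (simp add: nn_integral_cmult_indicator emeasure_ball3 ennreal_mult)
  also have "\<dots> < \<infinity>"
    using nn sm by (intro summable_imp_suminf_ennreal_finite)
      (auto intro: summable_mult[of _ vol3] simp: mult.left_commute[of _ vol3])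
  finally show ?thesis .
qed

text \<open>On the shell where \<open>norm w\<close> lies between \<open>2^-(k+1)\<close> and
  \<open>2^-k\<close> the function is at most \<open>2^(a (k+1))\<close>, so the series is geometric
  with ratio \<open>2^a / 8\<close>, which is below 1 because \<open>a < 3\<close>.\<close>

lemma nn_integral_norm_powr_near_0:
  assumes a: "0 < a" "a < 3"
  shows "(\<integral>\<^sup>+w. ennreal (norm w powr (- a)) * indicator (ball (0::real^3) 1) w \<partial>lborel) < \<infinity>"
proof (rule nn_integral_dyadic_bound[where c = "\<lambda>k. 2 powr a * (2 powr a) ^ k" and r = "\<lambda>k. (1/2) ^ k"])
  have lt: "2 powr a < (8::real)"
    using a powr_less_mono[of a 3 "2::real"] by simp
  have "summable (\<lambda>k. 2 powr a * ((2 powr a) / 8) ^ k)"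
    using lt by (intro summable_mult summable_geometric) auto
  moreover have "2 powr a * ((2 powr a) / 8) ^ k = 2 powr a * (2 powr a) ^ k * ((1/2) ^ k) ^ 3" for k
  proof -
    have "((1/2::real) ^ k) ^ 3 = (1 / 8) ^ k"
      by (simp add: power_mult[symmetric] mult.commute[of k] power_mult power_divide)
    then show ?thesis by (simp add: power_divide)
  qed
  ultimately show "summable (\<lambda>k. 2 powr a * (2 powr a) ^ k * ((1/2) ^ k) ^ 3)" by simp
  fix w :: "real^3" assume w: "w \<noteq> 0" "ennreal (norm w powr - a) * indicator (ball 0 1) w > 0"
  then have n: "norm w < 1" by (cases "norm w < 1") auto
  obtain n where "(1/2) ^ n < norm w" using real_arch_pow_inv[of "norm w" "1/2"] w by auto
  then have "(1/2) ^ n \<le> norm w" by simp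
  \<comment> \<open>The first power of 1/2 not exceeding \<open>norm w\<close> has a positive index
    since \<open>norm w < 1\<close>; the index before it is the number \<open>k\<close> of the
    shell.\<close>
  from ex_least_nat_less[of "\<lambda>n. (1/2) ^ n \<le> norm w", OF this] n obtain k
    where k: "\<And>i. i \<le> k \<Longrightarrow> \<not> (1/2) ^ i \<le> norm w" "(1/2) ^ Suc k \<le> norm w"
    by auto
  have "norm w powr - a \<le> ((1/2) ^ Suc k) powr - a"
    using k(2) a by (intro powr_mono2') auto
  also have "\<dots> = 2 powr a * (2 powr a) ^ k"
  proof -
    have eq: "((1/2) ^ Suc k :: real) = 2 powr (- real (Suc k))"
      by (simp only: powr_minus powr_realpow[symmetric] power_one_over inverse_eq_divide)
    have "((1/2) ^ Suc k) powr - a = (2::real) powr (a * real (Suc k))"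
      unfolding eq powr_powr by (simp add: mult.commute del: of_nat_Suc)
    also have "\<dots> = (2 powr a) ^ Suc k"
      by (simp only: powr_powr[symmetric]) (rule powr_realpow, simp)
    finally show ?thesis by simp
  qed
  finally show "\<exists>k. norm w < (1/2) ^ k \<and>
      ennreal (norm w powr - a) * indicator (ball 0 1) w \<le> ennreal (2 powr a * (2 powr a) ^ k)"
    using k(1)[of k] n by (intro exI[of _ k]) (auto intro: ennreal_leI)
qed auto

text \<open>The fourth power is the square of the decay of the kernel, so this is the square
  integrability of its far part. The shell from \<open>2^k\<close> to \<open>2^(k+1)\<close>
  contributes a multiple of \<open>16^-k * 8^(k+1) = 8 * 2^-k\<close>.\<close>

lemma nn_integral_norm_power4_far:
  "(\<integral>\<^sup>+w. ennreal (1 / norm w ^ 4) * indicator (- ball (0::real^3) 1) w \<partial>lborel) < \<infinity>"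
proof (rule nn_integral_dyadic_bound[where c = "\<lambda>k. (1/16) ^ k" and r = "\<lambda>k. 2 ^ Suc k"])
  have "summable (\<lambda>k. 8 * (1/2::real) ^ k)"
    by (intro summable_mult summable_geometric) auto
  moreover have "8 * (1/2::real) ^ k = (1/16) ^ k * (2 ^ Suc k) ^ 3" for k
  proof -
    have "((2::real) ^ Suc k) ^ 3 = 8 * 8 ^ k"
      by (simp add: power_mult_distrib power_mult[symmetric] mult.commute[of k] power_mult)
    moreover have "(1/2::real) ^ k = (1/16) ^ k * 8 ^ k"
      by (simp add: power_mult_distrib[symmetric])
    ultimately show ?thesis by simp
  qed
  ultimately show "summable (\<lambda>k. (1/16::real) ^ k * (2 ^ Suc k) ^ 3)" by simp
  fix w :: "real^3" assume w: "w \<noteq> 0" "ennreal (1 / norm w ^ 4) * indicator (- ball 0 1) w > 0"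
  then have n: "norm w \<ge> 1" by (cases "norm w < 1") auto
  obtain n where "norm w < 2 ^ n" using real_arch_pow[of 2 "norm w"] by auto
  from ex_least_nat_less[of "\<lambda>n. norm w < 2 ^ n", OF this] n obtain k
    where k: "\<And>i. i \<le> k \<Longrightarrow> \<not> norm w < 2 ^ i" "norm w < 2 ^ Suc k"
    by auto
  have "((2::real) ^ k) ^ 4 \<le> norm w ^ 4" using k(1)[of k] by (intro power_mono) auto
  moreover have "((2::real) ^ k) ^ 4 = 16 ^ k"
    by (simp add: power_mult[symmetric] mult.commute[of k] power_mult)
  ultimately have "1 / norm w ^ 4 \<le> 1 / 16 ^ k"
    using w(1) by (intro divide_left_mono) auto
  then have "1 / norm w ^ 4 \<le> (1/16) ^ k" unfolding power_one_over .
  then show "\<exists>k. norm w < 2 ^ Suc k \<and>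
      ennreal (1 / norm w ^ 4) * indicator (- ball 0 1) w \<le> ennreal ((1/16) ^ k)"
    using k(2) n by (intro exI[of _ k]) (auto intro: ennreal_leI)
qed auto

text \<open>This is \<open>w / (4 pi |w|^3)\<close>, as the area \<open>4 pi\<close> of the unit
  sphere is three times the volume of the unit ball. The volume comes from averaging over the ball,
  the 3 from the integral of \<open>1 / t ^ 4\<close>. Division by zero gives
  \<open>newton 0 = 0\<close>.\<close>

definition newton :: "real^3 \<Rightarrow> real^3" where
  "newton w = (1 / (3 * vol3) / norm w ^ 3) *\<^sub>R w"

lemma newton_measurable [measurable]: "newton \<in> borel_measurable borel"
  unfolding newton_def[abs_def] by measurable

lemma newton_uminus: "newton (- w) = - newton w"
  by (simp add: newton_def)

lemma norm_newton: "norm (newton w) = 1 / (3 * vol3) / (norm w)\<^sup>2"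
  by (cases "w = 0") (simp_all add: newton_def power2_eq_square power3_eq_cube abs_mult)

section \<open>Scaling and the fundamental solution of the divergence\<close>

lemma nn_integral_scale:
  fixes f :: "real^3 \<Rightarrow> ennreal"
  assumes [measurable]: "f \<in> borel_measurable borel" and c: "c \<noteq> 0"
  shows "(\<integral>\<^sup>+w. f w \<partial>lborel) = ennreal (\<bar>c\<bar> ^ 3) * (\<integral>\<^sup>+w. f (c *\<^sub>R w) \<partial>lborel)"
  by (subst (1) lborel_affine[OF c, of 0])
     (simp add: nn_integral_density nn_integral_distr nn_integral_cmult)

lemma integral_scale:
  fixes f :: "real^3 \<Rightarrow> real"
  assumes [measurable]: "f \<in> borel_measurable borel" and c: "c \<noteq> 0"
  shows "(LINT w|lborel. f w) = \<bar>c\<bar> ^ 3 * (LINT w|lborel. f (c *\<^sub>R w))"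
  by (subst (1) lborel_affine[OF c, of 0])
     (simp add: integral_density integral_distr)

lemma integrable_pairI:
  fixes f :: "'a::euclidean_space \<Rightarrow> 'b::euclidean_space \<Rightarrow> real"
  assumes [measurable]: "case_prod f \<in> borel_measurable (lborel \<Otimes>\<^sub>M lborel)"
    and fin: "(\<integral>\<^sup>+x. \<integral>\<^sup>+y. ennreal (norm (f x y)) \<partial>lborel \<partial>lborel) < \<infinity>"
  shows "integrable (lborel \<Otimes>\<^sub>M lborel) (case_prod f)"
proof -
  have "(\<integral>\<^sup>+z. ennreal (norm (case_prod f z)) \<partial>(lborel \<Otimes>\<^sub>M lborel)) =
      (\<integral>\<^sup>+x. \<integral>\<^sup>+y. ennreal (norm (case_prod f (x, y))) \<partial>lborel \<partial>lborel)"
    by (rule lborel.nn_integral_fst[symmetric]) measurable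
  then show ?thesis using fin by (simp add: integrable_iff_bounded)
qed

lemma integral_ray_smooth_grad:
  assumes \<zeta>: "test_function \<zeta>" and z: "z \<noteq> 0"
  shows "(LINT t|lborel. indicator {0<..} t * (z \<bullet> smooth_grad \<zeta> (t *\<^sub>R z))) = - \<zeta> 0"
proof -
  obtain R where R: "R > 0" "\<And>x. norm x \<ge> R \<Longrightarrow> \<zeta> x = 0" by (rule test_functionE[OF \<zeta>]) (rule that)
  obtain R' where R': "R' > 0" "\<And>x. norm x \<ge> R' \<Longrightarrow> dir_deriv z \<zeta> x = 0"
    by (rule test_functionE[OF test_function_dir_deriv[OF \<zeta>]]) (rule that)
  \<comment> \<open>Past the parameter \<open>T\<close> the ray has left both balls, so
    \<open>\<zeta>\<close> and its derivative along \<open>z\<close> vanish there and the half-line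
    may be replaced by \<open>{0..T}\<close>.\<close>
  define T where "T = (R + R') / norm z"
  have T: "T > 0" using R R' z by (simp add: T_def)
  have diff: "\<zeta> differentiable (at x)" for x by (rule test_function_differentiable[OF \<zeta>])
  have Tz: "T * norm z = R + R'" using z by (simp add: T_def)
  have *: "((\<lambda>t. \<zeta> (t *\<^sub>R z)) has_vector_derivative dir_deriv z \<zeta> (t *\<^sub>R z)) (at t within {0..T})" for t
    using has_derivative_affine_comp[OF diff bounded_linear_scaleR_left[of z], of 0 t]
    by (auto simp: has_vector_derivative_def dir_deriv_scaleR_direction[OF diff] intro: has_derivative_at_withinI)
  have **: "continuous_on {0..T} (\<lambda>t. dir_deriv z \<zeta> (t *\<^sub>R z))"
    by (rule continuous_on_compose2[OF C_infinity_continuous_on[OF C_infinity_dir_deriv[OF test_function_C_infinity[OF \<zeta>]], of UNIV]])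
       (auto intro!: continuous_intros)
  have [measurable]: "dir_deriv z \<zeta> \<in> borel_measurable borel"
    by (rule test_function_measurable[OF test_function_dir_deriv[OF \<zeta>]])
  have "(LINT t|lborel. indicator {0<..} t * (z \<bullet> smooth_grad \<zeta> (t *\<^sub>R z))) =
      (LINT t|lborel. indicator {0..T} t *\<^sub>R dir_deriv z \<zeta> (t *\<^sub>R z))"
    unfolding inner_smooth_grad[OF diff]
  proof (rule integral_cong_AE)
    show "AE t in lborel. indicator {0<..} t * dir_deriv z \<zeta> (t *\<^sub>R z) =
        indicator {0..T} t *\<^sub>R dir_deriv z \<zeta> (t *\<^sub>R z)"
      using AE_lborel_singleton[of "0::real"]
    proof eventually_elim
      case (elim t)
      show ?case
      proof (cases "t > T")
        case True
        then have "norm (t *\<^sub>R z) \<ge> R'"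
          using T z R mult_right_mono[of T t "norm z"] by (simp add: Tz)
        then show ?thesis using R' by simp
      qed (use elim T in \<open>auto simp: indicator_def\<close>)
    qed
  qed measurable
  also have "\<dots> = \<zeta> (T *\<^sub>R z) - \<zeta> (0 *\<^sub>R z)"
    by (rule integral_FTC_Icc[where F = "\<lambda>t. \<zeta> (t *\<^sub>R z)"]) (use T * ** in auto)
  also have "\<zeta> (T *\<^sub>R z) = 0" using R R' T by (intro R) (simp add: Tz)
  finally show ?thesis by simp
qed

text \<open>The power 4 comes from the substitution \<open>w = t z\<close>: three factors from the
  volume element and one from \<open>z = w / t\<close>. The value at \<open>a = norm w\<close>
  supplies the factor \<open>1 / norm w ^ 3\<close> of \<open>newton\<close>.\<close>

lemma nn_integral_inverse_power4:
  assumes "a > 0"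
  shows "(\<integral>\<^sup>+t. ennreal (1 / t ^ 4) * indicator {a..} t \<partial>lborel) = ennreal (1 / (3 * a ^ 3))"
proof -
  have "((\<lambda>t::real. - (1 / 3) * inverse (t ^ 3)) \<longlongrightarrow> - (1 / 3) * 0) at_top"
    by (intro tendsto_mult tendsto_const tendsto_inverse_0_at_top filterlim_pow_at_top filterlim_ident) auto
  then have "(\<integral>\<^sup>+t. ennreal (1 / t ^ 4) * indicator {a..} t \<partial>lborel) = ennreal (0 - (- (1 / 3) * inverse (a ^ 3)))"
    using assms by (intro nn_integral_FTC_atLeast)
      (auto intro!: derivative_eq_intros simp: field_simps power_numeral_reduce)
  then show ?thesis by (simp add: field_simps)
qed

lemma integral_inverse_power4:
  fixes a :: real
  assumes "a > 0"
  shows "(LINT t|lborel. (1 / t ^ 4) * indicator {a<..} t) = 1 / (3 * a ^ 3)"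
proof -
  have "(LINT t|lborel. (1 / t ^ 4) * indicator {a<..} t) = (LINT t|lborel. (1 / t ^ 4) * indicator {a..} t)"
  proof (rule integral_cong_AE)
    show "AE t in lborel. (1 / t ^ 4) * indicator {a<..} t = (1 / t ^ 4) * indicator {a..} t"
      using AE_lborel_singleton[of a]
    proof eventually_elim
      case (elim t)
      then show ?case by (auto simp: indicator_def)
    qed
  qed measurable
  also have "\<dots> = 1 / (3 * a ^ 3)"
  proof (rule integral_eq_nn_integral[THEN trans])
    show "enn2real (\<integral>\<^sup>+t. ennreal (1 / t ^ 4 * indicator {a..} t) \<partial>lborel) = 1 / (3 * a ^ 3)"
      using nn_integral_inverse_power4[OF assms] assms
      by (subst ennreal_mult'') (auto simp: ennreal_indicator)
  qed (use assms in \<open>auto simp: indicator_def\<close>)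
  finally show ?thesis .
qed

lemma smooth_grad_bounded_support:
  assumes \<zeta>: "test_function \<zeta>"
  obtains R C where "R > 0" "C > 0" "\<And>x. norm x \<ge> R \<Longrightarrow> smooth_grad \<zeta> x = 0" "\<And>x. norm (smooth_grad \<zeta> x) \<le> C"
proof -
  have "\<forall>i. \<exists>R>0. \<forall>x. norm x \<ge> R \<longrightarrow> dir_deriv (dx i) \<zeta> x = 0"
  proof
    fix i
    obtain R where "R > 0" "\<And>x. norm x \<ge> R \<Longrightarrow> dir_deriv (dx i) \<zeta> x = 0"
      by (rule test_functionE[OF test_function_dir_deriv[OF \<zeta>]]) (rule that)
    then show "\<exists>R>0. \<forall>x. norm x \<ge> R \<longrightarrow> dir_deriv (dx i) \<zeta> x = 0" by blast
  qed
  then obtain R where R: "\<And>i. R i > 0" "\<And>i x. norm x \<ge> R i \<Longrightarrow> dir_deriv (dx i) \<zeta> x = 0"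
    by metis
  have "\<forall>i. \<exists>C>0. \<forall>x. \<bar>dir_deriv (dx i) \<zeta> x\<bar> \<le> C"
  proof
    fix i
    obtain C where "C > 0" "\<And>x. \<bar>dir_deriv (dx i) \<zeta> x\<bar> \<le> C"
      by (rule test_function_bounded[OF test_function_dir_deriv[OF \<zeta>]]) (rule that)
    then show "\<exists>C>0. \<forall>x. \<bar>dir_deriv (dx i) \<zeta> x\<bar> \<le> C" by blast
  qed
  then obtain C where C: "\<And>i. C i > 0" "\<And>i x. \<bar>dir_deriv (dx i) \<zeta> x\<bar> \<le> C i"
    by metis
  show ?thesis
  proof
    show "sum R UNIV > 0" "sum C UNIV > 0" using R C by (auto intro!: sum_pos)
    fix x
    show "norm (smooth_grad \<zeta> x) \<le> sum C UNIV"
      by (rule order_trans[OF norm_le_l1_cart]) (auto simp: smooth_grad_def intro!: sum_mono C)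
    assume x: "norm x \<ge> sum R UNIV"
    have "R i \<le> norm x" for i
      by (rule order_trans[OF member_le_sum[of i UNIV R] x]) (auto intro: less_imp_le R)
    then show "smooth_grad \<zeta> x = 0" using R by (simp add: smooth_grad_def vec_eq_iff)
  qed
qed

lemma smooth_grad_measurable: "test_function \<zeta> \<Longrightarrow> smooth_grad \<zeta> \<in> borel_measurable borel"
  using L2_smooth_grad by auto

text \<open>Near 0 the kernel is a multiple of \<open>norm w powr (- 2)\<close>, integrable since 2
  is below the dimension; off the unit ball it is bounded by the constant
  \<open>1 / (3 * vol3)\<close>.\<close>

lemma nn_integral_newton_ball: "(\<integral>\<^sup>+w. ennreal (norm (newton w)) * indicator (ball 0 r) w \<partial>lborel) < \<infinity>"
proof -
  have "(\<integral>\<^sup>+w. ennreal (norm (newton w)) * indicator (ball 0 r) w \<partial>lborel) \<le>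
     (\<integral>\<^sup>+w. ennreal (1 / (3 * vol3)) * (ennreal (norm w powr (- 2)) * indicator (ball 0 1) w) +
        ennreal (1 / (3 * vol3)) * indicator (ball 0 r) w \<partial>(lborel :: (real^3) measure))"
  proof (rule nn_integral_mono)
    fix w :: "real^3"
    have eq: "norm w powr (- 2) = 1 / (norm w)\<^sup>2"
      by (cases "w = 0") (auto simp: powr_minus powr_numeral divide_simps)
    have e2: "ennreal (norm (newton w)) = ennreal (1 / (3 * vol3)) * ennreal (norm w powr (- 2))"
      unfolding norm_newton eq by (subst ennreal_mult[symmetric]) auto
    show "ennreal (norm (newton w)) * indicator (ball 0 r) w \<le>
       ennreal (1 / (3 * vol3)) * (ennreal (norm w powr (- 2)) * indicator (ball 0 1) w) +
        ennreal (1 / (3 * vol3)) * indicator (ball 0 r) w"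
    proof (cases "norm w < 1")
      case True
      then show ?thesis unfolding e2 by (auto simp: indicator_def)
    next
      case False
      then have "1 / (norm w)\<^sup>2 \<le> 1" by (simp add: divide_simps one_le_power)
      then have "ennreal (norm w powr (- 2)) \<le> 1" unfolding eq by (simp add: ennreal_le_1)
      then show ?thesis unfolding e2 using False
        by (auto simp: indicator_def mult_left_le)
    qed
  qed
  also have "\<dots> = ennreal (1 / (3 * vol3)) * (\<integral>\<^sup>+w. ennreal (norm w powr (- 2)) * indicator (ball (0::real^3) 1) w \<partial>lborel)
      + ennreal (1 / (3 * vol3)) * emeasure lborel (ball (0::real^3) r)"
    by (subst nn_integral_add, measurable, subst nn_integral_cmult, measurable)
       (simp add: nn_integral_cmult_indicator)
  also have "\<dots> < \<infinity>"
    using nn_integral_norm_powr_near_0[of 2] emeasure_lborel_ball_finite[of "0::real^3" r]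
    by (simp add: ennreal_mult_eq_top_iff ennreal_add_eq_top less_top[symmetric])
  finally show ?thesis .
qed

text \<open>Averaging \<open>\<integral>\<^sub>0\<^sup>\<infinity> z \<bullet> \<nabla>\<zeta>(t z) dt = - \<zeta> 0\<close> over the unit ball and substituting \<open>w = t z\<close>
  produces the kernel \<open>w \<integral>\<^sub>|\<^sub>w\<^sub>|\<^sup>\<infinity> t\<^sup>-\<^sup>4 dt\<close>, so the fundamental solution needs no integration by parts.\<close>

lemma integral_newton_smooth_grad_0:
  assumes \<zeta>: "test_function \<zeta>"
  shows "(LINT w|lborel. newton w \<bullet> smooth_grad \<zeta> w) = - \<zeta> 0"
proof -
  define g where "g = smooth_grad \<zeta>"
  obtain R C where RC': "R > 0" "C > 0" "\<And>x. norm x \<ge> R \<Longrightarrow> smooth_grad \<zeta> x = 0"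
      "\<And>x. norm (smooth_grad \<zeta> x) \<le> C"
    by (rule smooth_grad_bounded_support[OF \<zeta>]) (rule that)
  note RC = RC'[folded g_def]
  have [measurable]: "g \<in> borel_measurable borel" unfolding g_def by (rule smooth_grad_measurable[OF \<zeta>])
  define h where "h = (\<lambda>(z::real^3) (t::real). indicator (ball 0 1) z * (indicator {0<..} t * (z \<bullet> g (t *\<^sub>R z))))"
  have [measurable]: "(\<lambda>p::(real^3) \<times> real. indicator (ball 0 1) (fst p) :: real) \<in> borel_measurable (lborel \<Otimes>\<^sub>M lborel)"
    by (rule measurable_compose[OF measurable_fst]) simp
  have [measurable]: "(\<lambda>p::(real^3) \<times> real. indicator {0<..} (snd p) :: real) \<in> borel_measurable (lborel \<Otimes>\<^sub>M lborel)"
    by (rule measurable_compose[OF measurable_snd]) simp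
  have [measurable]: "(fst :: (real^3) \<times> real \<Rightarrow> _) \<in> borel_measurable (lborel \<Otimes>\<^sub>M lborel)"
    "(snd :: (real^3) \<times> real \<Rightarrow> _) \<in> borel_measurable (lborel \<Otimes>\<^sub>M lborel)"
    by simp_all
  have h_meas [measurable]: "case_prod h \<in> borel_measurable (lborel \<Otimes>\<^sub>M lborel)"
    unfolding h_def split_beta' by measurable
  have int_h: "integrable (lborel \<Otimes>\<^sub>M lborel) (case_prod h)"
  proof (rule integrable_pairI[OF h_meas])
    have "(\<integral>\<^sup>+t. ennreal (norm (h z t)) \<partial>lborel) \<le> ennreal (C * R) * indicator (ball 0 1) z" for z
    proof (cases "z = 0")
      \<comment> \<open>\<open>g\<close> vanishes from distance \<open>R\<close> on, so
        \<open>t\<close> only runs up to \<open>R / norm z\<close>. This length cancels the factor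
        \<open>norm z\<close> in the bound for the integrand, and the result is uniform in
        \<open>z\<close>.\<close>
      case False
      have "(\<integral>\<^sup>+t. ennreal (norm (h z t)) \<partial>lborel) \<le>
          (\<integral>\<^sup>+t. ennreal (norm z * C) * indicator (ball 0 1) z * indicator {0..R / norm z} t \<partial>lborel)"
      proof (rule nn_integral_mono)
        fix t :: real
        show "ennreal (norm (h z t)) \<le> ennreal (norm z * C) * indicator (ball 0 1) z * indicator {0..R / norm z} t"
        proof (cases "t > 0 \<and> t \<le> R / norm z \<and> z \<in> ball 0 1")
          case True
          have "\<bar>z \<bullet> g (t *\<^sub>R z)\<bar> \<le> norm z * C"
            by (rule order_trans[OF Cauchy_Schwarz_ineq2]) (intro mult_left_mono RC norm_ge_zero)
          then show ?thesis using True by (auto simp: h_def intro: ennreal_leI)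
        next
          case F: False
          have "h z t = 0"
          proof (cases "t > R / norm z")
            case True
            moreover have "0 < R / norm z" using RC(1) False by simp
            then have "t > 0" using True by linarith
            ultimately have "norm (t *\<^sub>R z) \<ge> R" using False by (simp add: field_simps)
            then show ?thesis using RC(3) by (simp add: h_def)
          qed (use F in \<open>auto simp: h_def\<close>)
          then show ?thesis by simp
        qed
      qed
      also have "\<dots> = ennreal (norm z * C) * indicator (ball 0 1) z * ennreal (R / norm z)"
        using RC by (subst nn_integral_cmult_indicator) auto
      also have "\<dots> = ennreal (C * R) * indicator (ball 0 1) z"
        using RC False by (auto simp: indicator_def ennreal_mult[symmetric])
      finally show ?thesis .
    qed (simp add: h_def)
    then have "(\<integral>\<^sup>+z. \<integral>\<^sup>+t. ennreal (norm (h z t)) \<partial>lborel \<partial>lborel) \<le>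
       (\<integral>\<^sup>+z. ennreal (C * R) * indicator (ball (0::real^3) 1) z \<partial>lborel)"
      by (rule nn_integral_mono)
    also have "\<dots> < \<infinity>"
      by (subst nn_integral_cmult_indicator) (auto simp: emeasure_ball3 ennreal_mult_less_top)
    finally show "(\<integral>\<^sup>+z. \<integral>\<^sup>+t. ennreal (norm (h z t)) \<partial>lborel \<partial>lborel) < \<infinity>" .
  qed
  define k where "k = (\<lambda>(w::real^3) (t::real). (w \<bullet> g w) * (1 / t ^ 4 * indicator {norm w<..} t))"
  have k_meas [measurable]: "case_prod k \<in> borel_measurable (lborel \<Otimes>\<^sub>M lborel)"
  proof -
    have "Measurable.pred (lborel \<Otimes>\<^sub>M lborel) (\<lambda>p::(real^3) \<times> real. snd p \<in> {norm (fst p)<..})"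
      by (simp add: greaterThan_def) measurable
    then show ?thesis unfolding k_def split_beta' indicator_def by measurable
  qed
  have int_k: "integrable (lborel \<Otimes>\<^sub>M lborel) (case_prod k)"
  proof (rule integrable_pairI[OF k_meas])
    have "AE w in lborel. (\<integral>\<^sup>+t. ennreal (norm (k w t)) \<partial>lborel) \<le>
        ennreal (C * vol3) * (ennreal (norm (newton w)) * indicator (ball 0 R) w)"
      using AE_lborel_singleton[of "0::real^3"]
    proof eventually_elim
      case (elim w)
      have "(\<integral>\<^sup>+t. ennreal (norm (k w t)) \<partial>lborel) \<le>
          (\<integral>\<^sup>+t. ennreal \<bar>w \<bullet> g w\<bar> * (ennreal (1 / t ^ 4) * indicator {norm w..} t) \<partial>lborel)"
        by (intro nn_integral_mono) (auto simp: k_def abs_mult ennreal_mult[symmetric] indicator_def)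
      also have "\<dots> = ennreal \<bar>w \<bullet> g w\<bar> * ennreal (1 / (3 * norm w ^ 3))"
        using elim by (simp add: nn_integral_cmult nn_integral_inverse_power4)
      also have "\<dots> \<le> ennreal (C * vol3) * (ennreal (norm (newton w)) * indicator (ball 0 R) w)"
      proof (cases "norm w < R")
        case True
        have "\<bar>w \<bullet> g w\<bar> \<le> norm w * C"
          by (rule order_trans[OF Cauchy_Schwarz_ineq2]) (intro mult_left_mono RC norm_ge_zero)
        then have "\<bar>w \<bullet> g w\<bar> * (1 / (3 * norm w ^ 3)) \<le> norm w * C * (1 / (3 * norm w ^ 3))"
          by (intro mult_right_mono) auto
        also have "\<dots> = C * vol3 * norm (newton w)"
          using elim vol3_pos unfolding norm_newton by (simp add: field_simps power2_eq_square power3_eq_cube)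
        finally show ?thesis using True RC
          by (auto simp: ennreal_mult[symmetric] mult.assoc intro: ennreal_leI)
      qed (use RC in auto)
      finally show ?case .
    qed
    then have "(\<integral>\<^sup>+w. \<integral>\<^sup>+t. ennreal (norm (k w t)) \<partial>lborel \<partial>lborel) \<le>
       (\<integral>\<^sup>+w. ennreal (C * vol3) * (ennreal (norm (newton w)) * indicator (ball 0 R) w) \<partial>lborel)"
      by (rule nn_integral_mono_AE)
    also have "\<dots> < \<infinity>"
      using nn_integral_newton_ball[of R] by (simp add: nn_integral_cmult ennreal_mult_less_top)
    finally show "(\<integral>\<^sup>+w. \<integral>\<^sup>+t. ennreal (norm (k w t)) \<partial>lborel \<partial>lborel) < \<infinity>" .
  qed
  \<comment> \<open>For \<open>t > 0\<close> the substitution \<open>w = t z\<close> has Jacobian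
    \<open>t ^ 3\<close>, and \<open>k\<close> is \<open>h\<close> in the new variable divided by
    it. For other \<open>t\<close> both functions vanish, \<open>k\<close> because no
    \<open>w\<close> satisfies \<open>norm w < t\<close>.\<close>
  have scale: "(LINT z|lborel. h z t) = (LINT w|lborel. k w t)" for t
  proof (cases "t > 0")
    case True
    have "(LINT w|lborel. k w t) = t ^ 3 * (LINT z|lborel. k (t *\<^sub>R z) t)"
      using True integral_scale[of "\<lambda>w. k w t" t] by simp
    also have "\<dots> = (LINT z|lborel. t ^ 3 * k (t *\<^sub>R z) t)" by simp
    also have "\<dots> = (LINT z|lborel. h z t)"
      using True by (intro Bochner_Integration.integral_cong)
        (auto simp: h_def k_def indicator_def power_numeral_reduce mult_less_cancel_left2)
    finally show ?thesis by simp
  next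
    case False
    then have "h z t = 0" "k z t = 0" for z
      using order_trans[OF norm_ge_zero[of z], of t] by (auto simp: h_def k_def indicator_def)
    then show ?thesis by simp
  qed
  have "- \<zeta> 0 * vol3 = (LINT z|lborel. indicator (ball (0::real^3) 1) z * - \<zeta> 0)"
    by (simp add: measure_def emeasure_ball3)
  also have "\<dots> = (LINT z|lborel. LINT t|lborel. h z t)"
  proof (rule integral_cong_AE)
    show "AE z in lborel. indicator (ball (0::real^3) 1) z * - \<zeta> 0 = (LINT t|lborel. h z t)"
      using AE_lborel_singleton[of "0::real^3"]
      by eventually_elim (simp add: h_def g_def integral_ray_smooth_grad[OF \<zeta>])
  qed measurable
  also have "\<dots> = (LINT t|lborel. LINT z|lborel. h z t)"
    using lborel_pair.Fubini_integral[OF int_h] by simp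
  also have "\<dots> = (LINT t|lborel. LINT w|lborel. k w t)" by (simp add: scale)
  also have "\<dots> = (LINT w|lborel. LINT t|lborel. k w t)"
    by (rule lborel_pair.Fubini_integral[OF int_k])
  also have "\<dots> = (LINT w|lborel. vol3 * (newton w \<bullet> g w))"
  proof (rule integral_cong_AE)
    show "AE w in lborel. (LINT t|lborel. k w t) = vol3 * (newton w \<bullet> g w)"
      using AE_lborel_singleton[of "0::real^3"]
    proof eventually_elim
      case (elim w)
      have "(LINT t|lborel. k w t) = (w \<bullet> g w) * (1 / (3 * norm w ^ 3))"
        using elim integral_inverse_power4[of "norm w"] by (simp add: k_def del: times_divide_eq_left)
      then show ?case using vol3_pos by (simp add: newton_def field_simps)
    qed
  qed measurable
  finally have "vol3 * (LINT w|lborel. newton w \<bullet> g w) = vol3 * - \<zeta> 0" by (simp add: mult.commute)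
  then show ?thesis unfolding g_def mult_left_cancel[OF vol3_nonzero] .
qed

lemma smooth_grad_translate: "test_function \<zeta> \<Longrightarrow> smooth_grad (\<lambda>x. \<zeta> (a + x)) x = smooth_grad \<zeta> (a + x)"
  by (simp add: smooth_grad_def dir_deriv_translate test_function_differentiable)

lemma integral_newton_smooth_grad:
  assumes \<zeta>: "test_function \<zeta>"
  shows "(LINT x|lborel. newton (x - y) \<bullet> smooth_grad \<zeta> x) = - \<zeta> y"
proof -
  have [measurable]: "smooth_grad \<zeta> \<in> borel_measurable borel" by (rule smooth_grad_measurable[OF \<zeta>])
  have "- \<zeta> y = (LINT w|lborel. newton w \<bullet> smooth_grad \<zeta> (y + w))"
    using integral_newton_smooth_grad_0[OF test_function_translate[OF \<zeta>, of y]]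
    by (simp add: smooth_grad_translate[OF \<zeta>])
  also have "\<dots> = (LINT x|lborel. newton (x - y) \<bullet> smooth_grad \<zeta> x)"
    using integral_translate[of "\<lambda>x. newton (x - y) \<bullet> smooth_grad \<zeta> x" y] by simp
  finally show ?thesis by simp
qed

subsection \<open>Convolution inequalities\<close>

text \<open>Values in \<open>ennreal\<close> make the convolution defined without conditions, so
  that Tonelli and monotonicity apply at once; the absolute convergence of real convolutions is read
  off from it.\<close>

definition nnconv :: "(real^3 \<Rightarrow> ennreal) \<Rightarrow> (real^3 \<Rightarrow> ennreal) \<Rightarrow> real^3 \<Rightarrow> ennreal" where
  "nnconv k f x = (\<integral>\<^sup>+y. k (x - y) * f y \<partial>lborel)"

lemma nn_integral_reflect:
  fixes h :: "real^3 \<Rightarrow> ennreal"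
  assumes [measurable]: "h \<in> borel_measurable borel"
  shows "(\<integral>\<^sup>+y. h (x - y) \<partial>lborel) = (\<integral>\<^sup>+y. h y \<partial>lborel)"
proof -
  have "(\<integral>\<^sup>+y. h (x - y) \<partial>lborel) = (\<integral>\<^sup>+y. h (- (- x + y)) \<partial>lborel)"
    by simp
  also have "\<dots> = (\<integral>\<^sup>+y. h (- y) \<partial>lborel)"
    by (rule nn_integral_translate[of "\<lambda>y. h (- y)" "- x"]) measurable
  also have "\<dots> = (\<integral>\<^sup>+y. h y \<partial>lborel)"
    using nn_integral_scale[of h "- 1"] by simp
  finally show ?thesis .
qed

lemma integral_reflect:
  fixes h :: "real^3 \<Rightarrow> real"
  assumes [measurable]: "h \<in> borel_measurable borel"
  shows "(LINT y|lborel. h (x - y)) = (LINT y|lborel. h y)"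
proof -
  have "(LINT y|lborel. h (x - y)) = (LINT y|lborel. h (- (- x + y)))"
    by simp
  also have "\<dots> = (LINT y|lborel. h (- y))"
    by (rule integral_translate[of "\<lambda>y. h (- y)" "- x"]) measurable
  also have "\<dots> = (LINT y|lborel. h y)"
    using integral_scale[of h "- 1"] by simp
  finally show ?thesis .
qed

lemma nnconv_commute:
  assumes [measurable]: "k \<in> borel_measurable borel" "f \<in> borel_measurable borel"
  shows "nnconv k f x = nnconv f k x"
proof -
  have "(\<integral>\<^sup>+y. k (x - y) * f (x - (x - y)) \<partial>lborel) = (\<integral>\<^sup>+w. k w * f (x - w) \<partial>lborel)"
    by (rule nn_integral_reflect[of "\<lambda>w. k w * f (x - w)" x]) measurable
  then show ?thesis by (simp add: nnconv_def mult.commute)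
qed

lemma nnconv_measurable [measurable]:
  assumes [measurable]: "k \<in> borel_measurable borel" "f \<in> borel_measurable borel"
  shows "nnconv k f \<in> borel_measurable borel"
  unfolding nnconv_def[abs_def] by measurable

lemma nn_integral_nnconv:
  assumes [measurable]: "k \<in> borel_measurable borel" "f \<in> borel_measurable borel"
  shows "(\<integral>\<^sup>+x. nnconv k f x \<partial>lborel) = (\<integral>\<^sup>+x. k x \<partial>lborel) * (\<integral>\<^sup>+x. f x \<partial>lborel)"
proof -
  have "(\<integral>\<^sup>+x. nnconv k f x \<partial>lborel) = (\<integral>\<^sup>+y. \<integral>\<^sup>+x. k (x - y) * f y \<partial>lborel \<partial>lborel)"
    unfolding nnconv_def by (rule lborel_pair.Fubini') measurable
  also have "\<dots> = (\<integral>\<^sup>+y. (\<integral>\<^sup>+x. k x \<partial>lborel) * f y \<partial>lborel)"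
  proof (rule nn_integral_cong)
    fix y :: "real^3"
    have "(\<integral>\<^sup>+x. k (x - y) * f y \<partial>lborel) = (\<integral>\<^sup>+x. k (x - y) \<partial>lborel) * f y"
      by (rule nn_integral_multc) measurable
    also have "(\<integral>\<^sup>+x. k (x - y) \<partial>lborel) = (\<integral>\<^sup>+x. k x \<partial>lborel)"
      using nn_integral_translate[of k "- y"] by simp
    finally show "(\<integral>\<^sup>+x. k (x - y) * f y \<partial>lborel) = (\<integral>\<^sup>+x. k x \<partial>lborel) * f y" .
  qed
  also have "\<dots> = (\<integral>\<^sup>+x. k x \<partial>lborel) * (\<integral>\<^sup>+x. f x \<partial>lborel)"
    by (rule nn_integral_cmult) measurable
  finally show ?thesis .
qed

text \<open>Cauchy-Schwarz for the functions 1 and \<open>f\<close> with respect to the measure of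
  density \<open>k (x - y)\<close>, whose total mass is the integral of \<open>k\<close>.\<close>

lemma nnconv_square_le:
  assumes [measurable]: "k \<in> borel_measurable borel" "f \<in> borel_measurable borel"
  shows "(nnconv k f x)\<^sup>2 \<le> (\<integral>\<^sup>+x. k x \<partial>lborel) * nnconv k (\<lambda>x. (f x)\<^sup>2) x"
proof -
  let ?M = "density lborel (\<lambda>y. k (x - y))"
  have "(\<integral>\<^sup>+y. 1 * f y \<partial>?M)\<^sup>2 \<le> (\<integral>\<^sup>+y. 1\<^sup>2 \<partial>?M) * (\<integral>\<^sup>+y. (f y)\<^sup>2 \<partial>?M)"
    by (rule Cauchy_Schwarz_nn_integral) measurable
  then show ?thesis
    using nn_integral_reflect[of k x] by (simp add: nn_integral_density nnconv_def emeasure_density)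
qed

text \<open>Integrating the pointwise bound yields the second factor of the integral of
  \<open>k\<close> through \<open>nn_integral_nnconv\<close>.\<close>

lemma nnconv_L1_L2:
  assumes [measurable]: "k \<in> borel_measurable borel" "f \<in> borel_measurable borel"
  shows "(\<integral>\<^sup>+x. (nnconv k f x)\<^sup>2 \<partial>lborel) \<le> (\<integral>\<^sup>+x. k x \<partial>lborel)\<^sup>2 * (\<integral>\<^sup>+x. (f x)\<^sup>2 \<partial>lborel)"
proof -
  have "(\<integral>\<^sup>+x. (nnconv k f x)\<^sup>2 \<partial>lborel) \<le> (\<integral>\<^sup>+x. (\<integral>\<^sup>+x. k x \<partial>lborel) * nnconv k (\<lambda>x. (f x)\<^sup>2) x \<partial>lborel)"
    by (intro nn_integral_mono nnconv_square_le) measurable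
  also have "\<dots> = (\<integral>\<^sup>+x. k x \<partial>lborel)\<^sup>2 * (\<integral>\<^sup>+x. (f x)\<^sup>2 \<partial>lborel)"
    by (simp add: nn_integral_cmult nn_integral_nnconv power2_eq_square mult.assoc)
  finally show ?thesis .
qed

lemma nnconv_L2_L2:
  assumes [measurable]: "k \<in> borel_measurable borel" "f \<in> borel_measurable borel"
  shows "(nnconv k f x)\<^sup>2 \<le> (\<integral>\<^sup>+x. (k x)\<^sup>2 \<partial>lborel) * (\<integral>\<^sup>+x. (f x)\<^sup>2 \<partial>lborel)"
proof -
  have "(nnconv k f x)\<^sup>2 \<le> (\<integral>\<^sup>+y. (k (x - y))\<^sup>2 \<partial>lborel) * (\<integral>\<^sup>+x. (f x)\<^sup>2 \<partial>lborel)"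
    unfolding nnconv_def by (rule Cauchy_Schwarz_nn_integral) measurable
  also have "(\<integral>\<^sup>+y. (k (x - y))\<^sup>2 \<partial>lborel) = (\<integral>\<^sup>+x. (k x)\<^sup>2 \<partial>lborel)"
    by (rule nn_integral_reflect[of "\<lambda>w. (k w)\<^sup>2"]) measurable
  finally show ?thesis .
qed

text \<open>The weights of the three factors below add up to 1, so their product is at most the sum
  \<open>X + Y + Z\<close>; after integration this is Young's inequality for \<open>1/q + 1/2 = 1 + 1/r\<close>.\<close>

lemma Young_pointwise:
  fixes a b A r :: real
  assumes a: "a \<ge> 0" and b: "b \<ge> 0" and A: "A > 0" and r: "r > 2"
  defines "q \<equiv> 2 * r / (r + 2)"
  shows "a * b \<le> A powr (1 / r) * (a powr q * b\<^sup>2 / A + a powr q + b\<^sup>2)"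
proof (cases "a = 0 \<or> b = 0")
  case True
  then show ?thesis using A by (intro order_trans[OF _ mult_nonneg_nonneg]) auto
next
  case False
  then have ab: "a > 0" "b > 0" using a b by auto
  have b2: "b\<^sup>2 = b powr 2" using ab by (simp add: powr_numeral)
  define X where "X = a powr q * b\<^sup>2 / A"
  define Y where "Y = a powr q"
  define Z where "Z = b\<^sup>2"
  have pos: "X > 0" "Y > 0" "Z > 0" using ab A by (auto simp: X_def Y_def Z_def)
  let ?M = "X + Y + Z"
  \<comment> \<open>\<open>q\<close> is chosen for this identity: the exponents of \<open>a\<close>
    in the first two factors add up to 1. Those of \<open>b\<close> in the first and third factor do
    so for every \<open>r\<close>.\<close>
  have e1: "q * (1 / r) + q * (1 / 2) = 1" using r by (simp add: q_def divide_simps) (simp add: algebra_simps)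
  have e2: "2 * (1 / r) + 2 * (1 / 2 - 1 / r) = 1" by (simp add: algebra_simps)
  have Xp: "X powr (1 / r) = a powr (q * (1 / r)) * b powr (2 * (1 / r)) / A powr (1 / r)"
    unfolding X_def b2 using ab A by (simp only: powr_divide powr_mult powr_powr powr_ge_zero mult_nonneg_nonneg less_imp_le)
  have Yp: "Y powr (1 / 2) = a powr (q * (1 / 2))" unfolding Y_def powr_powr ..
  have Zp: "Z powr (1 / 2 - 1 / r) = b powr (2 * (1 / 2 - 1 / r))" unfolding Z_def b2 powr_powr ..
  have gen: "p * (x * y / p * z * w) = x * z * (y * w)" if "p \<noteq> 0" for p x y z w :: real
    using that by simp
  have "A powr (1 / r) \<noteq> 0" using A by simp
  then have "A powr (1 / r) * (X powr (1 / r) * Y powr (1 / 2) * Z powr (1 / 2 - 1 / r)) =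
     (a powr (q * (1 / r)) * a powr (q * (1 / 2))) * (b powr (2 * (1 / r)) * b powr (2 * (1 / 2 - 1 / r)))"
    unfolding Xp Yp Zp by (rule gen)
  also have "\<dots> = a * b"
    unfolding powr_add[symmetric] e1 e2 using ab by simp
  finally have eq: "a * b = A powr (1 / r) * (X powr (1 / r) * Y powr (1 / 2) * Z powr (1 / 2 - 1 / r))" ..
  have "X powr (1 / r) * Y powr (1 / 2) * Z powr (1 / 2 - 1 / r) \<le>
      ?M powr (1 / r) * ?M powr (1 / 2) * ?M powr (1 / 2 - 1 / r)"
    using pos r by (intro mult_mono powr_mono2 mult_nonneg_nonneg) (auto simp: divide_simps)
  also have "\<dots> = ?M" using pos by (simp add: powr_add[symmetric])
  finally show ?thesis
    unfolding eq using A by (intro mult_left_mono) (auto simp: X_def Y_def Z_def)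
qed

text \<open>\<open>Young_pointwise\<close> is integrated in \<open>y\<close>, with its parameter
  \<open>A\<close> set to the value at \<open>x\<close> of the convolution of
  \<open>k powr q\<close> with the square of \<open>f\<close>. The first summand then contributes 1,
  the others the constants \<open>K'\<close> and \<open>F'\<close>. A majorant with integrable
  \<open>r\<close>-th power is stated instead of a norm bound, because a bounded term will be added
  to it.\<close>

lemma nnconv_Young:
  fixes k f :: "real^3 \<Rightarrow> real" and r :: real
  assumes [measurable]: "k \<in> borel_measurable borel" "f \<in> borel_measurable borel"
    and nn: "\<And>x. k x \<ge> 0" "\<And>x. f x \<ge> 0" and r: "r > 2"
  defines "q \<equiv> 2 * r / (r + 2)"
  assumes K: "(\<integral>\<^sup>+x. ennreal (k x powr q) \<partial>lborel) < \<infinity>" and F: "(\<integral>\<^sup>+x. ennreal ((f x)\<^sup>2) \<partial>lborel) < \<infinity>"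
  shows "\<exists>C\<ge>0. \<exists>A. integrable lborel A \<and> (\<forall>x. A x \<ge> 0) \<and>
     (AE x in lborel. nnconv (\<lambda>x. ennreal (k x)) (\<lambda>x. ennreal (f x)) x \<le> ennreal (C * A x powr (1 / r)))"
proof -
  define A where "A = nnconv (\<lambda>x. ennreal (k x powr q)) (\<lambda>x. ennreal ((f x)\<^sup>2))"
  define K' where "K' = enn2real (\<integral>\<^sup>+x. ennreal (k x powr q) \<partial>lborel)"
  define F' where "F' = enn2real (\<integral>\<^sup>+x. ennreal ((f x)\<^sup>2) \<partial>lborel)"
  have [measurable]: "A \<in> borel_measurable borel" unfolding A_def by measurable
  have A_int: "(\<integral>\<^sup>+x. A x \<partial>lborel) < \<infinity>"
    unfolding A_def using K F by (simp add: nn_integral_nnconv ennreal_mult_less_top)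
  have A_fin: "AE x in lborel. A x \<noteq> \<infinity>"
    by (rule nn_integral_PInf_AE) (use A_int in auto)
  have A': "AE x in lborel. ennreal (enn2real (A x)) = A x"
    using A_fin by eventually_elim (simp add: less_top)
  have int: "integrable lborel (\<lambda>x. enn2real (A x))"
  proof (rule integrableI_bounded)
    have "(\<integral>\<^sup>+x. ennreal (norm (enn2real (A x))) \<partial>lborel) = (\<integral>\<^sup>+x. A x \<partial>lborel)"
      by (rule nn_integral_cong_AE) (use A' in \<open>auto elim!: eventually_mono\<close>)
    then show "(\<integral>\<^sup>+x. ennreal (norm (enn2real (A x))) \<partial>lborel) < \<infinity>" using A_int by simp
  qed measurable
  have "AE x in lborel. nnconv (\<lambda>x. ennreal (k x)) (\<lambda>x. ennreal (f x)) x \<le>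
      ennreal ((1 + K' + F') * enn2real (A x) powr (1 / r))"
    using A_fin
  proof eventually_elim
    case (elim x)
    let ?a = "enn2real (A x)"
    have Ax: "A x = ennreal ?a" using elim by (simp add: less_top)
    show ?case
    proof (cases "?a = 0")
      \<comment> \<open>The pointwise inequality divides by \<open>A x\<close>. If that is 0, then
        for almost every \<open>y\<close> one of \<open>k (x - y)\<close> and \<open>f y\<close>
        vanishes, and so does the convolution.\<close>
      case True
      then have "A x = 0" using Ax by simp
      then have "(\<integral>\<^sup>+y. ennreal (k (x - y) powr q) * ennreal ((f y)\<^sup>2) \<partial>lborel) = 0"
        by (simp add: A_def nnconv_def)
      then have "AE y in lborel. ennreal (k (x - y) powr q) * ennreal ((f y)\<^sup>2) = 0"
        by (subst (asm) nn_integral_0_iff_AE) auto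
      then have "AE y in lborel. ennreal (k (x - y)) * ennreal (f y) = 0"
      proof eventually_elim
        case (elim y)
        then have "k (x - y) powr q * (f y)\<^sup>2 \<le> 0"
          by (simp add: ennreal_mult[symmetric] ennreal_eq_0_iff)
        then have "k (x - y) = 0 \<or> f y = 0"
          by (auto simp: mult_le_0_iff)
        then show ?case by auto
      qed
      then have "nnconv (\<lambda>x. ennreal (k x)) (\<lambda>x. ennreal (f x)) x = 0"
        unfolding nnconv_def by (subst nn_integral_0_iff_AE) auto
      then show ?thesis by simp
    next
      case False
      then have a: "?a > 0" using enn2real_nonneg[of "A x"] by linarith
      let ?c = "?a powr (1 / r)"
      have "nnconv (\<lambda>x. ennreal (k x)) (\<lambda>x. ennreal (f x)) x \<le>
        (\<integral>\<^sup>+y. ennreal ?c * (ennreal (1 / ?a) * (ennreal (k (x - y) powr q) * ennreal ((f y)\<^sup>2)) +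
            (ennreal (k (x - y) powr q) + ennreal ((f y)\<^sup>2))) \<partial>lborel)"
        unfolding nnconv_def
      proof (rule nn_integral_mono)
        fix y
        have "ennreal (k (x - y)) * ennreal (f y) = ennreal (k (x - y) * f y)"
          using nn by (simp add: ennreal_mult)
        also have "\<dots> \<le> ennreal (?c * (k (x - y) powr q * (f y)\<^sup>2 / ?a + k (x - y) powr q + (f y)\<^sup>2))"
          by (intro ennreal_leI) (use Young_pointwise[OF nn a r] in \<open>simp add: q_def\<close>)
        also have "\<dots> = ennreal ?c * (ennreal (1 / ?a) * (ennreal (k (x - y) powr q) * ennreal ((f y)\<^sup>2)) +
            (ennreal (k (x - y) powr q) + ennreal ((f y)\<^sup>2)))"
          using a by (simp add: ennreal_mult[symmetric] ennreal_plus[symmetric] add.assoc del: ennreal_plus)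
        finally show "ennreal (k (x - y)) * ennreal (f y) \<le> \<dots>" .
      qed
      also have "\<dots> = ennreal ?c * (ennreal (1 / ?a) * A x +
          ((\<integral>\<^sup>+y. ennreal (k (x - y) powr q) \<partial>lborel) + (\<integral>\<^sup>+y. ennreal ((f y)\<^sup>2) \<partial>lborel)))"
        by (simp add: nn_integral_cmult nn_integral_add A_def nnconv_def)
      also have "(\<integral>\<^sup>+y. ennreal (k (x - y) powr q) \<partial>lborel) = (\<integral>\<^sup>+y. ennreal (k y powr q) \<partial>lborel)"
        by (rule nn_integral_reflect[of "\<lambda>w. ennreal (k w powr q)"]) measurable
      also have "\<dots> = ennreal K'" using K by (simp add: K'_def less_top)
      also have "(\<integral>\<^sup>+y. ennreal ((f y)\<^sup>2) \<partial>lborel) = ennreal F'" using F by (simp add: F'_def less_top)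
      also have "ennreal (1 / ?a) * A x = 1"
        by (subst Ax) (use a in \<open>simp add: ennreal_mult[symmetric]\<close>)
      also have "ennreal ?c * (1 + (ennreal K' + ennreal F')) = ennreal ((1 + K' + F') * ?c)"
        unfolding ennreal_1[symmetric]
        by (simp add: ennreal_mult[symmetric] ennreal_plus[symmetric] K'_def F'_def mult.commute add.assoc
            del: ennreal_plus ennreal_1)
      finally show ?thesis .
    qed
  qed
  then show ?thesis using int
    by (intro exI[of _ "1 + K' + F'"] conjI exI[of _ "\<lambda>x. enn2real (A x)"]) (auto simp: K'_def F'_def)
qed

subsection \<open>Convolution with the Newtonian kernel\<close>

definition knear :: "real^3 \<Rightarrow> real" where "knear w = norm (newton w) * indicator (ball 0 1) w"
definition kfar :: "real^3 \<Rightarrow> real" where "kfar w = norm (newton w) * indicator (- ball 0 1) w"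

lemma knear_kfar_measurable [measurable]:
  "knear \<in> borel_measurable borel" "kfar \<in> borel_measurable borel"
  unfolding knear_def[abs_def] kfar_def[abs_def] by measurable

lemma knear_kfar_nonneg: "knear w \<ge> 0" "kfar w \<ge> 0"
  by (auto simp: knear_def kfar_def)

lemma norm_newton_split: "ennreal (norm (newton w)) = ennreal (knear w) + ennreal (kfar w)"
  by (auto simp: knear_def kfar_def indicator_def)

lemma knear_L1: "(\<integral>\<^sup>+w. ennreal (knear w) \<partial>lborel) < \<infinity>"
  using nn_integral_newton_ball[of 1] by (simp add: knear_def ennreal_mult ennreal_indicator)

lemma kfar_L2: "(\<integral>\<^sup>+w. (ennreal (kfar w))\<^sup>2 \<partial>lborel) < \<infinity>"
proof -
  have "(ennreal (kfar w))\<^sup>2 = ennreal ((1 / (3 * vol3))\<^sup>2) * (ennreal (1 / norm w ^ 4) * indicator (- ball 0 1) w)" for w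
    unfolding kfar_def norm_newton
    by (auto simp: indicator_def ennreal_mult[symmetric] ennreal_power power_divide power_mult_distrib power_mult[symmetric])
  then show ?thesis using nn_integral_norm_power4_far by (simp add: nn_integral_cmult ennreal_mult_less_top)
qed

text \<open>Meant for the Sobolev embedding, where \<open>q\<close> depends on \<open>r\<close>: the
  singularity has order \<open>2 * q\<close>, which must stay below the dimension 3.\<close>

lemma knear_powr:
  assumes "0 < q" "q < 3 / 2"
  shows "(\<integral>\<^sup>+w. ennreal (knear w powr q) \<partial>lborel) < \<infinity>"
proof -
  have "ennreal (knear w powr q) = ennreal ((1 / (3 * vol3)) powr q) * (ennreal (norm w powr (- (2 * q))) * indicator (ball 0 1) w)" for w
  proof (cases "w \<in> ball 0 1")
    case True
    have "(norm (newton w)) powr q = (1 / (3 * vol3)) powr q * norm w powr (- (2 * q))"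
    proof (cases "w = 0")
      case False
      then have "norm (newton w) = (1 / (3 * vol3)) * norm w powr (- 2)"
        unfolding norm_newton by (simp add: powr_minus powr_numeral divide_simps)
      then show ?thesis by (simp only:) (subst powr_mult, auto simp: powr_powr)
    qed (simp add: newton_def)
    then show ?thesis using True by (simp add: knear_def ennreal_mult)
  qed (use assms in \<open>simp add: knear_def\<close>)
  then show ?thesis
    using nn_integral_norm_powr_near_0[of "2 * q"] assms by (simp add: nn_integral_cmult ennreal_mult_less_top)
qed

lemma nnconv_add_left:
  assumes [measurable]: "k \<in> borel_measurable borel" "k' \<in> borel_measurable borel" "f \<in> borel_measurable borel"
  shows "nnconv (\<lambda>x. k x + k' x) f x = nnconv k f x + nnconv k' f x"
  unfolding nnconv_def by (simp add: distrib_right nn_integral_add)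

abbreviation newton_nnconv :: "(real^3 \<Rightarrow> real) \<Rightarrow> real^3 \<Rightarrow> ennreal" where
  "newton_nnconv f \<equiv> nnconv (\<lambda>w. ennreal (norm (newton w))) (\<lambda>y. ennreal \<bar>f y\<bar>)"

lemma newton_nnconv_split:
  assumes [measurable]: "f \<in> borel_measurable borel"
  shows "newton_nnconv f x = nnconv (\<lambda>w. ennreal (knear w)) (\<lambda>y. ennreal \<bar>f y\<bar>) x +
     nnconv (\<lambda>w. ennreal (kfar w)) (\<lambda>y. ennreal \<bar>f y\<bar>) x"
  unfolding norm_newton_split by (rule nnconv_add_left) measurable

text \<open>A sum is at most twice its larger summand. Only finiteness is wanted later, so the
  constant 4 serves.\<close>

lemma ennreal_square_add_le: "(a + b)\<^sup>2 \<le> 4 * a\<^sup>2 + 4 * (b::ennreal)\<^sup>2"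
proof -
  have *: "(a + b)\<^sup>2 \<le> 4 * b\<^sup>2" if "a \<le> b" for a b :: ennreal
  proof -
    have "(a + b)\<^sup>2 \<le> (2 * b)\<^sup>2" using that by (intro power_mono) (auto simp: mult_2 intro: add_right_mono)
    then show ?thesis by (simp add: power_mult_distrib)
  qed
  show ?thesis
  proof (cases "a \<le> b")
    case True
    from *[OF this] show ?thesis by (rule order_trans) simp
  next
    case False
    then have "b \<le> a" by simp
    from *[OF this] show ?thesis by (subst add.commute[of a]) (rule order_trans, auto)
  qed
qed

lemma L2_nn: "L2 f \<Longrightarrow> (\<integral>\<^sup>+x. (ennreal \<bar>f x\<bar>)\<^sup>2 \<partial>lborel) < \<infinity>" for f :: "real^3 \<Rightarrow> real"
  by (simp add: L2_def integrable_iff_bounded ennreal_power)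

text \<open>For the near part an L1 kernel acts on an L2 function; for the far part the roles are
  exchanged by commutativity, and an L1 function acts on the L2 kernel. This is the reason for
  asking \<open>h\<close> to be in both spaces.\<close>

lemma newton_nnconv_L2:
  assumes h: "L2 h" "integrable lborel h"
  shows "(\<integral>\<^sup>+x. (newton_nnconv h x)\<^sup>2 \<partial>lborel) < \<infinity>"
proof -
  have [measurable]: "h \<in> borel_measurable borel" using h by auto
  let ?n = "nnconv (\<lambda>w. ennreal (knear w)) (\<lambda>y. ennreal \<bar>h y\<bar>)"
  let ?f = "nnconv (\<lambda>w. ennreal (kfar w)) (\<lambda>y. ennreal \<bar>h y\<bar>)"
  have "(\<integral>\<^sup>+x. (?n x)\<^sup>2 \<partial>lborel) \<le> (\<integral>\<^sup>+x. ennreal (knear x) \<partial>lborel)\<^sup>2 * (\<integral>\<^sup>+x. (ennreal \<bar>h x\<bar>)\<^sup>2 \<partial>lborel)"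
    by (rule nnconv_L1_L2) measurable
  also have "\<dots> < \<infinity>" using knear_L1 L2_nn[OF h(1)]
    by (simp add: ennreal_mult_less_top power2_eq_square)
  finally have 1: "(\<integral>\<^sup>+x. (?n x)\<^sup>2 \<partial>lborel) < \<infinity>" .
  have "?f x = nnconv (\<lambda>y. ennreal \<bar>h y\<bar>) (\<lambda>w. ennreal (kfar w)) x" for x
    by (rule nnconv_commute) measurable
  then have "(\<integral>\<^sup>+x. (?f x)\<^sup>2 \<partial>lborel) = (\<integral>\<^sup>+x. (nnconv (\<lambda>y. ennreal \<bar>h y\<bar>) (\<lambda>w. ennreal (kfar w)) x)\<^sup>2 \<partial>lborel)"
    by simp
  also have "\<dots> \<le> (\<integral>\<^sup>+x. ennreal \<bar>h x\<bar> \<partial>lborel)\<^sup>2 * (\<integral>\<^sup>+x. (ennreal (kfar x))\<^sup>2 \<partial>lborel)"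
    by (rule nnconv_L1_L2) measurable
  also have "\<dots> < \<infinity>" using kfar_L2 h(2)
    by (simp add: ennreal_mult_less_top power2_eq_square integrable_iff_bounded)
  finally have 2: "(\<integral>\<^sup>+x. (?f x)\<^sup>2 \<partial>lborel) < \<infinity>" .
  have "(\<integral>\<^sup>+x. (newton_nnconv h x)\<^sup>2 \<partial>lborel) \<le> (\<integral>\<^sup>+x. 4 * (?n x)\<^sup>2 + 4 * (?f x)\<^sup>2 \<partial>lborel)"
    by (intro nn_integral_mono) (simp add: newton_nnconv_split ennreal_square_add_le)
  also have "\<dots> = 4 * (\<integral>\<^sup>+x. (?n x)\<^sup>2 \<partial>lborel) + 4 * (\<integral>\<^sup>+x. (?f x)\<^sup>2 \<partial>lborel)"
    by (simp add: nn_integral_add nn_integral_cmult)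
  also have "\<dots> < \<infinity>" using 1 2 by (simp add: ennreal_mult_less_top)
  finally show ?thesis .
qed

text \<open>Cauchy-Schwarz with the preceding bound. It justifies the exchanges of integration order
  in \<open>newton_conv_duality\<close> and \<open>newton_conv_weak_deriv\<close>.\<close>

lemma newton_bilinear_finite:
  assumes f: "L2 f" and h: "L2 h" "integrable lborel h"
  shows "(\<integral>\<^sup>+x. ennreal \<bar>f x\<bar> * newton_nnconv h x \<partial>lborel) < \<infinity>"
proof -
  have [measurable]: "f \<in> borel_measurable borel" "h \<in> borel_measurable borel" using f h by auto
  have "(\<integral>\<^sup>+x. ennreal \<bar>f x\<bar> * newton_nnconv h x \<partial>lborel)\<^sup>2 \<le>
     (\<integral>\<^sup>+x. (ennreal \<bar>f x\<bar>)\<^sup>2 \<partial>lborel) * (\<integral>\<^sup>+x. (newton_nnconv h x)\<^sup>2 \<partial>lborel)"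
    by (rule Cauchy_Schwarz_nn_integral) measurable
  also have "\<dots> < \<infinity>" using L2_nn[OF f] newton_nnconv_L2[OF h] by (simp add: ennreal_mult_less_top)
  finally show ?thesis by (auto simp: power2_eq_square ennreal_mult_less_top)
qed

definition newton_conv :: "3 \<Rightarrow> (real^3 \<Rightarrow> real) \<Rightarrow> real^3 \<Rightarrow> real" where
  "newton_conv i h x = (LINT y|lborel. newton (x - y) $ i * h y)"

lemma newton_conv_measurable [measurable]:
  assumes [measurable]: "h \<in> borel_measurable borel"
  shows "newton_conv i h \<in> borel_measurable borel"
  unfolding newton_conv_def[abs_def] by measurable

text \<open>Where the defining integral diverges, the left side is 0 by convention, so no
  integrability has to be assumed.\<close>

lemma newton_conv_le: "ennreal \<bar>newton_conv i h x\<bar> \<le> newton_nnconv h x"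
proof (cases "integrable lborel (\<lambda>y. newton (x - y) $ i * h y)")
  case True
  have "ennreal \<bar>newton_conv i h x\<bar> \<le> (\<integral>\<^sup>+y. ennreal (norm (newton (x - y) $ i * h y)) \<partial>lborel)"
    using integral_norm_bound_ennreal[OF True] by (simp add: newton_conv_def)
  also have "\<dots> \<le> newton_nnconv h x"
    unfolding nnconv_def
    by (intro nn_integral_mono)
       (auto simp: abs_mult ennreal_mult[symmetric] intro!: ennreal_leI mult_right_mono component_le_norm_cart)
  finally show ?thesis .
qed (simp add: newton_conv_def not_integrable_integral_eq)

lemma newton_conv_L2:
  assumes h: "L2 h" "integrable lborel h" shows "L2 (newton_conv i h)"
  unfolding L2_def
proof
  have [measurable]: "h \<in> borel_measurable borel" using h by auto
  show [measurable]: "newton_conv i h \<in> borel_measurable borel" by measurable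
  have "(\<integral>\<^sup>+x. ennreal (norm ((norm (newton_conv i h x))\<^sup>2)) \<partial>lborel) \<le> (\<integral>\<^sup>+x. (newton_nnconv h x)\<^sup>2 \<partial>lborel)"
  proof (rule nn_integral_mono)
    fix x
    have "ennreal (norm ((norm (newton_conv i h x))\<^sup>2)) = (ennreal \<bar>newton_conv i h x\<bar>)\<^sup>2"
      by (simp add: ennreal_power)
    then show "ennreal (norm ((norm (newton_conv i h x))\<^sup>2)) \<le> (newton_nnconv h x)\<^sup>2"
      using newton_conv_le[of i h x] by (simp add: power_mono)
  qed
  also have "\<dots> < \<infinity>" by (rule newton_nnconv_L2[OF h])
  finally show "integrable lborel (\<lambda>x. (norm (newton_conv i h x))\<^sup>2)"
    by (intro integrableI_bounded) auto
qed

text \<open>Fubini, with the sign from the oddness of the kernel. The convolution of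
  \<open>f\<close> is not claimed to lie in L2; integrability is asserted only after multiplication
  by a function such as \<open>h\<close>.\<close>

lemma newton_conv_duality:
  assumes f: "L2 f" and h: "L2 h" "integrable lborel h"
  shows "integrable lborel (\<lambda>x. f x * newton_conv i h x)"
    and "integrable lborel (\<lambda>y. h y * newton_conv i f y)"
    and "(LINT x|lborel. f x * newton_conv i h x) = - (LINT y|lborel. h y * newton_conv i f y)"
proof -
  have [measurable]: "f \<in> borel_measurable borel" "h \<in> borel_measurable borel" using f h by auto
  let ?J = "\<lambda>x y. f x * (newton (x - y) $ i * h y)"
  have int: "integrable (lborel \<Otimes>\<^sub>M lborel) (case_prod ?J)"
  proof (rule integrable_pairI)
    have "(\<integral>\<^sup>+x. \<integral>\<^sup>+y. ennreal (norm (?J x y)) \<partial>lborel \<partial>lborel) \<le>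
        (\<integral>\<^sup>+x. ennreal \<bar>f x\<bar> * newton_nnconv h x \<partial>lborel)"
    proof (rule nn_integral_mono)
      fix x
      have "(\<integral>\<^sup>+y. ennreal (norm (?J x y)) \<partial>lborel) \<le>
         (\<integral>\<^sup>+y. ennreal \<bar>f x\<bar> * (ennreal (norm (newton (x - y))) * ennreal \<bar>h y\<bar>) \<partial>lborel)"
        by (intro nn_integral_mono) (auto simp: abs_mult ennreal_mult[symmetric]
            intro!: ennreal_leI mult_left_mono mult_right_mono component_le_norm_cart)
      also have "\<dots> = ennreal \<bar>f x\<bar> * newton_nnconv h x"
        unfolding nnconv_def by (rule nn_integral_cmult) measurable
      finally show "(\<integral>\<^sup>+y. ennreal (norm (?J x y)) \<partial>lborel) \<le> ennreal \<bar>f x\<bar> * newton_nnconv h x" .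
    qed
    also have "\<dots> < \<infinity>" by (rule newton_bilinear_finite[OF f h])
    finally show "(\<integral>\<^sup>+x. \<integral>\<^sup>+y. ennreal (norm (?J x y)) \<partial>lborel \<partial>lborel) < \<infinity>" .
  qed measurable
  have 1: "(LINT y|lborel. ?J x y) = f x * newton_conv i h x" for x
    by (simp add: newton_conv_def)
  have 2: "(LINT x|lborel. ?J x y) = - (h y * newton_conv i f y)" for y
  proof -
    have "newton (x - y) $ i = - newton (y - x) $ i" for x
      using newton_uminus[of "y - x"] by (simp add: vec_eq_iff)
    then have "(LINT x|lborel. ?J x y) = (LINT x|lborel. - h y * (newton (y - x) $ i * f x))"
      by (simp add: mult_ac)
    then show ?thesis by (simp add: newton_conv_def)
  qed
  show "integrable lborel (\<lambda>x. f x * newton_conv i h x)"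
    using lborel_pair.integrable_fst[OF int] unfolding 1 .
  have "integrable lborel (\<lambda>y. - (h y * newton_conv i f y))"
    using lborel_pair.integrable_snd[OF int] unfolding 2 .
  from Bochner_Integration.integrable_minus[OF this]
  show "integrable lborel (\<lambda>y. h y * newton_conv i f y)" by simp
  show "(LINT x|lborel. f x * newton_conv i h x) = - (LINT y|lborel. h y * newton_conv i f y)"
    using lborel_pair.Fubini_integral[OF int] unfolding 1 2 by simp
qed

text \<open>The kernel is too singular to be differentiated, and \<open>u\<close> has only a weak
  derivative. Putting the shift on the test function leaves the kernel outside: for every fixed
  \<open>w\<close> the definition of the weak derivative applies to the translate of
  \<open>\<zeta>\<close> by \<open>w\<close>.\<close>

lemma newton_conv_weak_deriv:
  assumes u: "L2 u" and g: "L2 g" and w: "has_weak_deriv u b g" and \<zeta>: "test_function \<zeta>"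
  shows "(LINT x|lborel. g x * newton_conv i \<zeta> x) = - (LINT x|lborel. u x * newton_conv i (dir_deriv b \<zeta>) x)"
proof -
  have swap: "(LINT x|lborel. f x * newton_conv i h x) =
      (LINT w|lborel. newton w $ i * (LINT x|lborel. f x * h (x - w)))"
    if f: "L2 f" and h: "L2 h" "integrable lborel h" for f h
  proof -
    have [measurable]: "f \<in> borel_measurable borel" "h \<in> borel_measurable borel" using f h by auto
    let ?J = "\<lambda>x w. f x * (newton w $ i * h (x - w))"
    have int: "integrable (lborel \<Otimes>\<^sub>M lborel) (case_prod ?J)"
    proof (rule integrable_pairI)
      have "(\<integral>\<^sup>+x. \<integral>\<^sup>+w. ennreal (norm (?J x w)) \<partial>lborel \<partial>lborel) \<le>
          (\<integral>\<^sup>+x. ennreal \<bar>f x\<bar> * newton_nnconv h x \<partial>lborel)"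
      proof (rule nn_integral_mono)
        fix x
        have "(\<integral>\<^sup>+w. ennreal (norm (?J x w)) \<partial>lborel) \<le>
           (\<integral>\<^sup>+w. ennreal \<bar>f x\<bar> * (ennreal \<bar>h (x - w)\<bar> * ennreal (norm (newton w))) \<partial>lborel)"
          by (intro nn_integral_mono) (auto simp: abs_mult ennreal_mult[symmetric] mult.commute[of _ "norm (newton _)"]
              intro!: ennreal_leI mult_left_mono mult_right_mono component_le_norm_cart)
        also have "\<dots> = ennreal \<bar>f x\<bar> * nnconv (\<lambda>y. ennreal \<bar>h y\<bar>) (\<lambda>w. ennreal (norm (newton w))) x"
          unfolding nnconv_def by (rule nn_integral_cmult) measurable
        also have "nnconv (\<lambda>y. ennreal \<bar>h y\<bar>) (\<lambda>w. ennreal (norm (newton w))) x = newton_nnconv h x"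
          by (rule nnconv_commute) measurable
        finally show "(\<integral>\<^sup>+w. ennreal (norm (?J x w)) \<partial>lborel) \<le> ennreal \<bar>f x\<bar> * newton_nnconv h x" .
      qed
      also have "\<dots> < \<infinity>" by (rule newton_bilinear_finite[OF f h])
      finally show "(\<integral>\<^sup>+x. \<integral>\<^sup>+w. ennreal (norm (?J x w)) \<partial>lborel \<partial>lborel) < \<infinity>" .
    qed measurable
    have "newton_conv i h x = (LINT w|lborel. newton w $ i * h (x - w))" for x
      using integral_reflect[of "\<lambda>w. newton w $ i * h (x - w)" x] by (simp add: newton_conv_def)
    then have "(LINT x|lborel. f x * newton_conv i h x) = (LINT x|lborel. LINT w|lborel. ?J x w)"
      by simp
    also have "\<dots> = (LINT w|lborel. LINT x|lborel. ?J x w)"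
      by (rule lborel_pair.Fubini_integral[OF int, symmetric])
    also have "\<dots> = (LINT w|lborel. newton w $ i * (LINT x|lborel. f x * h (x - w)))"
      by (simp add: mult.left_commute[of _ "newton _ $ i"])
    finally show ?thesis .
  qed
  have shift: "(LINT x|lborel. g x * \<zeta> (x - v)) = - (LINT x|lborel. u x * dir_deriv b \<zeta> (x - v))" for v
  proof -
    have "test_function (\<lambda>x. \<zeta> (x - v))"
      using test_function_translate[OF \<zeta>, of "- v"] by simp
    then have "(LINT x|lborel. g x * \<zeta> (x - v)) = - (LINT x|lborel. u x * dir_deriv b (\<lambda>x. \<zeta> (x - v)) x)"
      using w by (simp add: has_weak_deriv_iff)
    moreover have "dir_deriv b (\<lambda>x. \<zeta> (x - v)) x = dir_deriv b \<zeta> (x - v)" for x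
      using dir_deriv_translate[of \<zeta> "- v" x b] test_function_differentiable[OF \<zeta>] by simp
    ultimately show ?thesis by simp
  qed
  show ?thesis
    by (simp add: swap u g \<zeta> shift test_function_L2 test_function_integrable test_function_dir_deriv)
qed

lemma newton_integrable_times_test_function:
  assumes \<eta>: "test_function \<eta>" shows "integrable lborel (\<lambda>y. newton (x - y) $ i * \<eta> y)"
proof -
  have [measurable]: "\<eta> \<in> borel_measurable borel" using \<eta> by auto
  obtain R where R: "R > 0" "\<And>x. norm x \<ge> R \<Longrightarrow> \<eta> x = 0" by (rule test_functionE[OF \<eta>]) (rule that)
  obtain C where C: "C > 0" "\<And>x. \<bar>\<eta> x\<bar> \<le> C" by (rule test_function_bounded[OF \<eta>]) (rule that)
  let ?B = "ball (0::real^3) (norm x + R)"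
  have "(\<integral>\<^sup>+y. ennreal (norm (newton (x - y) $ i * \<eta> y)) \<partial>lborel) \<le>
     (\<integral>\<^sup>+y. ennreal C * (ennreal (norm (newton (x - y))) * indicator ?B (x - y)) \<partial>lborel)"
  proof (rule nn_integral_mono)
    fix y
    show "ennreal (norm (newton (x - y) $ i * \<eta> y)) \<le> ennreal C * (ennreal (norm (newton (x - y))) * indicator ?B (x - y))"
    proof (cases "norm y < R")
      case True
      then have "x - y \<in> ?B" using norm_triangle_ineq4[of x y] by simp
      moreover have "\<bar>newton (x - y) $ i\<bar> * \<bar>\<eta> y\<bar> \<le> norm (newton (x - y)) * C"
        by (intro mult_mono component_le_norm_cart C) auto
      ultimately show ?thesis using C(1)
        by (auto simp: abs_mult ennreal_mult[symmetric] mult.commute intro!: ennreal_leI)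
    qed (use R in auto)
  qed
  also have "\<dots> = (\<integral>\<^sup>+w. ennreal C * (ennreal (norm (newton w)) * indicator ?B w) \<partial>lborel)"
    by (rule nn_integral_reflect[of "\<lambda>w. ennreal C * (ennreal (norm (newton w)) * indicator ?B w)"]) measurable
  also have "\<dots> < \<infinity>"
    using nn_integral_newton_ball[of "norm x + R"] by (simp add: nn_integral_cmult ennreal_mult_less_top)
  finally show ?thesis by (intro integrableI_bounded) auto
qed

text \<open>The fundamental solution property in convolution form: by oddness
  \<open>newton (x - y)\<close> is minus \<open>newton (y - x)\<close>, which cancels the sign in
  \<open>integral_newton_smooth_grad\<close>.\<close>

lemma newton_conv_grad:
  assumes \<zeta>: "test_function \<zeta>"
  shows "(\<Sum>i\<in>UNIV. newton_conv i (dir_deriv (dx i) \<zeta>) x) = \<zeta> x"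
proof -
  have "(\<Sum>i\<in>UNIV. newton_conv i (dir_deriv (dx i) \<zeta>) x) =
     (LINT y|lborel. (\<Sum>i\<in>UNIV. newton (x - y) $ i * dir_deriv (dx i) \<zeta> y))"
    unfolding newton_conv_def
    by (rule Bochner_Integration.integral_sum[symmetric])
       (rule newton_integrable_times_test_function[OF test_function_dir_deriv[OF \<zeta>]])
  also have "\<dots> = (LINT y|lborel. - (newton (y - x) \<bullet> smooth_grad \<zeta> y))"
  proof (rule Bochner_Integration.integral_cong[OF refl])
    fix y
    have "newton (x - y) = - newton (y - x)" using newton_uminus[of "y - x"] by simp
    then show "(\<Sum>i\<in>UNIV. newton (x - y) $ i * dir_deriv (dx i) \<zeta> y) = - (newton (y - x) \<bullet> smooth_grad \<zeta> y)"
      by (simp add: inner_vec_def smooth_grad_def sum_negf)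
  qed
  also have "\<dots> = \<zeta> x" using integral_newton_smooth_grad[OF \<zeta>, of x] by simp
  finally show ?thesis .
qed

text \<open>Duality moves the kernel from \<open>h\<close> to the gradient of
  \<open>\<zeta>\<close>, where the preceding identity applies. Up to the sign this is the weak
  divergence of the convolution.\<close>

lemma integral_newton_conv_grad:
  assumes h: "L2 h" "integrable lborel h" and \<zeta>: "test_function \<zeta>"
  shows "(\<Sum>i\<in>UNIV. LINT x|lborel. newton_conv i h x * dir_deriv (dx i) \<zeta> x) = - (LINT x|lborel. h x * \<zeta> x)"
proof -
  have t: "L2 (dir_deriv (dx i) \<zeta>)" for i by (intro test_function_L2 test_function_dir_deriv \<zeta>)
  have "(\<Sum>i\<in>UNIV. LINT x|lborel. newton_conv i h x * dir_deriv (dx i) \<zeta> x) =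
      - (\<Sum>i\<in>UNIV. LINT x|lborel. h x * newton_conv i (dir_deriv (dx i) \<zeta>) x)"
    using newton_conv_duality(3)[OF t h] by (simp add: mult.commute[of "newton_conv _ h _"] sum_negf)
  also have "(\<Sum>i\<in>UNIV. LINT x|lborel. h x * newton_conv i (dir_deriv (dx i) \<zeta>) x) =
      (LINT x|lborel. (\<Sum>i\<in>UNIV. h x * newton_conv i (dir_deriv (dx i) \<zeta>) x))"
    by (rule Bochner_Integration.integral_sum[symmetric]) (rule newton_conv_duality(2)[OF t h])
  also have "\<dots> = (LINT x|lborel. h x * \<zeta> x)"
    by (simp add: sum_distrib_left[symmetric] newton_conv_grad[OF \<zeta>])
  finally show ?thesis .
qed

text \<open>The electrostatic field of the charge density \<open>h\<close>, that is, minus the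
  gradient of its Coulomb potential.\<close>

definition newton_field :: "(real^3 \<Rightarrow> real) \<Rightarrow> real^3 \<Rightarrow> real^3" where
  "newton_field h x = (\<chi> i. newton_conv i h x)"

lemma newton_field_L2: "L2 h \<Longrightarrow> integrable lborel h \<Longrightarrow> L2 (newton_field h)"
  by (rule L2_vec_components) (simp add: newton_field_def newton_conv_L2)

lemma distr_div_eq: "distr_div dx (distr_of_vec F) \<eta> = - (\<Sum>i\<in>UNIV. LINT x|lborel. F x $ i * dir_deriv (dx i) \<eta> x)"
  by (simp add: distr_div_def distr_deriv_def distr_of_vec_def distr_of_def sum_negf)

lemma div_newton_field:
  assumes "L2 h" "integrable lborel h"
  shows "distr_eq (distr_div dx (distr_of_vec (newton_field h))) (distr_of h)"
  using integral_newton_conv_grad[OF assms]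
  by (simp add: distr_eq_def distr_div_eq newton_field_def) (simp add: distr_of_def)

subsection \<open>Newtonian potential of a square integrable field\<close>

text \<open>The sign turns \<open>newton (x - y)\<close> into \<open>newton (y - x)\<close>; by
  \<open>integral_newton_smooth_grad\<close> a test function is then recovered from minus its
  gradient.\<close>

definition newton_potential :: "(real^3 \<Rightarrow> real^3) \<Rightarrow> real^3 \<Rightarrow> real" where
  "newton_potential F x = - (\<Sum>i\<in>UNIV. newton_conv i (\<lambda>y. F y $ i) x)"

lemma newton_potential_measurable [measurable]:
  assumes "F \<in> borel_measurable borel" shows "newton_potential F \<in> borel_measurable borel"
  unfolding newton_potential_def[abs_def] using assms by measurable

lemma newton_potential_duality:
  assumes F: "L2 F" and h: "L2 h" "integrable lborel h"
  shows "integrable lborel (\<lambda>x. newton_potential F x * h x)"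
    and "(LINT x|lborel. newton_potential F x * h x) = (LINT x|lborel. F x \<bullet> newton_field h x)"
proof -
  note d = newton_conv_duality[OF L2_component[OF F] h]
  have eq: "newton_potential F x * h x = - (\<Sum>i\<in>UNIV. h x * newton_conv i (\<lambda>y. F y $ i) x)" for x
    by (simp add: newton_potential_def sum_distrib_left mult.commute)
  show "integrable lborel (\<lambda>x. newton_potential F x * h x)"
    unfolding eq by (intro Bochner_Integration.integrable_minus Bochner_Integration.integrable_sum d(2))
  have "(LINT x|lborel. newton_potential F x * h x) = - (\<Sum>i\<in>UNIV. LINT x|lborel. h x * newton_conv i (\<lambda>y. F y $ i) x)"
    unfolding eq by (simp add: Bochner_Integration.integral_sum d(2))
  also have "\<dots> = (\<Sum>i\<in>UNIV. LINT x|lborel. F x $ i * newton_conv i h x)"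
    by (simp add: d(3) sum_negf)
  also have "\<dots> = (LINT x|lborel. F x \<bullet> newton_field h x)"
    by (simp add: inner_vec_def newton_field_def Bochner_Integration.integral_sum d(1))
  finally show "(LINT x|lborel. newton_potential F x * h x) = (LINT x|lborel. F x \<bullet> newton_field h x)" .
qed

text \<open>Duality with \<open>h\<close> equal to \<open>u\<close> cut off to a compact set, which
  lies in L1 and L2. Local integrability of the potential alone would not give a meaning to its
  product with \<open>u\<close> in the Schroedinger equation.\<close>

lemma newton_potential_times_L2_locally_integrable:
  assumes F: "L2 F" and u: "L2 u"
  shows "locally_integrable (\<lambda>x. newton_potential F x * u x)"
proof (rule locally_integrableI)
  have [measurable]: "u \<in> borel_measurable borel" "F \<in> borel_measurable borel" using u F by auto
  show "(\<lambda>x. newton_potential F x * u x) \<in> borel_measurable borel" by measurable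
  fix K :: "(real^3) set" assume K: "compact K"
  then have [measurable]: "K \<in> sets borel" by (simp add: borel_compact)
  let ?h = "\<lambda>x. indicator K x * u x"
  have "L2 ?h" by (rule L2_bound[OF u]) (auto simp: indicator_def)
  moreover have "integrable lborel ?h" by (rule L2_mult[OF L2_indicator_compact(1)[OF K] u])
  ultimately have "integrable lborel (\<lambda>x. newton_potential F x * ?h x)"
    by (rule newton_potential_duality[OF F])
  then show "integrable lborel (\<lambda>x. indicator K x *\<^sub>R (newton_potential F x * u x))"
    by (simp add: mult.left_commute)
qed

lemma newton_potential_locally_integrable:
  assumes F: "L2 F" shows "locally_integrable (newton_potential F)"
proof (rule locally_integrableI)
  show "newton_potential F \<in> borel_measurable borel" using F by measurable
  fix K :: "(real^3) set" assume K: "compact K"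
  show "integrable lborel (\<lambda>x. indicator K x *\<^sub>R newton_potential F x)"
    using newton_potential_duality(1)[OF F L2_indicator_compact[OF K]] by (simp add: mult.commute)
qed

subsection \<open>Sobolev embedding\<close>

text \<open>Proved by testing, without approximating \<open>u\<close> by smooth functions: the
  derivative passes to \<open>\<zeta>\<close> by \<open>newton_conv_weak_deriv\<close>, and
  \<open>newton_conv_grad\<close> restores \<open>\<zeta>\<close>.\<close>

lemma H1_representation:
  assumes u: "L2 u" and g: "L2 g" and w: "has_weak_grad u g"
  shows "AE x in lborel. u x = - newton_potential g x"
proof (rule AE_eq_if_distr_eq)
  show "locally_integrable u" by (rule L2_locally_integrable[OF u])
  show "locally_integrable (\<lambda>x. - newton_potential g x)"
    using locally_integrable_cmult[OF newton_potential_locally_integrable[OF g], of "- 1"] by simp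
  show "distr_eq (distr_of u) (distr_of (\<lambda>x. - newton_potential g x))"
    unfolding distr_eq_def
  proof (intro allI impI)
    fix \<zeta> :: "real^3 \<Rightarrow> real" assume \<zeta>: "test_function \<zeta>"
    have t: "L2 \<zeta>" "integrable lborel \<zeta>" "L2 (dir_deriv (dx i) \<zeta>)" "integrable lborel (dir_deriv (dx i) \<zeta>)" for i
      by (intro test_function_L2 test_function_integrable test_function_dir_deriv \<zeta>)+
    have "distr_of (\<lambda>x. - newton_potential g x) \<zeta> = - (LINT x|lborel. g x \<bullet> newton_field \<zeta> x)"
      using newton_potential_duality(2)[OF g t(1,2)] by (simp add: distr_of_def)
    also have "\<dots> = - (\<Sum>i\<in>UNIV. LINT x|lborel. g x $ i * newton_conv i \<zeta> x)"
      by (simp add: inner_vec_def newton_field_def Bochner_Integration.integral_sum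
          newton_conv_duality(1)[OF L2_component[OF g] t(1,2)])
    also have "\<dots> = (\<Sum>i\<in>UNIV. LINT x|lborel. u x * newton_conv i (dir_deriv (dx i) \<zeta>) x)"
    proof -
      have "(LINT x|lborel. g x $ i * newton_conv i \<zeta> x) =
          - (LINT x|lborel. u x * newton_conv i (dir_deriv (dx i) \<zeta>) x)" for i
        using w by (intro newton_conv_weak_deriv[OF u L2_component[OF g] _ \<zeta>]) (simp add: has_weak_grad_def)
      then show ?thesis by (simp add: sum_negf)
    qed
    also have "\<dots> = (LINT x|lborel. (\<Sum>i\<in>UNIV. u x * newton_conv i (dir_deriv (dx i) \<zeta>) x))"
      by (rule Bochner_Integration.integral_sum[symmetric]) (rule newton_conv_duality(1)[OF u t(3,4)])
    also have "\<dots> = (LINT x|lborel. u x * \<zeta> x)"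
      by (simp add: sum_distrib_left[symmetric] newton_conv_grad[OF \<zeta>])
    finally show "distr_of u \<zeta> = distr_of (\<lambda>x. - newton_potential g x) \<zeta>" by (simp add: distr_of_def)
  qed
qed

lemma nnconv_mono: "(\<And>y. f y \<le> g y) \<Longrightarrow> nnconv k f x \<le> nnconv k g x"
  unfolding nnconv_def by (intro nn_integral_mono mult_left_mono) auto

text \<open>\<open>u\<close> is bounded by convolutions of the kernel with
  \<open>norm (g x)\<close>. The far part is at most a constant \<open>M\<close> by Cauchy-Schwarz,
  the near part at most \<open>C * A x powr (1 / r)\<close> by Young. Where \<open>M\<close>
  dominates, the square integrability of \<open>u\<close> is enough since \<open>r > 2\<close>;
  elsewhere the integrable \<open>A\<close> takes over.\<close>

lemma H1_powr_integrable:
  assumes u: "H1 u" and r: "2 < r" "r < 6"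
  shows "integrable lborel (\<lambda>x. \<bar>u x\<bar> powr r)"
proof -
  obtain g where g: "L2 g" "has_weak_grad u g" using u by (auto simp: H1_def)
  have u2: "L2 u" using u by (simp add: H1_def)
  have [measurable]: "u \<in> borel_measurable borel" "g \<in> borel_measurable borel" using u2 g by auto
  define f where "f = (\<lambda>x. norm (g x))"
  have [measurable]: "f \<in> borel_measurable borel" unfolding f_def by measurable
  have f_abs: "\<bar>f x\<bar> = f x" "f x \<ge> 0" for x by (auto simp: f_def)
  have f2: "(\<integral>\<^sup>+x. ennreal ((f x)\<^sup>2) \<partial>lborel) < \<infinity>"
    using L2_integrable_square[OF g(1)] by (simp add: integrable_iff_bounded f_def)
  define q where "q = 2 * r / (r + 2)"
  have q: "0 < q" "q < 3 / 2" using r by (auto simp: q_def divide_simps)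
  obtain C A where CA: "C \<ge> 0" "integrable lborel A" "\<And>x. A x \<ge> 0"
     "AE x in lborel. nnconv (\<lambda>x. ennreal (knear x)) (\<lambda>x. ennreal (f x)) x \<le> ennreal (C * A x powr (1 / r))"
    using nnconv_Young[OF knear_kfar_measurable(1) \<open>f \<in> borel_measurable borel\<close> knear_kfar_nonneg(1) f_abs(2) r(1)]
      knear_powr[OF q] f2 unfolding q_def by blast
  define M where "M = sqrt (enn2real ((\<integral>\<^sup>+w. (ennreal (kfar w))\<^sup>2 \<partial>lborel) * (\<integral>\<^sup>+x. (ennreal (f x))\<^sup>2 \<partial>lborel)))"
  have M: "nnconv (\<lambda>x. ennreal (kfar x)) (\<lambda>x. ennreal (f x)) x \<le> ennreal M" for x
  proof -
    let ?c = "nnconv (\<lambda>x. ennreal (kfar x)) (\<lambda>x. ennreal (f x)) x"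
    let ?P = "(\<integral>\<^sup>+w. (ennreal (kfar w))\<^sup>2 \<partial>lborel) * (\<integral>\<^sup>+x. (ennreal (f x))\<^sup>2 \<partial>lborel)"
    have fin: "?P < \<infinity>" using kfar_L2 f2 by (simp add: ennreal_mult_less_top ennreal_power f_abs)
    have "?c\<^sup>2 \<le> ?P" by (rule nnconv_L2_L2) measurable
    also have "?P = (ennreal M)\<^sup>2"
      using fin by (simp add: M_def ennreal_power less_top)
    finally have le: "?c\<^sup>2 \<le> (ennreal M)\<^sup>2" .
    show ?thesis
    proof (cases ?c)
      case (real y)
      then have "y\<^sup>2 \<le> M\<^sup>2" using le by (simp add: ennreal_power M_def)
      then have "y \<le> M" by (rule power2_le_imp_le) (simp add: M_def)
      then show ?thesis using real by (simp add: ennreal_leI)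
    qed (use le in \<open>simp add: ennreal_power M_def top_unique\<close>)
  qed
  have M0: "M \<ge> 0" by (simp add: M_def)
  have main: "AE x in lborel. \<bar>u x\<bar> \<le> 3 * (M + C * A x powr (1 / r))"
    using H1_representation[OF u2 g] CA(4)
  proof eventually_elim
    case (elim x)
    have "ennreal \<bar>newton_conv i (\<lambda>y. g y $ i) x\<bar> \<le> ennreal (M + C * A x powr (1 / r))" for i
    proof -
      have "ennreal \<bar>newton_conv i (\<lambda>y. g y $ i) x\<bar> \<le> newton_nnconv (\<lambda>y. g y $ i) x"
        by (rule newton_conv_le)
      also have "\<dots> \<le> newton_nnconv f x"
        by (intro nnconv_mono ennreal_leI) (simp add: f_def component_le_norm_cart)
      also have "\<dots> \<le> ennreal (C * A x powr (1 / r)) + ennreal M"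
        unfolding newton_nnconv_split[OF \<open>f \<in> borel_measurable borel\<close>]
        using elim(2) M[of x] by (intro add_mono) (simp_all add: f_abs)
      also have "\<dots> = ennreal (M + C * A x powr (1 / r))"
        using CA(1) M0 by (subst add.commute) (simp add: ennreal_plus)
      finally show ?thesis .
    qed
    then have le: "\<bar>newton_conv i (\<lambda>y. g y $ i) x\<bar> \<le> M + C * A x powr (1 / r)" for i
      using CA(1) M0 by (subst (asm) ennreal_le_iff) auto
    have "\<bar>u x\<bar> \<le> (\<Sum>i\<in>UNIV. \<bar>newton_conv i (\<lambda>y. g y $ i) x\<bar>)"
      using elim(1) by (simp add: newton_potential_def sum_abs)
    also have "\<dots> \<le> (\<Sum>i\<in>(UNIV :: 3 set). M + C * A x powr (1 / r))"
      by (intro sum_mono le)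
    finally show ?case by simp
  qed
  show ?thesis
  proof (rule Bochner_Integration.integrable_bound)
    \<comment> \<open>The factor 3 in \<open>main\<close> counts the components of the gradient; it
      becomes 6 because the sum of the near and far bounds is at most twice the larger one.\<close>
    show "integrable lborel (\<lambda>x. (6 * M) powr (r - 2) * (u x)\<^sup>2 + (6 * C) powr r * A x)"
      by (intro Bochner_Integration.integrable_add integrable_mult_right CA L2_square u2)
    show "AE x in lborel. norm (\<bar>u x\<bar> powr r) \<le> norm ((6 * M) powr (r - 2) * (u x)\<^sup>2 + (6 * C) powr r * A x)"
      using main
    proof eventually_elim
      case (elim x)
      have p: "(6 * M) powr (r - 2) * (u x)\<^sup>2 \<ge> 0" "(6 * C) powr r * A x \<ge> 0" using CA(3) by auto
      have "\<bar>u x\<bar> powr r \<le> (6 * M) powr (r - 2) * (u x)\<^sup>2 + (6 * C) powr r * A x"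
      proof (cases "C * A x powr (1 / r) \<le> M")
        case True
        then have le: "\<bar>u x\<bar> \<le> 6 * M" using elim by simp
        show ?thesis
        proof (cases "u x = 0")
          case False
          have "\<bar>u x\<bar> powr r = \<bar>u x\<bar> powr (r - 2) * \<bar>u x\<bar> powr 2"
            by (simp only: powr_add[symmetric]) simp
          also have "\<bar>u x\<bar> powr 2 = (u x)\<^sup>2" using False by (simp add: powr_numeral)
          also have "\<bar>u x\<bar> powr (r - 2) * (u x)\<^sup>2 \<le> (6 * M) powr (r - 2) * (u x)\<^sup>2"
            using le r by (intro mult_right_mono powr_mono2) auto
          finally show ?thesis using p by linarith
        qed (use p in simp)
      next
        case False
        then have "\<bar>u x\<bar> \<le> 6 * C * A x powr (1 / r)" using elim by simp
        then have "\<bar>u x\<bar> powr r \<le> (6 * C * A x powr (1 / r)) powr r"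
          using r by (intro powr_mono2) auto
        also have "\<dots> = (6 * C) powr r * A x"
          using CA(1,3) r by (subst powr_mult) (auto simp: powr_powr)
        finally show ?thesis using p by linarith
      qed
      then show ?case using p by auto
    qed
  qed measurable
qed

subsection \<open>The potential and the nonlinearity\<close>

text \<open>Splitting the lattice coordinates of \<open>x\<close> into integer and fractional parts
  shows that \<open>V\<close> takes all its values on the image of the unit cube, which is
  compact.\<close>

lemma periodic_potential_bounded:
  assumes V: "V_i V" "V_ii M V"
  obtains B where "\<And>x. 0 \<le> V x" "\<And>x. V x \<le> B"
proof -
  have inv: "invertible M" and per: "\<And>x z. (\<forall>i. z $ i \<in> \<int>) \<Longrightarrow> V x = V (x + M *v z)"
    using V(2) unfolding V_ii_def by blast+
  have cont: "continuous_on UNIV V" using V by (simp add: V_i_def)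
  let ?K = "(\<lambda>y. M *v y) ` cbox 0 1"
  have "compact ?K"
    by (rule compact_continuous_image[OF linear_continuous_on[OF matrix_vector_mul_bounded_linear] compact_cbox])
  then have "bounded (V ` ?K)"
    by (rule compact_imp_bounded[OF compact_continuous_image[OF continuous_on_subset[OF cont subset_UNIV]]])
  then obtain B where "\<forall>v\<in>V ` ?K. norm v \<le> B" unfolding bounded_iff by (rule exE)
  then have B: "\<bar>V (M *v y)\<bar> \<le> B" if "y \<in> cbox 0 1" for y using that by simp
  have "V x \<le> B" for x
  proof -
    obtain M' where M': "M ** M' = mat 1" using inv unfolding invertible_def by blast
    define y where "y = M' *v x"
    define z :: "real^3" where "z = (\<chi> i. of_int \<lfloor>y $ i\<rfloor>)"
    have "M *v y = x" by (simp add: y_def matrix_vector_mul_assoc M')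
    then have "x = M *v (y - z) + M *v z" by (simp add: matrix_vector_mult_diff_distrib)
    moreover have "\<forall>i. z $ i \<in> \<int>" by (simp add: z_def)
    ultimately have "V x = V (M *v (y - z))" using per[of z "M *v (y - z)"] by metis
    moreover have "of_int \<lfloor>y $ i\<rfloor> \<le> y $ i" "y $ i - of_int \<lfloor>y $ i\<rfloor> \<le> 1" for i by linarith+
    then have "y - z \<in> cbox 0 1" by (simp add: mem_box_cart z_def)
    ultimately show ?thesis using B[of "y - z"] by simp
  qed
  then show ?thesis using that[of B] V(1) by (simp add: V_i_def)
qed

text \<open>Away from 0 this is reflection. At 0 the one-sided derivative vanishes by
  \<open>W_i\<close>, so the even extension is differentiable there and its odd derivative is
  continuous.\<close>

lemma nonlinearity_derivative:
  assumes ev: "even_extended W" and Wi: "W_i E0 W"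
  obtains D where "\<And>s. (W has_real_derivative D s) (at s)" "continuous_on UNIV D" "\<And>s. D (- s) = - D s" "W 0 = 0"
proof -
  obtain W1 W2 where W:
    "\<And>s. s \<ge> 0 \<Longrightarrow> (W has_real_derivative W1 s) (at s within {0..})"
    "\<And>s. s \<ge> 0 \<Longrightarrow> (W1 has_real_derivative W2 s) (at s within {0..})"
    "W 0 = 0" "W1 0 = 0"
    using Wi unfolding W_i_def by blast
  define D where "D s = (if s \<ge> 0 then W1 s else - W1 (- s))" for s
  have even: "W (- s) = W s" for s using ev unfolding even_extended_def by (metis abs_minus_cancel)
  have pos: "(W has_real_derivative W1 s) (at s)" if "s > 0" for s
    using W(1)[of s] that at_within_interior[of s "{0..}"] by (simp add: interior_real_atLeast)
  have der: "(W has_real_derivative D s) (at s)" for s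
  proof -
    consider "s > 0" | "s < 0" | "s = 0" by linarith
    then show ?thesis
    proof cases
      case 1 then show ?thesis using pos by (simp add: D_def)
    next
      case 2
      then have "(W has_real_derivative W1 (- s)) (at (- s))" using pos by simp
      moreover have "(uminus has_real_derivative - 1) (at s)" by (auto intro!: derivative_eq_intros)
      ultimately have "((\<lambda>s. W (- s)) has_real_derivative W1 (- s) * - 1) (at s)"
        by (rule DERIV_chain2)
      then show ?thesis using 2 by (simp add: even D_def)
    next
      case 3
      have "((\<lambda>y. (W y - W 0) / (y - 0)) \<longlongrightarrow> W1 0) (at 0 within {0..})"
        using W(1)[of 0] unfolding has_field_derivative_iff by simp
      then have r: "((\<lambda>y. W y / y) \<longlongrightarrow> 0) (at_right 0)"
        using W(3,4) by (simp add: at_within_Ici_at_right)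
      have "((\<lambda>y. - (W y / y)) \<longlongrightarrow> - 0) (at_right 0)" by (intro tendsto_minus r)
      then have l: "((\<lambda>y. W y / y) \<longlongrightarrow> 0) (at_left 0)"
        unfolding filterlim_at_left_to_right by (simp add: even)
      have "((\<lambda>y. W y / y) \<longlongrightarrow> 0) (at 0)" by (rule filterlim_split_at[OF l r])
      then show ?thesis using 3 W(3,4) by (simp add: has_field_derivative_iff D_def)
    qed
  qed
  have c: "continuous_on {0..} W1"
    using W(2) by (intro DERIV_continuous_on) auto
  have "continuous_on {..0} (\<lambda>s. - W1 (- s))"
    by (intro continuous_intros continuous_on_compose2[OF c]) auto
  then have "continuous_on ({..0} \<union> {0..}) (\<lambda>s. if s \<le> 0 then - W1 (- s) else W1 s)"
    using c W(4) by (intro continuous_on_cases) auto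
  moreover have D_eq: "(\<lambda>s. if s \<le> 0 then - W1 (- s) else W1 s) = D"
    using W(4) by (auto simp: D_def)
  moreover have "{..0} \<union> {0..} = (UNIV :: real set)" by auto
  ultimately have "continuous_on UNIV D" by (simp only:)
  moreover have "D (- s) = - D s" for s using W(4) by (auto simp: D_def)
  ultimately show ?thesis using that[of D] der W(3) by blast
qed

text \<open>The growth bound joins the linear part of the derivative, coming from the quadratic term
  of \<open>W\<close>, with the two powers that control the remainder. Nonnegative coefficients make
  its right-hand side increasing in \<open>\<bar>s\<bar>\<close>.\<close>

locale nonlinearity =
  fixes W D :: "real \<Rightarrow> real" and a b c r l :: real
  assumes deriv_W: "(W has_real_derivative D s) (at s)"
    and continuous_D: "continuous_on UNIV D"
    and W_0: "W 0 = 0"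
    and coefficients: "0 \<le> a" "0 \<le> b" "0 \<le> c"
    and exponents: "2 < r" "r < 6" "2 < l" "l < 6"
    and growth: "\<bar>D s\<bar> \<le> a * \<bar>s\<bar> + b * \<bar>s\<bar> powr (r - 1) + c * \<bar>s\<bar> powr (l - 1)"

text \<open>The constants in \<open>W_iii\<close> carry no sign and are replaced by their absolute
  values; oddness of the derivative extends the bound to negative arguments.\<close>

lemma nonlinearity_exists:
  assumes ev: "even_extended W" and Wi: "W_i E0 W" and Wiii: "W_iii E0 W"
  obtains D a b c r l where "nonlinearity W D a b c r l"
proof -
  obtain D where D: "\<And>s. (W has_real_derivative D s) (at s)" "continuous_on UNIV D" "\<And>s. D (- s) = - D s" "W 0 = 0"
    by (rule nonlinearity_derivative[OF ev Wi]) (rule that)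
  obtain r l c1 c2 where rl: "2 < r" "r < 6" "2 < l" "l < 6" and
    g: "\<And>s. s \<ge> 0 \<Longrightarrow> \<bar>deriv (N_of E0 W) s\<bar> \<le> c1 * s powr (r - 1) + c2 * s powr (l - 1)"
    using Wiii unfolding W_iii_def greaterThanLessThan_iff Bex_def by blast
  have "deriv (N_of E0 W) s = D s - 2 * E0 * s" for s
  proof (rule DERIV_imp_deriv)
    show "(N_of E0 W has_real_derivative D s - 2 * E0 * s) (at s)"
      unfolding N_of_def[abs_def] by (auto intro!: derivative_eq_intros D)
  qed
  then have g': "\<bar>D s - 2 * E0 * s\<bar> \<le> c1 * s powr (r - 1) + c2 * s powr (l - 1)" if "s \<ge> 0" for s
    using g[OF that] by simp
  have pos: "\<bar>D s\<bar> \<le> 2 * \<bar>E0\<bar> * s + \<bar>c1\<bar> * s powr (r - 1) + \<bar>c2\<bar> * s powr (l - 1)" if "s \<ge> 0" for s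
  proof -
    have "\<bar>D s\<bar> \<le> \<bar>D s - 2 * E0 * s\<bar> + \<bar>2 * E0 * s\<bar>" by linarith
    also have "\<bar>2 * E0 * s\<bar> = 2 * \<bar>E0\<bar> * s" using that by (simp add: abs_mult)
    also have "\<bar>D s - 2 * E0 * s\<bar> \<le> \<bar>c1\<bar> * s powr (r - 1) + \<bar>c2\<bar> * s powr (l - 1)"
      by (rule order_trans[OF g'[OF that]]) (intro add_mono mult_right_mono, auto)
    finally show ?thesis by simp
  qed
  have "\<bar>D s\<bar> \<le> 2 * \<bar>E0\<bar> * \<bar>s\<bar> + \<bar>c1\<bar> * \<bar>s\<bar> powr (r - 1) + \<bar>c2\<bar> * \<bar>s\<bar> powr (l - 1)" for s
    using pos[of "\<bar>s\<bar>"] D(3)[of s] by (cases "s \<ge> 0") auto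
  then have "nonlinearity W D (2 * \<bar>E0\<bar>) \<bar>c1\<bar> \<bar>c2\<bar> r l"
    using D rl by unfold_locales auto
  then show ?thesis by (rule that)
qed

subsection \<open>Closure properties of \<open>H\<^sup>1\<close>\<close>

lemma H1_L2: "H1 u \<Longrightarrow> L2 u"
  by (simp add: H1_def)

lemma H1_measurable: "H1 u \<Longrightarrow> u \<in> borel_measurable borel"
  by (rule L2_measurable) (rule H1_L2)

lemma H1I: "L2 u \<Longrightarrow> has_weak_grad u g \<Longrightarrow> L2 g \<Longrightarrow> H1 u"
  by (auto simp: H1_def)

lemma H1_add: "H1 u \<Longrightarrow> H1 v \<Longrightarrow> H1 (\<lambda>x. u x + v x)"
  by (rule H1I[OF L2_add has_weak_grad_add L2_add]) (auto intro: H1_L2 H1_weak_grad)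

lemma L2_cmult: "L2 u \<Longrightarrow> L2 (\<lambda>x. c * u x)" for u :: "real^3 \<Rightarrow> real"
  using L2_scaleR[of u c] by simp

lemma H1_cmult: "H1 u \<Longrightarrow> H1 (\<lambda>x. c * u x)"
  by (rule H1I[OF L2_cmult has_weak_grad_cmult L2_scaleR]) (auto intro: H1_L2 H1_weak_grad)

lemma test_function_H1: "test_function \<eta> \<Longrightarrow> H1 \<eta>"
  by (rule H1I[OF test_function_L2 has_weak_grad_smooth L2_smooth_grad]) (auto intro: test_function_C_infinity)

subsection \<open>Integrability of the nonlinear terms\<close>

context nonlinearity
begin

definition dW_bound :: "real \<Rightarrow> real" where
  "dW_bound m = a * m + b * m powr (r - 1) + c * m powr (l - 1)"

lemma dW_bound_nonneg: "0 \<le> m \<Longrightarrow> 0 \<le> dW_bound m"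
  using coefficients by (simp add: dW_bound_def)

lemma dW_bound_mono: "0 \<le> m \<Longrightarrow> m \<le> n \<Longrightarrow> dW_bound m \<le> dW_bound n"
  unfolding dW_bound_def using coefficients exponents
  by (intro add_mono mult_left_mono powr_mono2) auto

lemma W_measurable [measurable]: "W \<in> borel_measurable borel"
  using deriv_W by (intro borel_measurable_continuous_onI continuous_at_imp_continuous_on ballI DERIV_isCont)

lemma D_measurable [measurable]: "D \<in> borel_measurable borel"
  by (intro borel_measurable_continuous_onI continuous_D)

lemma deriv_W_eq: "deriv W = D"
  using DERIV_imp_deriv[OF deriv_W] by blast

lemma D_bound: "\<bar>D s\<bar> \<le> dW_bound \<bar>s\<bar>"
  using growth by (simp add: dW_bound_def)

text \<open>The mean value theorem; as \<open>dW_bound\<close> increases, one value \<open>m\<close>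
  above both arguments covers the unknown intermediate point.\<close>

lemma W_lipschitz:
  assumes m: "\<bar>s\<bar> \<le> m" "\<bar>t\<bar> \<le> m"
  shows "\<bar>W t - W s\<bar> \<le> \<bar>t - s\<bar> * dW_bound m"
proof -
  have *: "\<bar>W t - W s\<bar> \<le> \<bar>t - s\<bar> * dW_bound m" if "s < t" "\<bar>s\<bar> \<le> m" "\<bar>t\<bar> \<le> m" for s t
  proof -
    obtain z where z: "s < z" "z < t" "W t - W s = (t - s) * D z"
      using MVT2[OF \<open>s < t\<close>, of W D] deriv_W by blast
    have "\<bar>D z\<bar> \<le> dW_bound m"
      by (rule order_trans[OF D_bound dW_bound_mono]) (use z that in auto)
    then show ?thesis unfolding z(3) abs_mult by (intro mult_left_mono) auto
  qed
  show ?thesis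
    using *[of s t] *[of t s] m dW_bound_nonneg[of m]
    by (cases s t rule: linorder_cases) (auto simp: abs_minus_commute)
qed

text \<open>The additional factor raises the exponents 1, \<open>r - 1\<close>, \<open>l - 1\<close>
  to 2, \<open>r\<close>, \<open>l\<close>, for which functions in H1 have integrable
  powers.\<close>

lemma times_dW_bound_integrable:
  assumes u: "H1 u" shows "integrable lborel (\<lambda>x. \<bar>u x\<bar> * dW_bound \<bar>u x\<bar>)"
proof -
  have eq: "\<bar>s\<bar> * dW_bound \<bar>s\<bar> = a * s\<^sup>2 + b * \<bar>s\<bar> powr r + c * \<bar>s\<bar> powr l" for s
  proof (cases "s = 0")
    case False
    have p: "\<bar>s\<bar> * \<bar>s\<bar> powr (e - 1) = \<bar>s\<bar> powr e" for e
      using False powr_add[of "\<bar>s\<bar>" 1 "e - 1"] by simp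
    have "\<bar>s\<bar> * dW_bound \<bar>s\<bar> = a * (\<bar>s\<bar> * \<bar>s\<bar>) + b * (\<bar>s\<bar> * \<bar>s\<bar> powr (r - 1)) + c * (\<bar>s\<bar> * \<bar>s\<bar> powr (l - 1))"
      by (simp add: dW_bound_def algebra_simps)
    then show ?thesis unfolding p by (simp add: power2_eq_square)
  qed (simp add: dW_bound_def)
  show ?thesis
    unfolding eq
    by (intro Bochner_Integration.integrable_add integrable_mult_right L2_square H1_L2 u H1_powr_integrable exponents)
qed

text \<open>A sum is at most twice its larger summand and H1 is closed under doubling, so the bound
  for a single function suffices.\<close>

lemma sum_times_dW_bound_integrable:
  assumes u: "H1 u" and v: "H1 v"
  shows "integrable lborel (\<lambda>x. (\<bar>u x\<bar> + \<bar>v x\<bar>) * dW_bound (\<bar>u x\<bar> + \<bar>v x\<bar>))"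
proof (rule Bochner_Integration.integrable_bound)
  have [measurable]: "u \<in> borel_measurable borel" "v \<in> borel_measurable borel" using u v by (auto intro: H1_measurable)
  show "integrable lborel (\<lambda>x. \<bar>2 * u x\<bar> * dW_bound \<bar>2 * u x\<bar> + \<bar>2 * v x\<bar> * dW_bound \<bar>2 * v x\<bar>)"
    by (intro Bochner_Integration.integrable_add times_dW_bound_integrable H1_cmult u v)
  have "(p + q) * dW_bound (p + q) \<le> 2 * p * dW_bound (2 * p) + 2 * q * dW_bound (2 * q)"
    if "0 \<le> p" "0 \<le> q" for p q
  proof -
    have m: "(p + q) * dW_bound (p + q) \<le> 2 * q * dW_bound (2 * q)" if "p \<le> q" "0 \<le> p" "0 \<le> q" for p q
      using that by (intro mult_mono dW_bound_mono dW_bound_nonneg) auto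
    have "0 \<le> 2 * p * dW_bound (2 * p)" "0 \<le> 2 * q * dW_bound (2 * q)"
      using that by (auto intro!: mult_nonneg_nonneg dW_bound_nonneg)
    moreover have "(p + q) * dW_bound (p + q) \<le> 2 * q * dW_bound (2 * q) \<or>
        (p + q) * dW_bound (p + q) \<le> 2 * p * dW_bound (2 * p)"
      using m[of p q] m[of q p] that unfolding add.commute[of q p] by linarith
    ultimately show ?thesis by linarith
  qed
  then show "AE x in lborel. norm ((\<bar>u x\<bar> + \<bar>v x\<bar>) * dW_bound (\<bar>u x\<bar> + \<bar>v x\<bar>)) \<le>
      norm (\<bar>2 * u x\<bar> * dW_bound \<bar>2 * u x\<bar> + \<bar>2 * v x\<bar> * dW_bound \<bar>2 * v x\<bar>)"
    by (intro AE_I2) (simp add: abs_mult dW_bound_nonneg mult_nonneg_nonneg)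
  show "(\<lambda>x. (\<bar>u x\<bar> + \<bar>v x\<bar>) * dW_bound (\<bar>u x\<bar> + \<bar>v x\<bar>)) \<in> borel_measurable lborel"
    unfolding dW_bound_def by measurable
qed

lemma W_comp_integrable:
  assumes u: "H1 u" shows "integrable lborel (\<lambda>x. W (u x))"
proof (rule Bochner_Integration.integrable_bound[OF times_dW_bound_integrable[OF u]])
  have [measurable]: "u \<in> borel_measurable borel" using H1_L2[OF u] by auto
  show "(\<lambda>x. W (u x)) \<in> borel_measurable lborel" by measurable
  show "AE x in lborel. norm (W (u x)) \<le> norm (\<bar>u x\<bar> * dW_bound \<bar>u x\<bar>)"
    using W_lipschitz[of 0 "\<bar>u x\<bar>" "u x" for x] by (intro AE_I2) (auto simp: W_0 abs_mult dW_bound_nonneg)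
qed

lemma D_comp_times_integrable:
  assumes u: "H1 u" and v: "H1 v" shows "integrable lborel (\<lambda>x. D (u x) * v x)"
proof (rule Bochner_Integration.integrable_bound[OF sum_times_dW_bound_integrable[OF u v]])
  have [measurable]: "u \<in> borel_measurable borel" "v \<in> borel_measurable borel" using u v by (auto intro: H1_measurable)
  show "(\<lambda>x. D (u x) * v x) \<in> borel_measurable lborel" by measurable
  show "AE x in lborel. norm (D (u x) * v x) \<le> norm ((\<bar>u x\<bar> + \<bar>v x\<bar>) * dW_bound (\<bar>u x\<bar> + \<bar>v x\<bar>))"
  proof (rule AE_I2)
    fix x
    have "\<bar>D (u x)\<bar> * \<bar>v x\<bar> \<le> dW_bound (\<bar>u x\<bar> + \<bar>v x\<bar>) * (\<bar>u x\<bar> + \<bar>v x\<bar>)"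
      by (intro mult_mono order_trans[OF D_bound dW_bound_mono] dW_bound_nonneg) auto
    then show "norm (D (u x) * v x) \<le> norm ((\<bar>u x\<bar> + \<bar>v x\<bar>) * dW_bound (\<bar>u x\<bar> + \<bar>v x\<bar>))"
      by (simp add: abs_mult dW_bound_nonneg mult.commute)
  qed
qed

text \<open>Where \<open>\<bar>u x\<bar> \<le> 1\<close> the majorant is constant; elsewhere an
  additional factor \<open>\<bar>u x\<bar>\<close> only enlarges it and gives an integrable
  function.\<close>

lemma D_comp_locally_integrable:
  assumes u: "H1 u" shows "locally_integrable (\<lambda>x. D (u x))"
proof (rule locally_integrable_bound)
  have [measurable]: "u \<in> borel_measurable borel" using H1_L2[OF u] by auto
  show "(\<lambda>x. D (u x)) \<in> borel_measurable borel" by measurable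
  show "locally_integrable (\<lambda>x. dW_bound 1 + \<bar>u x\<bar> * dW_bound \<bar>u x\<bar>)"
    by (intro locally_integrable_add continuous_imp_locally_integrable
        integrable_imp_locally_integrable times_dW_bound_integrable u) auto
  fix x
  have p: "0 \<le> \<bar>u x\<bar> * dW_bound \<bar>u x\<bar>" "0 \<le> dW_bound 1" by (auto intro!: mult_nonneg_nonneg dW_bound_nonneg)
  have "dW_bound \<bar>u x\<bar> \<le> dW_bound 1 + \<bar>u x\<bar> * dW_bound \<bar>u x\<bar>"
  proof (cases "\<bar>u x\<bar> \<le> 1")
    case True then show ?thesis using dW_bound_mono[of "\<bar>u x\<bar>" 1] p by simp
  next
    case False
    then have "1 * dW_bound \<bar>u x\<bar> \<le> \<bar>u x\<bar> * dW_bound \<bar>u x\<bar>"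
      by (intro mult_right_mono dW_bound_nonneg) auto
    then show ?thesis using p by simp
  qed
  then show "\<bar>D (u x)\<bar> \<le> \<bar>dW_bound 1 + \<bar>u x\<bar> * dW_bound \<bar>u x\<bar>\<bar>" using D_bound[of "u x"] p by simp
qed

end

subsection \<open>Divergences of square integrable fields\<close>

definition weak_div :: "(real^3 \<Rightarrow> real^3) \<Rightarrow> (real^3 \<Rightarrow> real) \<Rightarrow> bool" where
  "weak_div F f \<longleftrightarrow> L2 F \<and> locally_integrable f \<and> distr_eq (distr_div dx (distr_of_vec F)) (distr_of f)"

lemma weak_div_iff:
  "weak_div F f \<longleftrightarrow> L2 F \<and> locally_integrable f \<and>
    (\<forall>\<zeta>. test_function \<zeta> \<longrightarrow> - (LINT x|lborel. F x \<bullet> smooth_grad \<zeta> x) = (LINT x|lborel. f x * \<zeta> x))"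
proof -
  have "(\<Sum>i\<in>UNIV. LINT x|lborel. F x $ i * dir_deriv (dx i) \<zeta> x) = (LINT x|lborel. F x \<bullet> smooth_grad \<zeta> x)"
    if "L2 F" "test_function \<zeta>" for \<zeta>
    unfolding inner_vec_def smooth_grad_def
    using that by (simp add: Bochner_Integration.integral_sum L2_mult L2_component test_function_L2 test_function_dir_deriv)
  then show ?thesis
    by (auto simp: weak_div_def distr_eq_def distr_div_eq distr_of_def)
qed

lemma weak_div_add:
  assumes "weak_div F f" "weak_div G g"
  shows "weak_div (\<lambda>x. F x + G x) (\<lambda>x. f x + g x)"
  using assms unfolding weak_div_iff
  by (auto simp: inner_add_left distrib_right L2_inner L2_smooth_grad locally_integrable_times_test_function
      Bochner_Integration.integral_add intro!: L2_add locally_integrable_add)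

lemma weak_div_scaleR:
  assumes "weak_div F f" shows "weak_div (\<lambda>x. c *\<^sub>R F x) (\<lambda>x. c * f x)"
  unfolding weak_div_iff
proof (intro conjI allI impI)
  fix \<zeta> :: "real^3 \<Rightarrow> real" assume "test_function \<zeta>"
  then have "- (LINT x|lborel. F x \<bullet> smooth_grad \<zeta> x) = (LINT x|lborel. f x * \<zeta> x)"
    using assms by (simp add: weak_div_iff)
  then have "c * - (LINT x|lborel. F x \<bullet> smooth_grad \<zeta> x) = c * (LINT x|lborel. f x * \<zeta> x)" by simp
  then show "- (LINT x|lborel. c *\<^sub>R F x \<bullet> smooth_grad \<zeta> x) = (LINT x|lborel. c * f x * \<zeta> x)"
    by (simp add: mult.assoc)
qed (use assms in \<open>auto simp: weak_div_iff intro: L2_scaleR locally_integrable_cmult\<close>)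

lemma weak_div_newton_field:
  assumes "L2 h" "integrable lborel h" shows "weak_div (newton_field h) h"
  using assms by (simp add: weak_div_def newton_field_L2 div_newton_field L2_locally_integrable)

lemma weak_div_test_field:
  assumes \<eta>: "test_function \<eta>"
  shows "weak_div (\<lambda>x. \<eta> x *\<^sub>R dx i) (dir_deriv (dx i) \<eta>)"
  unfolding weak_div_iff
proof (intro conjI allI impI)
  show "L2 (\<lambda>x. \<eta> x *\<^sub>R dx i)"
    by (rule L2_bound[OF test_function_L2[OF \<eta>]]) (use \<eta> in \<open>auto simp: dx_def\<close>)
  show "locally_integrable (dir_deriv (dx i) \<eta>)"
    by (intro L2_locally_integrable test_function_L2 test_function_dir_deriv \<eta>)
  fix \<zeta> :: "real^3 \<Rightarrow> real" assume \<zeta>: "test_function \<zeta>"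
  have "(LINT x|lborel. \<eta> x *\<^sub>R dx i \<bullet> smooth_grad \<zeta> x) = (LINT x|lborel. \<eta> x * dir_deriv (dx i) \<zeta> x)"
    by (simp add: inner_smooth_grad dir_deriv_scaleR_direction test_function_differentiable[OF \<zeta>])
  also have "\<dots> = - (LINT x|lborel. dir_deriv (dx i) \<eta> x * \<zeta> x)"
    by (rule integral_dir_deriv_by_parts[OF \<eta> test_function_C_infinity[OF \<zeta>]])
  finally show "- (LINT x|lborel. \<eta> x *\<^sub>R dx i \<bullet> smooth_grad \<zeta> x) = (LINT x|lborel. dir_deriv (dx i) \<eta> x * \<zeta> x)"
    by simp
qed

subsection \<open>The energy near a minimiser\<close>

lemma phase_space_iff:
  "x \<in> phase_space q \<longleftrightarrow> H1 (amp x) \<and> L2 (cur x) \<and> weak_div (elec x) (\<lambda>a. q * (amp x a)\<^sup>2) \<and> L2 (magn x)"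
proof -
  have "locally_integrable (\<lambda>a. q * (amp x a)\<^sup>2)" if "H1 (amp x)"
    using that by (intro integrable_imp_locally_integrable integrable_mult_right L2_square H1_L2)
  then show ?thesis by (auto simp: phase_space_def weak_div_def)
qed

lemma integral_square_add:
  fixes f h :: "real^3 \<Rightarrow> 'b::euclidean_space"
  assumes f: "L2 f" and h: "L2 h"
  shows "(LINT x|lborel. (norm (f x + s *\<^sub>R h x))\<^sup>2) =
     (LINT x|lborel. (norm (f x))\<^sup>2) + 2 * s * (LINT x|lborel. f x \<bullet> h x) + s\<^sup>2 * (LINT x|lborel. (norm (h x))\<^sup>2)"
proof -
  have "(norm (f x + s *\<^sub>R h x))\<^sup>2 = ((norm (f x))\<^sup>2 + 2 * s * (f x \<bullet> h x)) + s\<^sup>2 * (norm (h x))\<^sup>2" for x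
    unfolding power2_norm_eq_inner
    by (simp add: inner_add_left inner_add_right inner_commute[of "h x" "f x"] power2_eq_square algebra_simps)
  then show ?thesis
    using L2_integrable_square[OF f] L2_integrable_square[OF h] L2_inner[OF f h] by simp
qed

lemma linear_term_zero:
  fixes p n :: real
  assumes "\<And>s. 0 \<le> 2 * s * p + s\<^sup>2 * n" shows "p = 0"
proof -
  have "((\<lambda>s. 2 * s * p + s\<^sup>2 * n) has_real_derivative 2 * p) (at 0)"
    by (auto intro!: derivative_eq_intros)
  then have "2 * p = 0" by (rule DERIV_local_min[of _ _ _ 1]) (use assms in auto)
  then show ?thesis by simp
qed

locale soliton_setting = nonlinearity W D a b c r l for W D a b c r l +
  fixes V :: "real^3 \<Rightarrow> real" and B q :: real
  assumes V_cont: "continuous_on UNIV V" and V_nonneg: "0 \<le> V x" and V_le: "V x \<le> B"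
begin

lemma V_measurable [measurable]: "V \<in> borel_measurable borel"
  by (intro borel_measurable_continuous_onI V_cont)

lemma V_times_L2: "L2 u \<Longrightarrow> L2 (\<lambda>x. V x * u x)" for u :: "real^3 \<Rightarrow> real"
proof -
  assume u: "L2 u"
  then have [measurable]: "u \<in> borel_measurable borel" by auto
  show "L2 (\<lambda>x. V x * u x)"
  proof (rule L2_bound[OF L2_cmult[OF u]])
    have "V x * \<bar>u x\<bar> \<le> \<bar>B\<bar> * \<bar>u x\<bar>" for x
      using V_le[of x] by (intro mult_right_mono) auto
    then show "norm (V x * u x) \<le> norm (\<bar>B\<bar> * u x)" for x
      using V_nonneg[of x] by (simp add: abs_mult)
  qed measurable
qed

lemma V_mult_integrable: "L2 u \<Longrightarrow> L2 v \<Longrightarrow> integrable lborel (\<lambda>x. V x * u x * v x)" for u v :: "real^3 \<Rightarrow> real"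
  by (intro L2_mult V_times_L2)

lemma V_square_integrable: "L2 u \<Longrightarrow> integrable lborel (\<lambda>x. V x * (u x)\<^sup>2)" for u :: "real^3 \<Rightarrow> real"
  using V_mult_integrable[of u u] by (simp add: power2_eq_square mult.assoc)

lemma integral_V_square_add:
  fixes u v :: "real^3 \<Rightarrow> real"
  assumes u: "L2 u" and v: "L2 v"
  shows "(LINT x|lborel. V x * (u x + s * v x)\<^sup>2) =
     (LINT x|lborel. V x * (u x)\<^sup>2) + 2 * s * (LINT x|lborel. V x * u x * v x) + s\<^sup>2 * (LINT x|lborel. V x * (v x)\<^sup>2)"
proof -
  have "V x * (u x + s * v x)\<^sup>2 = (V x * (u x)\<^sup>2 + 2 * s * (V x * u x * v x)) + s\<^sup>2 * (V x * (v x)\<^sup>2)" for x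
    by (simp add: power2_eq_square algebra_simps)
  then show ?thesis
    using V_square_integrable[OF u] V_square_integrable[OF v] V_mult_integrable[OF u v] by simp
qed

text \<open>Each of the six terms is integrable, the one with \<open>W\<close> by the Sobolev
  embedding, so the single integral in \<open>energy\<close> splits. The choice inside
  \<open>weak_grad\<close> disappears by uniqueness almost everywhere.\<close>

lemma energy_eq:
  assumes x: "x \<in> phase_space q" and g: "has_weak_grad (amp x) g" "L2 g"
  shows "energy W V x = 1/2 * (LINT a|lborel. (norm (g a))\<^sup>2) + (LINT a|lborel. V a * (amp x a)\<^sup>2)
     + (LINT a|lborel. W (amp x a)) + 1/2 * (LINT a|lborel. (norm (cur x a))\<^sup>2)
     + 1/2 * (LINT a|lborel. (norm (elec x a))\<^sup>2) + 1/2 * (LINT a|lborel. (norm (magn x a))\<^sup>2)"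
proof -
  have H: "H1 (amp x)" "L2 (cur x)" "L2 (elec x)" "L2 (magn x)" using x by (auto simp: phase_space_def)
  note wg = H1_weak_grad[OF H(1)]
  have [measurable]: "g \<in> borel_measurable borel" "weak_grad (amp x) \<in> borel_measurable borel"
    using g wg by auto
  have "(LINT a|lborel. (norm (weak_grad (amp x) a))\<^sup>2) = (LINT a|lborel. (norm (g a))\<^sup>2)"
  proof (rule integral_cong_AE)
    show "AE a in lborel. (norm (weak_grad (amp x) a))\<^sup>2 = (norm (g a))\<^sup>2"
      using has_weak_grad_AE_unique[OF wg(1) g(1)] by eventually_elim simp
  qed measurable
  moreover note L2_integrable_square[OF wg(2)] L2_integrable_square[OF H(2)] L2_integrable_square[OF H(3)]
    L2_integrable_square[OF H(4)] V_square_integrable[OF H1_L2[OF H(1)]] W_comp_integrable[OF H(1)]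
  ultimately show ?thesis
    unfolding energy_def by simp
qed

text \<open>The dilation \<open>\<mu>\<close> keeps the charge fixed along the variation \<open>u + s \<eta>\<close>.\<close>

lemma integral_W_has_derivative:
  assumes u: "H1 u" and v: "H1 v" and \<mu>: "\<mu> 0 = 1" "(\<mu> has_real_derivative \<mu>') (at 0)"
  shows "((\<lambda>s. LINT x|lborel. W (\<mu> s * (u x + s * v x))) has_real_derivative
     (LINT x|lborel. D (u x) * (\<mu>' * u x + v x))) (at 0)"
proof -
  have [measurable]: "u \<in> borel_measurable borel" "v \<in> borel_measurable borel"
    using u v by (auto intro: H1_measurable)
  define K where "K = \<bar>\<mu>'\<bar> + 1"
  have "((\<lambda>s. \<bar>(\<mu> s - \<mu> 0) / (s - 0)\<bar>) \<longlongrightarrow> \<bar>\<mu>'\<bar>) (at 0)"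
    using \<mu>(2) unfolding has_field_derivative_iff by (rule tendsto_rabs)
  then have "\<forall>\<^sub>F s in at 0. \<bar>(\<mu> s - \<mu> 0) / (s - 0)\<bar> < K"
    by (rule order_tendstoD) (simp add: K_def)
  then obtain d where d: "d > 0" "\<And>s. s \<noteq> 0 \<Longrightarrow> \<bar>s\<bar> < d \<Longrightarrow> \<bar>(\<mu> s - \<mu> 0) / (s - 0)\<bar> < K"
    unfolding eventually_at by (auto simp: dist_real_def)
  define e where "e = min d (min 1 (1 / K))"
  have K: "K > 0" by (simp add: K_def add_nonneg_pos)
  have e: "e > 0" using d(1) K by (simp add: e_def)
  have bounds: "\<bar>\<mu> s - 1\<bar> \<le> K * \<bar>s\<bar>" "\<bar>\<mu> s\<bar> \<le> 2" "\<bar>s\<bar> \<le> 1" if "s \<noteq> 0" "\<bar>s\<bar> < e" for s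
  proof -
    have s: "\<bar>s\<bar> < d" "\<bar>s\<bar> < 1" "\<bar>s\<bar> < 1 / K" using that by (auto simp: e_def)
    show 1: "\<bar>\<mu> s - 1\<bar> \<le> K * \<bar>s\<bar>"
      using d(2)[OF that(1) s(1)] that(1) by (simp add: \<mu>(1) abs_divide divide_simps)
    have "K * \<bar>s\<bar> \<le> 1" using s(3) K by (simp add: field_simps)
    then show "\<bar>\<mu> s\<bar> \<le> 2" using 1 by linarith
    show "\<bar>s\<bar> \<le> 1" using s by simp
  qed
  let ?w = "\<lambda>s x. W (\<mu> s * (u x + s * v x))"
  let ?h = "\<lambda>x. \<bar>2 * u x\<bar> + \<bar>2 * v x\<bar>"
  have pt: "\<bar>(?w s x - W (u x)) / s\<bar> \<le> (K + 2) * (?h x * dW_bound (?h x))" if s: "s \<noteq> 0" "\<bar>s\<bar> < e" for s x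
  proof -
    have "\<bar>\<mu> s * (u x + s * v x) - u x\<bar> = \<bar>(\<mu> s - 1) * u x + \<mu> s * s * v x\<bar>" by (simp add: algebra_simps)
    also have "\<dots> \<le> \<bar>\<mu> s - 1\<bar> * \<bar>u x\<bar> + \<bar>\<mu> s\<bar> * \<bar>s\<bar> * \<bar>v x\<bar>"
      by (rule order_trans[OF abs_triangle_ineq]) (simp add: abs_mult)
    also have "\<dots> \<le> (K * \<bar>s\<bar>) * \<bar>u x\<bar> + 2 * \<bar>s\<bar> * \<bar>v x\<bar>"
      using bounds[OF s] by (intro add_mono mult_right_mono) auto
    also have "\<dots> \<le> \<bar>s\<bar> * ((K + 2) * ?h x)"
    proof -
      have "K * \<bar>u x\<bar> + 2 * \<bar>v x\<bar> \<le> (K + 2) * ?h x"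
        using K mult_nonneg_nonneg[of K "\<bar>u x\<bar>"] mult_nonneg_nonneg[of K "\<bar>v x\<bar>"]
        by (simp add: abs_mult algebra_simps)
      from mult_left_mono[OF this, of "\<bar>s\<bar>"] show ?thesis by (simp add: algebra_simps)
    qed
    finally have diff: "\<bar>\<mu> s * (u x + s * v x) - u x\<bar> \<le> \<bar>s\<bar> * ((K + 2) * ?h x)" .
    have "\<bar>\<mu> s * (u x + s * v x)\<bar> \<le> 2 * (\<bar>u x\<bar> + 1 * \<bar>v x\<bar>)"
      unfolding abs_mult using bounds[OF s]
      by (intro mult_mono order_trans[OF abs_triangle_ineq] add_mono) (auto simp: abs_mult intro: mult_left_le_one_le)
    then have "\<bar>?w s x - W (u x)\<bar> \<le> \<bar>\<mu> s * (u x + s * v x) - u x\<bar> * dW_bound (?h x)"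
      by (intro W_lipschitz) auto
    also have "\<dots> \<le> \<bar>s\<bar> * ((K + 2) * ?h x) * dW_bound (?h x)"
      by (intro mult_right_mono diff dW_bound_nonneg) auto
    finally show ?thesis using s(1) by (simp add: abs_divide divide_simps mult_ac)
  qed
  have ptlim: "((\<lambda>s. (?w s x - W (u x)) / s) \<longlongrightarrow> D (u x) * (\<mu>' * u x + v x)) (at 0)" for x
  proof -
    have "((\<lambda>s. \<mu> s * (u x + s * v x)) has_real_derivative \<mu>' * u x + v x) (at 0)"
      by (auto intro!: derivative_eq_intros \<mu>(2) simp: \<mu>(1))
    then have "((\<lambda>s. ?w s x) has_real_derivative D (\<mu> 0 * (u x + 0 * v x)) * (\<mu>' * u x + v x)) (at 0)"
      by (rule DERIV_chain2[OF deriv_W])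
    then show ?thesis by (simp add: has_field_derivative_iff \<mu>(1))
  qed
  have H: "H1 (\<lambda>x. \<mu> s * (u x + s * v x))" for s
    by (intro H1_cmult H1_add u v)
  have "((\<lambda>s. ((LINT x|lborel. ?w s x) - (LINT x|lborel. W (u x))) / s) \<longlongrightarrow>
      (LINT x|lborel. D (u x) * (\<mu>' * u x + v x))) (at 0)"
    \<comment> \<open>Dominated convergence is applied along sequences tending to 0; the first
      \<open>N\<close> terms, which may lie outside the range of the majorant, are dropped.\<close>
    unfolding tendsto_at_iff_sequentially
  proof (intro allI impI)
    fix X :: "nat \<Rightarrow> real" assume X: "\<forall>i. X i \<in> UNIV - {0}" "X \<longlonglongrightarrow> 0"
    then have X0: "X i \<noteq> 0" for i by auto
    have "\<forall>\<^sub>F i in sequentially. \<bar>X i\<bar> < e"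
      using X(2) e by (auto simp: tendsto_iff dist_real_def)
    then obtain N where N: "\<And>i. i \<ge> N \<Longrightarrow> \<bar>X i\<bar> < e" by (auto simp: eventually_sequentially)
    have "(\<lambda>n. LINT x|lborel. (?w (X (n + N)) x - W (u x)) / X (n + N)) \<longlonglongrightarrow>
        (LINT x|lborel. D (u x) * (\<mu>' * u x + v x))"
    proof (rule integral_dominated_convergence[where w = "\<lambda>x. (K + 2) * (?h x * dW_bound (?h x))"])
      show "integrable lborel (\<lambda>x. (K + 2) * (?h x * dW_bound (?h x)))"
        by (intro integrable_mult_right sum_times_dW_bound_integrable H1_cmult u v)
      show "AE x in lborel. norm ((?w (X (n + N)) x - W (u x)) / X (n + N)) \<le> (K + 2) * (?h x * dW_bound (?h x))" for n
        using pt[OF X0 N[of "n + N"]] by (intro AE_I2) simp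
      show "AE x in lborel. (\<lambda>n. (?w (X (n + N)) x - W (u x)) / X (n + N)) \<longlonglongrightarrow> D (u x) * (\<mu>' * u x + v x)"
      proof (rule AE_I2)
        fix x
        have "((\<lambda>s. (?w s x - W (u x)) / s) \<circ> X) \<longlonglongrightarrow> D (u x) * (\<mu>' * u x + v x)"
          using ptlim[of x] X unfolding tendsto_at_iff_sequentially by blast
        then show "(\<lambda>n. (?w (X (n + N)) x - W (u x)) / X (n + N)) \<longlonglongrightarrow> D (u x) * (\<mu>' * u x + v x)"
          unfolding o_def by (rule LIMSEQ_ignore_initial_segment)
      qed
    qed measurable
    moreover have "(LINT x|lborel. (?w s x - W (u x)) / s) = ((LINT x|lborel. ?w s x) - (LINT x|lborel. W (u x))) / s" for s
      using W_comp_integrable[OF H] W_comp_integrable[OF u] by (simp add: Bochner_Integration.integral_diff)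
    ultimately have "(\<lambda>n. ((LINT x|lborel. ?w (X (n + N)) x) - (LINT x|lborel. W (u x))) / X (n + N)) \<longlonglongrightarrow>
        (LINT x|lborel. D (u x) * (\<mu>' * u x + v x))" by (simp only:)
    then show "((\<lambda>s. ((LINT x|lborel. ?w s x) - (LINT x|lborel. W (u x))) / s) \<circ> X) \<longlonglongrightarrow>
        (LINT x|lborel. D (u x) * (\<mu>' * u x + v x))"
      unfolding o_def by (rule LIMSEQ_offset)
  qed
  then show ?thesis by (simp add: has_field_derivative_iff \<mu>(1))
qed

end

locale minimiser = soliton_setting W D a b c r l V B q for W D a b c r l V B q +
  fixes x :: state
  assumes x_in: "x \<in> phase_space q" and charge_pos: "charge x > 0"
    and minimal: "\<And>y. y \<in> phase_space q \<Longrightarrow> charge y = charge x \<Longrightarrow> energy W V x \<le> energy W V y"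
begin

abbreviation u where "u \<equiv> amp x"
abbreviation E where "E \<equiv> elec x"

lemma parts: "H1 u" "L2 u" "L2 (cur x)" "L2 E" "L2 (magn x)" "weak_div E (\<lambda>a. q * (u a)\<^sup>2)"
  using x_in by (auto simp: phase_space_iff weak_div_def H1_L2)

lemma state_measurable [measurable]: "u \<in> borel_measurable borel" "E \<in> borel_measurable borel"
  "cur x \<in> borel_measurable borel" "magn x \<in> borel_measurable borel"
  using parts by auto

abbreviation g where "g \<equiv> weak_grad u"

lemma grad: "has_weak_grad u g" "L2 g"
  using H1_weak_grad[OF parts(1)] .

lemma cur_magn_zero: "AE a in lborel. cur x a = 0" "AE a in lborel. magn x a = 0"
proof -
  let ?y = "x\<lparr>cur := \<lambda>_. 0, magn := \<lambda>_. 0\<rparr>"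
  have y: "?y \<in> phase_space q"
    using x_in by (auto simp: phase_space_def L2_def)
  have "charge ?y = charge x" by (simp add: charge_def)
  from minimal[OF y this]
  have "(LINT a|lborel. (norm (cur x a))\<^sup>2) + (LINT a|lborel. (norm (magn x a))\<^sup>2) \<le> 0"
    using energy_eq[OF x_in grad] energy_eq[OF y, of g] grad by simp
  moreover have "(LINT a|lborel. (norm (cur x a))\<^sup>2) \<ge> 0" "(LINT a|lborel. (norm (magn x a))\<^sup>2) \<ge> 0"
    by simp_all
  ultimately have z: "(LINT a|lborel. (norm (cur x a))\<^sup>2) = 0" "(LINT a|lborel. (norm (magn x a))\<^sup>2) = 0"
    by linarith+
  show "AE a in lborel. cur x a = 0"
    using z(1) integral_nonneg_eq_0_iff_AE[OF L2_integrable_square[OF parts(3)]] by simp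
  show "AE a in lborel. magn x a = 0"
    using z(2) integral_nonneg_eq_0_iff_AE[OF L2_integrable_square[OF parts(5)]] by simp
qed

lemma elec_orthogonal:
  assumes F: "weak_div F (\<lambda>_. 0)" shows "(LINT a|lborel. E a \<bullet> F a) = 0"
proof (rule linear_term_zero)
  fix s :: real
  have LF: "L2 F" using F by (simp add: weak_div_def)
  let ?y = "x\<lparr>elec := \<lambda>a. E a + s *\<^sub>R F a\<rparr>"
  have "weak_div (\<lambda>a. E a + s *\<^sub>R F a) (\<lambda>a. q * (u a)\<^sup>2 + s * 0)"
    by (intro weak_div_add weak_div_scaleR F parts)
  then have y: "?y \<in> phase_space q"
    using x_in by (simp add: phase_space_iff)
  have "charge ?y = charge x" by (simp add: charge_def)
  from minimal[OF y this]
  have "(LINT a|lborel. (norm (E a))\<^sup>2) \<le> (LINT a|lborel. (norm (E a + s *\<^sub>R F a))\<^sup>2)"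
    using energy_eq[OF x_in grad] energy_eq[OF y, of g] grad by simp
  then show "0 \<le> 2 * s * (LINT a|lborel. E a \<bullet> F a) + s\<^sup>2 * (LINT a|lborel. (norm (F a))\<^sup>2)"
    unfolding integral_square_add[OF parts(4) LF] by simp
qed

definition \<phi> :: "real^3 \<Rightarrow> real" where "\<phi> = newton_potential E"

lemma has_weak_grad_potential: "has_weak_grad \<phi> (\<lambda>a. - E a)"
  unfolding has_weak_grad_def has_weak_deriv_iff
proof (intro allI conjI impI)
  show "locally_integrable \<phi>" unfolding \<phi>_def by (rule newton_potential_locally_integrable[OF parts(4)])
  fix i
  show "locally_integrable (\<lambda>a. (- E a) $ i)"
    using locally_integrable_cmult[OF L2_locally_integrable[OF L2_component[OF parts(4)]], of "- 1"] by simp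
  fix \<eta> :: "real^3 \<Rightarrow> real" assume \<eta>: "test_function \<eta>"
  let ?d = "dir_deriv (dx i) \<eta>"
  have d: "L2 ?d" "integrable lborel ?d"
    by (intro test_function_L2 test_function_integrable test_function_dir_deriv \<eta>)+
  have w: "weak_div (newton_field ?d) ?d" by (rule weak_div_newton_field[OF d])
  have w': "weak_div (\<lambda>a. - 1 *\<^sub>R (\<eta> a *\<^sub>R dx i)) (\<lambda>a. - 1 * ?d a)"
    by (intro weak_div_scaleR weak_div_test_field \<eta>)
  from weak_div_add[OF w w'] have "weak_div (\<lambda>a. newton_field ?d a + - 1 *\<^sub>R (\<eta> a *\<^sub>R dx i)) (\<lambda>_. 0)"
    by simp
  from elec_orthogonal[OF this]
  have "0 = (LINT a|lborel. E a \<bullet> newton_field ?d a + - 1 * (E a \<bullet> (\<eta> a *\<^sub>R dx i)))"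
    by (simp add: inner_add_right inner_diff_right)
  also have "\<dots> = (LINT a|lborel. E a \<bullet> newton_field ?d a) - (LINT a|lborel. E a \<bullet> (\<eta> a *\<^sub>R dx i))"
    using L2_inner[OF parts(4), of "newton_field ?d"] L2_inner[OF parts(4), of "\<lambda>a. \<eta> a *\<^sub>R dx i"] w weak_div_test_field[OF \<eta>, of i]
    by (simp add: weak_div_def)
  finally have "(LINT a|lborel. E a \<bullet> newton_field ?d a) = (LINT a|lborel. E a \<bullet> (\<eta> a *\<^sub>R dx i))" by simp
  also have "\<dots> = (LINT a|lborel. E a $ i * \<eta> a)"
    by (simp add: dx_def inner_axis mult.commute)
  finally have "(LINT a|lborel. \<phi> a * ?d a) = (LINT a|lborel. E a $ i * \<eta> a)"
    unfolding \<phi>_def newton_potential_duality(2)[OF parts(4) d] .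
  then show "- (LINT a|lborel. \<phi> a * ?d a) = (LINT a|lborel. (- E a) $ i * \<eta> a)" by simp
qed

section \<open>Variation of the amplitude under both constraints\<close>

definition kinetic where "kinetic = (LINT a|lborel. (norm (g a))\<^sup>2)"
text \<open>The derivative at \<open>m = 1\<close> of the energy under the dilation of
  \<open>u\<close> by \<open>m\<close> and of \<open>E\<close> by \<open>m^2\<close>, divided by the
  charge. The electric energy scales with the fourth power of \<open>m\<close>, the terms quadratic
  in \<open>u\<close> with the second, which explains the coefficients.\<close>

definition multiplier where
  "multiplier = (kinetic + 2 * (LINT a|lborel. V a * (u a)\<^sup>2) + 2 * (LINT a|lborel. (norm (E a))\<^sup>2)
     + (LINT a|lborel. D (u a) * u a)) / charge x"

text \<open>The density \<open>q * (amp y a)\<^sup>2\<close> is \<open>\<mu>\<^sup>2\<close> times a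
  quadratic polynomial in \<open>s\<close>, each coefficient of which is the divergence of a known
  field. The Gauss law therefore holds exactly and not only to first order in
  \<open>s\<close>.\<close>

lemma varied_state_admissible:
  assumes \<eta>: "test_function \<eta>" and s: "0 < (LINT a|lborel. (u a + s * \<eta> a)\<^sup>2)"
  defines "\<mu> \<equiv> sqrt (charge x / (LINT a|lborel. (u a + s * \<eta> a)\<^sup>2))"
  defines "y \<equiv> x\<lparr>amp := \<lambda>a. \<mu> * (u a + s * \<eta> a),
      elec := \<lambda>a. \<mu>\<^sup>2 *\<^sub>R (E a + s *\<^sub>R ((2 * q) *\<^sub>R newton_field (\<lambda>a. u a * \<eta> a) a
          + s *\<^sub>R (q *\<^sub>R newton_field (\<lambda>a. (\<eta> a)\<^sup>2) a)))\<rparr>"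
  shows "y \<in> phase_space q" "charge y = charge x"
proof -
  have \<mu>2: "\<mu>\<^sup>2 = charge x / (LINT a|lborel. (u a + s * \<eta> a)\<^sup>2)"
    using charge_pos s by (simp add: \<mu>_def)
  then show "charge y = charge x"
    using s by (simp add: y_def charge_def[of "x\<lparr>amp := _, elec := _\<rparr>"] power_mult_distrib)
  have h: "L2 (\<lambda>a. u a * \<eta> a)" "integrable lborel (\<lambda>a. u a * \<eta> a)" "L2 (\<lambda>a. (\<eta> a)\<^sup>2)" "integrable lborel (\<lambda>a. (\<eta> a)\<^sup>2)"
    using L2_times_test_function[OF parts(2) \<eta>] L2_mult[OF parts(2) test_function_L2[OF \<eta>]]
      test_function_square[OF \<eta>] by (auto intro: test_function_L2 test_function_integrable)
  have "weak_div (\<lambda>a. \<mu>\<^sup>2 *\<^sub>R (E a + s *\<^sub>R ((2 * q) *\<^sub>R newton_field (\<lambda>a. u a * \<eta> a) a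
          + s *\<^sub>R (q *\<^sub>R newton_field (\<lambda>a. (\<eta> a)\<^sup>2) a))))
      (\<lambda>a. \<mu>\<^sup>2 * (q * (u a)\<^sup>2 + s * ((2 * q) * (u a * \<eta> a) + s * (q * (\<eta> a)\<^sup>2))))"
    by (intro weak_div_scaleR weak_div_add weak_div_newton_field h parts)
  also have "(\<lambda>a. \<mu>\<^sup>2 * (q * (u a)\<^sup>2 + s * ((2 * q) * (u a * \<eta> a) + s * (q * (\<eta> a)\<^sup>2)))) =
      (\<lambda>a. q * (\<mu> * (u a + s * \<eta> a))\<^sup>2)"
    by (simp add: power2_eq_square algebra_simps)
  finally show "y \<in> phase_space q"
    using parts \<eta> unfolding phase_space_iff y_def
    by (simp add: H1_cmult H1_add test_function_H1)
qed

text \<open>Every dependence on \<open>s\<close> is made explicit, so that only the term with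
  \<open>W\<close> needs differentiation under the integral.\<close>

lemma energy_varied_state:
  assumes \<eta>: "test_function \<eta>" and s: "0 < (LINT a|lborel. (u a + s * \<eta> a)\<^sup>2)"
  defines "\<nu> \<equiv> charge x / (LINT a|lborel. (u a + s * \<eta> a)\<^sup>2)"
  defines "F1 \<equiv> \<lambda>a. (2 * q) *\<^sub>R newton_field (\<lambda>a. u a * \<eta> a) a" and "F2 \<equiv> \<lambda>a. q *\<^sub>R newton_field (\<lambda>a. (\<eta> a)\<^sup>2) a"
  shows "energy W V x \<le>
     1/2 * (\<nu> * (kinetic + 2 * s * (LINT a|lborel. g a \<bullet> smooth_grad \<eta> a) + s\<^sup>2 * (LINT a|lborel. (norm (smooth_grad \<eta> a))\<^sup>2)))
     + \<nu> * ((LINT a|lborel. V a * (u a)\<^sup>2) + 2 * s * (LINT a|lborel. V a * u a * \<eta> a) + s\<^sup>2 * (LINT a|lborel. V a * (\<eta> a)\<^sup>2))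
     + (LINT a|lborel. W (sqrt \<nu> * (u a + s * \<eta> a)))
     + 1/2 * (LINT a|lborel. (norm (cur x a))\<^sup>2)
     + 1/2 * (\<nu>\<^sup>2 * ((LINT a|lborel. (norm (E a))\<^sup>2)
         + 2 * s * ((LINT a|lborel. E a \<bullet> F1 a) + s * (LINT a|lborel. E a \<bullet> F2 a))
         + s\<^sup>2 * ((LINT a|lborel. (norm (F1 a))\<^sup>2) + 2 * s * (LINT a|lborel. F1 a \<bullet> F2 a) + s\<^sup>2 * (LINT a|lborel. (norm (F2 a))\<^sup>2))))
     + 1/2 * (LINT a|lborel. (norm (magn x a))\<^sup>2)"
proof -
  define \<mu> where "\<mu> = sqrt \<nu>"
  have \<nu>: "\<nu> > 0" using charge_pos s by (simp add: \<nu>_def)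
  have \<mu>2: "\<mu>\<^sup>2 = \<nu>" using \<nu> by (simp add: \<mu>_def)
  define y where "y = x\<lparr>amp := \<lambda>a. \<mu> * (u a + s * \<eta> a), elec := \<lambda>a. \<mu>\<^sup>2 *\<^sub>R (E a + s *\<^sub>R (F1 a + s *\<^sub>R F2 a))\<rparr>"
  have y: "y \<in> phase_space q" "charge y = charge x"
    using varied_state_admissible[OF \<eta> s] unfolding y_def F1_def F2_def \<mu>_def \<nu>_def by auto
  have h: "L2 (\<lambda>a. u a * \<eta> a)" "integrable lborel (\<lambda>a. u a * \<eta> a)" "L2 (\<lambda>a. (\<eta> a)\<^sup>2)" "integrable lborel (\<lambda>a. (\<eta> a)\<^sup>2)"
    using L2_times_test_function[OF parts(2) \<eta>] L2_mult[OF parts(2) test_function_L2[OF \<eta>]]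
      test_function_square[OF \<eta>] by (auto intro: test_function_L2 test_function_integrable)
  have F: "L2 F1" "L2 F2" unfolding F1_def F2_def by (intro L2_scaleR newton_field_L2 h)+
  have FF: "L2 (\<lambda>a. F1 a + s *\<^sub>R F2 a)" by (intro L2_add L2_scaleR F)
  have gr: "has_weak_grad (amp y) (\<lambda>a. \<mu> *\<^sub>R (g a + s *\<^sub>R smooth_grad \<eta> a))"
    unfolding y_def using \<eta>
    by (auto intro!: has_weak_grad_cmult has_weak_grad_add has_weak_grad_smooth grad test_function_C_infinity)
  have gr2: "L2 (\<lambda>a. \<mu> *\<^sub>R (g a + s *\<^sub>R smooth_grad \<eta> a))"
    by (intro L2_scaleR L2_add L2_smooth_grad grad \<eta>)
  have 1: "(LINT a|lborel. (norm (\<mu> *\<^sub>R (g a + s *\<^sub>R smooth_grad \<eta> a)))\<^sup>2) = \<nu> * (LINT a|lborel. (norm (g a + s *\<^sub>R smooth_grad \<eta> a))\<^sup>2)"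
    by (simp add: power_mult_distrib \<mu>2)
  have 2: "(LINT a|lborel. V a * (amp y a)\<^sup>2) = \<nu> * (LINT a|lborel. V a * (u a + s * \<eta> a)\<^sup>2)"
    by (simp add: y_def power_mult_distrib \<mu>2 mult.left_commute[of _ \<nu>])
  have 3: "(LINT a|lborel. (norm (elec y a))\<^sup>2) = \<nu>\<^sup>2 * (LINT a|lborel. (norm (E a + s *\<^sub>R (F1 a + s *\<^sub>R F2 a)))\<^sup>2)"
    using \<nu> by (simp add: y_def power_mult_distrib \<mu>2)
  have 4: "(LINT a|lborel. E a \<bullet> (F1 a + s *\<^sub>R F2 a)) = (LINT a|lborel. E a \<bullet> F1 a) + s * (LINT a|lborel. E a \<bullet> F2 a)"
    using L2_inner[OF parts(4) F(1)] L2_inner[OF parts(4) F(2)] by (simp add: inner_add_right)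
  have o: "amp y = (\<lambda>a. sqrt \<nu> * (u a + s * \<eta> a))" "cur y = cur x" "magn y = magn x"
    by (auto simp: y_def \<mu>_def)
  have "energy W V y = 1/2 * (\<nu> * (LINT a|lborel. (norm (g a + s *\<^sub>R smooth_grad \<eta> a))\<^sup>2))
     + \<nu> * (LINT a|lborel. V a * (u a + s * \<eta> a)\<^sup>2)
     + (LINT a|lborel. W (sqrt \<nu> * (u a + s * \<eta> a)))
     + 1/2 * (LINT a|lborel. (norm (cur x a))\<^sup>2)
     + 1/2 * (\<nu>\<^sup>2 * (LINT a|lborel. (norm (E a + s *\<^sub>R (F1 a + s *\<^sub>R F2 a)))\<^sup>2))
     + 1/2 * (LINT a|lborel. (norm (magn x a))\<^sup>2)"
    unfolding energy_eq[OF y(1) gr gr2] 1 2 3 unfolding o ..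
  then show ?thesis
    using minimal[OF y]
    unfolding integral_square_add[OF grad(2) L2_smooth_grad[OF \<eta>]] integral_square_add[OF parts(4) FF]
      integral_square_add[OF F] integral_V_square_add[OF parts(2) test_function_L2[OF \<eta>]] 4 kinetic_def
    by simp
qed

lemma Euler_Lagrange:
  assumes \<eta>: "test_function \<eta>"
  shows "(LINT a|lborel. g a \<bullet> smooth_grad \<eta> a) + 2 * (LINT a|lborel. V a * u a * \<eta> a)
     + (LINT a|lborel. D (u a) * \<eta> a) + 2 * q * (LINT a|lborel. \<phi> a * (u a * \<eta> a))
     = multiplier * (LINT a|lborel. u a * \<eta> a)"
proof -
  have t: "L2 \<eta>" "H1 \<eta>" using \<eta> by (auto intro: test_function_L2 test_function_H1)
  define C where "C = charge x"
  define p where "p = (LINT a|lborel. u a * \<eta> a)"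
  define m where "m = (LINT a|lborel. (\<eta> a)\<^sup>2)"
  define dn where "dn s = C + 2 * s * p + s\<^sup>2 * m" for s
  have dn: "(LINT a|lborel. (u a + s * \<eta> a)\<^sup>2) = dn s" for s
    using integral_square_add[OF parts(2) t(1), of s] by (simp add: dn_def C_def charge_def p_def m_def)
  have C: "C > 0" using charge_pos by (simp add: C_def)
  define \<nu> where "\<nu> s = C / dn s" for s
  have dn0: "dn 0 = C" by (simp add: dn_def)
  have \<nu>0: "\<nu> 0 = 1" using C by (simp add: \<nu>_def dn0)
  have dn_der: "(dn has_real_derivative 2 * p) (at 0)"
    unfolding dn_def[abs_def] by (auto intro!: derivative_eq_intros)
  \<comment> \<open>\<open>dn\<close> is the squared L2 norm of \<open>u + s \<eta>\<close>, with
    value \<open>C\<close> and slope \<open>2 * p\<close> at 0; hence the slope of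
    \<open>\<nu>\<close> is \<open>- 2 * p / C\<close>, and that of its square root half as
    much.\<close>
  have \<nu>_der: "(\<nu> has_real_derivative - 2 * p / C) (at 0)"
    unfolding \<nu>_def[abs_def] using C
    by (auto intro!: derivative_eq_intros dn_der simp: dn0 field_simps power2_eq_square)
  have \<mu>_der: "((\<lambda>s. sqrt (\<nu> s)) has_real_derivative - p / C) (at 0)"
    using C by (auto intro!: derivative_eq_intros \<nu>_der simp: \<nu>0 field_simps)
  define F1 where "F1 = (\<lambda>a. (2 * q) *\<^sub>R newton_field (\<lambda>a. u a * \<eta> a) a)"
  define F2 where "F2 = (\<lambda>a. q *\<^sub>R newton_field (\<lambda>a. (\<eta> a)\<^sup>2) a)"
  have h: "L2 (\<lambda>a. u a * \<eta> a)" "integrable lborel (\<lambda>a. u a * \<eta> a)"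
    using L2_times_test_function[OF parts(2) \<eta>] L2_mult[OF parts(2) t(1)] by auto
  define P1 where "P1 = (LINT a|lborel. g a \<bullet> smooth_grad \<eta> a)"
  define P2 where "P2 = (LINT a|lborel. (norm (smooth_grad \<eta> a))\<^sup>2)"
  define Q0 where "Q0 = (LINT a|lborel. V a * (u a)\<^sup>2)"
  define Q1 where "Q1 = (LINT a|lborel. V a * u a * \<eta> a)"
  define Q2 where "Q2 = (LINT a|lborel. V a * (\<eta> a)\<^sup>2)"
  define R0 where "R0 = (LINT a|lborel. (norm (E a))\<^sup>2)"
  define R1 where "R1 = (LINT a|lborel. E a \<bullet> F1 a)"
  define R2 where "R2 = (LINT a|lborel. E a \<bullet> F2 a)"
  define R3 where "R3 = (LINT a|lborel. (norm (F1 a))\<^sup>2)"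
  define R4 where "R4 = (LINT a|lborel. F1 a \<bullet> F2 a)"
  define R5 where "R5 = (LINT a|lborel. (norm (F2 a))\<^sup>2)"
  define S where "S = (LINT a|lborel. (norm (cur x a))\<^sup>2)"
  define T where "T = (LINT a|lborel. (norm (magn x a))\<^sup>2)"
  define w where "w s = (LINT a|lborel. W (sqrt (\<nu> s) * (u a + s * \<eta> a)))" for s
  define w' where "w' = (LINT a|lborel. D (u a) * (- p / C * u a + \<eta> a))"
  define j where "j s = 1/2 * (\<nu> s * (kinetic + 2 * s * P1 + s\<^sup>2 * P2)) + \<nu> s * (Q0 + 2 * s * Q1 + s\<^sup>2 * Q2)
     + w s + 1/2 * S + 1/2 * ((\<nu> s)\<^sup>2 * (R0 + 2 * s * (R1 + s * R2) + s\<^sup>2 * (R3 + 2 * s * R4 + s\<^sup>2 * R5))) + 1/2 * T" for s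
  have w_der: "(w has_real_derivative w') (at 0)"
    unfolding w_def[abs_def] w'_def
    by (rule integral_W_has_derivative[OF parts(1) t(2) _ \<mu>_der]) (simp add: \<nu>0)
  have "(j has_real_derivative 1/2 * (- 2 * p / C * kinetic + 2 * P1) + (- 2 * p / C * Q0 + 2 * Q1) + w'
      + 1/2 * (2 * (- 2 * p / C) * R0 + 2 * R1)) (at 0)"
    unfolding j_def[abs_def]
    by (rule derivative_eq_intros \<nu>_der w_der refl)+ (simp add: \<nu>0 algebra_simps)
  moreover have "\<exists>d>0. \<forall>s. \<bar>0 - s\<bar> < d \<longrightarrow> j 0 \<le> j s"
  proof -
    \<comment> \<open>The varied state needs \<open>dn s > 0\<close>, which is known only near 0; a
      local minimum of \<open>j\<close> at 0 is enough.\<close>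
    have "isCont dn 0" by (rule DERIV_isCont[OF dn_der])
    then have "\<forall>\<^sub>F s in at 0. dn s > 0"
      unfolding isCont_def by (rule order_tendstoD) (simp add: dn0 C)
    then obtain d where d: "d > 0" "\<And>s. s \<noteq> 0 \<Longrightarrow> \<bar>s\<bar> < d \<Longrightarrow> dn s > 0"
      unfolding eventually_at by (auto simp: dist_real_def)
    have j0: "j 0 = energy W V x"
      unfolding energy_eq[OF x_in grad] by (simp add: j_def w_def \<nu>0 kinetic_def Q0_def R0_def S_def T_def)
    have "j 0 \<le> j s" if "\<bar>0 - s\<bar> < d" for s
    proof (cases "s = 0")
      case False
      then have "dn s > 0" using d(2)[of s] that by simp
      then show ?thesis
        using energy_varied_state[OF \<eta>, of s] unfolding dn j0 C_def[symmetric] \<nu>_def[symmetric]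
        unfolding j_def w_def P1_def P2_def Q0_def Q1_def Q2_def R0_def R1_def R2_def R3_def R4_def R5_def S_def T_def F1_def F2_def
        by blast
    qed simp
    then show ?thesis using d(1) by blast
  qed
  then obtain d where "d > 0" "\<forall>s. \<bar>0 - s\<bar> < d \<longrightarrow> j 0 \<le> j s" by blast
  ultimately have *: "1/2 * (- 2 * p / C * kinetic + 2 * P1) + (- 2 * p / C * Q0 + 2 * Q1) + w'
      + 1/2 * (2 * (- 2 * p / C) * R0 + 2 * R1) = 0"
    by (rule DERIV_local_min)
  have w'_eq: "w' = - p / C * (LINT a|lborel. D (u a) * u a) + (LINT a|lborel. D (u a) * \<eta> a)"
  proof -
    have "w' = (LINT a|lborel. - p / C * (D (u a) * u a) + D (u a) * \<eta> a)"
      unfolding w'_def by (rule Bochner_Integration.integral_cong) (auto simp: algebra_simps)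
    also have "\<dots> = - p / C * (LINT a|lborel. D (u a) * u a) + (LINT a|lborel. D (u a) * \<eta> a)"
      using D_comp_times_integrable[OF parts(1) parts(1)] D_comp_times_integrable[OF parts(1) t(2)]
      by (subst Bochner_Integration.integral_add) auto
    finally show ?thesis .
  qed
  \<comment> \<open>The correction of the electric field couples the variation to the potential: by
    duality its pairing with \<open>E\<close> is the pairing of \<open>\<phi>\<close> with
    \<open>2 q u \<eta>\<close>.\<close>
  have R1_eq: "R1 = 2 * q * (LINT a|lborel. \<phi> a * (u a * \<eta> a))"
    unfolding R1_def F1_def \<phi>_def newton_potential_duality(2)[OF parts(4) h] by simp
  have "multiplier * p = p / C * (kinetic + 2 * Q0 + 2 * R0 + (LINT a|lborel. D (u a) * u a))"
    by (simp add: multiplier_def C_def Q0_def R0_def)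
  moreover have "P1 + 2 * Q1 + (LINT a|lborel. D (u a) * \<eta> a) + R1 =
      p / C * (kinetic + 2 * Q0 + 2 * R0 + (LINT a|lborel. D (u a) * u a))"
    using * unfolding w'_eq by (simp add: algebra_simps)
  ultimately show ?thesis unfolding R1_eq P1_def Q1_def p_def by simp
qed

text \<open>The Euler-Lagrange identity carries twice the coefficients of the Schroedinger equation;
  halving it and matching the sign convention gives \<open>- multiplier / 2\<close> for the
  frequency. The Poisson equation is the Gauss law with \<open>E\<close> equal to minus the gradient
  of \<open>\<phi>\<close>.\<close>

lemma solves_schroedinger_poisson: "schroedinger_poisson W V q (- multiplier / 2) u \<phi>"
  unfolding schroedinger_poisson_def
proof (intro conjI)
  show li: "locally_integrable u" "locally_integrable \<phi>" "locally_integrable (\<lambda>x. (u x)\<^sup>2)"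
    "locally_integrable (\<lambda>x. V x * u x)" "locally_integrable (\<lambda>x. deriv W (u x))" "locally_integrable (\<lambda>x. \<phi> x * u x)"
    using parts has_weak_grad_potential
    by (auto simp: has_weak_grad_def has_weak_deriv_def \<phi>_def deriv_W_eq
        intro: L2_locally_integrable V_times_L2 integrable_imp_locally_integrable L2_square D_comp_locally_integrable
          newton_potential_times_L2_locally_integrable newton_potential_locally_integrable)
  show "distr_eq (\<lambda>\<eta>. - 1/2 * distr_laplacian dx (distr_of u) \<eta>
         + distr_of (\<lambda>x. V x * u x + 1/2 * deriv W (u x) + q * \<phi> x * u x) \<eta>)
       (distr_of (\<lambda>x. - (- multiplier / 2) * u x))"
    unfolding distr_eq_def
  proof (intro allI impI)
    fix \<eta> :: "real^3 \<Rightarrow> real" assume \<eta>: "test_function \<eta>"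
    have t: "L2 \<eta>" "H1 \<eta>" using \<eta> by (auto intro: test_function_L2 test_function_H1)
    have "distr_laplacian dx (distr_of u) \<eta> = (\<Sum>i\<in>UNIV. LINT a|lborel. u a * dir_deriv (dx i) (dir_deriv (dx i) \<eta>) a)"
      by (simp add: distr_laplacian_def distr_deriv_def distr_of_def)
    also have "\<dots> = (\<Sum>i\<in>UNIV. - (LINT a|lborel. g a $ i * dir_deriv (dx i) \<eta> a))"
    proof (rule sum.cong[OF refl])
      fix i
      have "- (LINT a|lborel. u a * dir_deriv (dx i) (dir_deriv (dx i) \<eta>) a) = (LINT a|lborel. g a $ i * dir_deriv (dx i) \<eta> a)"
        using grad(1) test_function_dir_deriv[OF \<eta>] by (simp add: has_weak_grad_def has_weak_deriv_iff)
      then show "(LINT a|lborel. u a * dir_deriv (dx i) (dir_deriv (dx i) \<eta>) a) = - (LINT a|lborel. g a $ i * dir_deriv (dx i) \<eta> a)"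
        by simp
    qed
    also have "\<dots> = - (LINT a|lborel. g a \<bullet> smooth_grad \<eta> a)"
      by (simp add: inner_vec_def smooth_grad_def sum_negf Bochner_Integration.integral_sum L2_mult L2_component grad
          test_function_L2 test_function_dir_deriv \<eta>)
    finally have lap: "distr_laplacian dx (distr_of u) \<eta> = - (LINT a|lborel. g a \<bullet> smooth_grad \<eta> a)" .
    have "distr_of (\<lambda>x. V x * u x + 1/2 * deriv W (u x) + q * \<phi> x * u x) \<eta> =
        (LINT a|lborel. V a * u a * \<eta> a + 1/2 * (D (u a) * \<eta> a) + q * (\<phi> a * (u a * \<eta> a)))"
      unfolding distr_of_def by (rule Bochner_Integration.integral_cong) (auto simp: deriv_W_eq algebra_simps)
    also have "\<dots> = (LINT a|lborel. V a * u a * \<eta> a) + 1/2 * (LINT a|lborel. D (u a) * \<eta> a) + q * (LINT a|lborel. \<phi> a * (u a * \<eta> a))"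
    proof -
      have "integrable lborel (\<lambda>a. \<phi> a * (u a * \<eta> a))"
        using locally_integrable_times_test_function[OF li(6) \<eta>] by (simp add: mult.assoc)
      then show ?thesis
        using V_mult_integrable[OF parts(2) t(1)] D_comp_times_integrable[OF parts(1) t(2)] by simp
    qed
    finally have rest: "distr_of (\<lambda>x. V x * u x + 1/2 * deriv W (u x) + q * \<phi> x * u x) \<eta> =
      (LINT a|lborel. V a * u a * \<eta> a) + 1/2 * (LINT a|lborel. D (u a) * \<eta> a) + q * (LINT a|lborel. \<phi> a * (u a * \<eta> a))" .
    have "distr_of (\<lambda>x. - (- multiplier / 2) * u x) \<eta> = multiplier / 2 * (LINT a|lborel. u a * \<eta> a)"
      by (simp add: distr_of_def mult.assoc)
    then show "- 1/2 * distr_laplacian dx (distr_of u) \<eta>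
         + distr_of (\<lambda>x. V x * u x + 1/2 * deriv W (u x) + q * \<phi> x * u x) \<eta> =
       distr_of (\<lambda>x. - (- multiplier / 2) * u x) \<eta>"
      unfolding lap rest using Euler_Lagrange[OF \<eta>] by (simp add: field_simps)
  qed
  show "distr_eq (\<lambda>\<eta>. - distr_laplacian dx (distr_of \<phi>) \<eta>) (distr_of (\<lambda>x. q * (u x)\<^sup>2))"
    unfolding distr_eq_def
  proof (intro allI impI)
    fix \<eta> :: "real^3 \<Rightarrow> real" assume \<eta>: "test_function \<eta>"
    have "(LINT a|lborel. \<phi> a * dir_deriv (dx i) (dir_deriv (dx i) \<eta>) a) = (LINT a|lborel. E a $ i * dir_deriv (dx i) \<eta> a)" for i
    proof -
      have "- (LINT a|lborel. \<phi> a * dir_deriv (dx i) (dir_deriv (dx i) \<eta>) a) = (LINT a|lborel. (- E a) $ i * dir_deriv (dx i) \<eta> a)"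
        using has_weak_grad_potential test_function_dir_deriv[OF \<eta>] unfolding has_weak_grad_def has_weak_deriv_iff by blast
      then show ?thesis by simp
    qed
    then have "- distr_laplacian dx (distr_of \<phi>) \<eta> = distr_div dx (distr_of_vec E) \<eta>"
      by (simp add: distr_laplacian_def distr_deriv_def distr_of_def distr_div_eq)
    then show "- distr_laplacian dx (distr_of \<phi>) \<eta> = distr_of (\<lambda>x. q * (u x)\<^sup>2) \<eta>"
      using parts(6) \<eta> by (simp add: weak_div_def distr_eq_def)
  qed
qed

end

subsection \<open>Stationary fields on space-time\<close>

lemma space_slice:
  assumes \<eta>: "test_function (\<eta> :: (real^3) \<times> real \<Rightarrow> real)"
  shows "test_function (\<lambda>x. \<eta> (x, t))" and "dir_deriv b (\<lambda>x. \<eta> (x, t)) x = dir_deriv (b, 0) \<eta> (x, t)"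
proof -
  have L: "bounded_linear (\<lambda>x::real^3. (x, 0::real))"
    by (intro bounded_linear_Pair bounded_linear_ident bounded_linear_zero)
  obtain R where R: "R > 0" "\<And>z. norm z \<ge> R \<Longrightarrow> \<eta> z = 0" by (rule test_functionE[OF \<eta>]) (rule that)
  show "test_function (\<lambda>x. \<eta> (x, t))"
  proof (rule test_functionI)
    show "C_infinity (\<lambda>x. \<eta> (x, t))"
      using C_infinity_affine_comp[OF test_function_C_infinity[OF \<eta>] L, of "(0, t)"] by simp
    show "bounded (ball (0::real^3) R)" by simp
    fix x :: "real^3" assume "x \<notin> ball 0 R"
    then have "norm (x, t) \<ge> R" using norm_fst_le[of x t] by simp
    then show "\<eta> (x, t) = 0" by (rule R)
  qed
  show "dir_deriv b (\<lambda>x. \<eta> (x, t)) x = dir_deriv (b, 0) \<eta> (x, t)"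
    using dir_deriv_affine_comp[OF test_function_differentiable[OF \<eta>] L, of b "(0, t)" x] by simp
qed

lemma time_slice:
  assumes \<eta>: "test_function (\<eta> :: (real^3) \<times> real \<Rightarrow> real)"
  shows "test_function (\<lambda>t. \<eta> (x, t))" and "dir_deriv c (\<lambda>t. \<eta> (x, t)) t = dir_deriv (0, c) \<eta> (x, t)"
proof -
  have L: "bounded_linear (\<lambda>t::real. (0::real^3, t))"
    by (intro bounded_linear_Pair bounded_linear_ident bounded_linear_zero)
  obtain R where R: "R > 0" "\<And>z. norm z \<ge> R \<Longrightarrow> \<eta> z = 0" by (rule test_functionE[OF \<eta>]) (rule that)
  show "test_function (\<lambda>t. \<eta> (x, t))"
  proof (rule test_functionI)
    show "C_infinity (\<lambda>t. \<eta> (x, t))"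
      using C_infinity_affine_comp[OF test_function_C_infinity[OF \<eta>] L, of "(x, 0)"] by simp
    show "bounded (ball (0::real) R)" by simp
    fix t :: real assume "t \<notin> ball 0 R"
    then have "norm (x, t) \<ge> R" using norm_snd_le[of t x] by simp
    then show "\<eta> (x, t) = 0" by (rule R)
  qed
  show "dir_deriv c (\<lambda>t. \<eta> (x, t)) t = dir_deriv (0, c) \<eta> (x, t)"
    using dir_deriv_affine_comp[OF test_function_differentiable[OF \<eta>] L, of c "(x, 0)" t] by simp
qed

lemma stationary_measurable [measurable]:
  assumes [measurable]: "f \<in> borel_measurable (borel :: (real^3) measure)"
  shows "(\<lambda>(x, t::real). f x) \<in> borel_measurable borel"
proof -
  have "(\<lambda>z::(real^3) \<times> real. f (fst z)) \<in> borel_measurable borel"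
    by (rule measurable_compose[OF _ assms]) (intro borel_measurable_continuous_onI continuous_intros)
  then show ?thesis by (simp add: split_beta')
qed

text \<open>A compact set lies in the product of a ball with a bounded time interval, and
  integrating over time there costs only the finite length of the interval.\<close>

lemma stationary_locally_integrable:
  assumes f: "locally_integrable f"
  shows "locally_integrable (\<lambda>(x::real^3, t::real). f x)"
proof (rule locally_integrableI)
  have [measurable]: "f \<in> borel_measurable borel" using f by auto
  show m [measurable]: "(\<lambda>(x::real^3, t::real). f x) \<in> borel_measurable borel" by measurable
  fix K :: "((real^3) \<times> real) set" assume K: "compact K"
  then have [measurable]: "K \<in> sets borel" by (simp add: borel_compact)
  obtain R where R: "\<And>z. z \<in> K \<Longrightarrow> norm z \<le> R" using compact_imp_bounded[OF K] by (auto simp: bounded_iff)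
  have [measurable]: "cball (0::real^3) R \<in> sets borel" by (simp add: borel_closed)
  let ?J = "\<lambda>(x::real^3) t. (indicator (cball 0 R) x *\<^sub>R f x) * indicator {-R..R} t"
  have ind: "(\<lambda>z::(real^3) \<times> real. indicator (cball 0 R) (fst z) :: real) \<in> borel_measurable (lborel \<Otimes>\<^sub>M lborel)"
    "(\<lambda>z::(real^3) \<times> real. f (fst z)) \<in> borel_measurable (lborel \<Otimes>\<^sub>M lborel)"
    by (rule measurable_compose[OF measurable_fst], measurable)+
  have ind2: "(\<lambda>z::(real^3) \<times> real. indicator {-R..R} (snd z) :: real) \<in> borel_measurable (lborel \<Otimes>\<^sub>M lborel)"
    by (rule measurable_compose[OF measurable_snd]) simp
  have "integrable (lborel \<Otimes>\<^sub>M lborel) (case_prod ?J)"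
  proof (rule integrable_pairI)
    show "case_prod ?J \<in> borel_measurable (lborel \<Otimes>\<^sub>M lborel)"
      using ind ind2 unfolding split_beta' by measurable
    have cb: "integrable lborel (\<lambda>x. indicator (cball 0 R) x *\<^sub>R f x)"
      by (rule locally_integrable_set[OF f]) simp
    have "(\<integral>\<^sup>+x. \<integral>\<^sup>+t. ennreal (norm (?J x t)) \<partial>lborel \<partial>lborel) =
        (\<integral>\<^sup>+x. \<integral>\<^sup>+t. ennreal (norm (indicator (cball 0 R) x *\<^sub>R f x)) * indicator {-R..R} t \<partial>lborel \<partial>lborel)"
      by (intro nn_integral_cong) (auto simp: abs_mult indicator_def)
    also have "\<dots> = (\<integral>\<^sup>+x. ennreal (norm (indicator (cball 0 R) x *\<^sub>R f x)) * emeasure lborel {-R..R} \<partial>lborel)"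
      by (intro nn_integral_cong) (rule nn_integral_cmult_indicator, simp)
    also have "\<dots> = (\<integral>\<^sup>+x. ennreal (norm (indicator (cball 0 R) x *\<^sub>R f x)) \<partial>lborel) * emeasure lborel {-R..R}"
      by (rule nn_integral_multc) measurable
    also have "\<dots> < \<infinity>"
      using cb unfolding integrable_iff_bounded by (simp add: ennreal_mult_less_top emeasure_lborel_Icc_eq)
    finally show "(\<integral>\<^sup>+x. \<integral>\<^sup>+t. ennreal (norm (?J x t)) \<partial>lborel \<partial>lborel) < \<infinity>" .
  qed
  then have "integrable lborel (case_prod ?J)" by (simp add: lborel_prod)
  then show "integrable lborel (\<lambda>z. indicator K z *\<^sub>R (case z of (x, t) \<Rightarrow> f x))"
  proof (rule Bochner_Integration.integrable_bound)
    show "AE z in lborel. norm (indicator K z *\<^sub>R (case z of (x, t) \<Rightarrow> f x)) \<le> norm (case_prod ?J z)"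
    proof (rule AE_I2)
      fix z :: "(real^3) \<times> real"
      show "norm (indicator K z *\<^sub>R (case z of (x, t) \<Rightarrow> f x)) \<le> norm (case_prod ?J z)"
      proof (cases "z \<in> K")
        case True
        then have "norm (fst z) \<le> R" "\<bar>snd z\<bar> \<le> R"
          using R[OF True] norm_fst_le[of "fst z" "snd z"] norm_snd_le[of "snd z" "fst z"] by auto
        then show ?thesis using True by (auto simp: split_beta indicator_def abs_le_iff)
      qed simp
    qed
  qed measurable
qed

text \<open>The two orders of integration serve different purposes: time last reduces an equation on
  space-time to its spatial form on every slice, time first lets time derivatives of test functions
  integrate to 0.\<close>

lemma distr_of_stationary:
  assumes f: "locally_integrable f" and \<eta>: "test_function (\<eta> :: (real^3) \<times> real \<Rightarrow> real)"
  shows "distr_of (\<lambda>(x, t). f x) \<eta> = (LINT t|lborel. distr_of f (\<lambda>x. \<eta> (x, t)))"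
    and "distr_of (\<lambda>(x, t). f x) \<eta> = (LINT x|lborel. f x * (LINT t|lborel. \<eta> (x, t)))"
    and "integrable lborel (\<lambda>t. distr_of f (\<lambda>x. \<eta> (x, t)))"
proof -
  have "integrable lborel (\<lambda>z. (case z of (x, t) \<Rightarrow> f x) * \<eta> z)"
    by (rule locally_integrable_times_test_function[OF stationary_locally_integrable[OF f] \<eta>])
  then have int: "integrable (lborel \<Otimes>\<^sub>M lborel) (\<lambda>(x, t). f x * \<eta> (x, t))"
    by (simp add: lborel_prod split_beta')
  have eq: "distr_of (\<lambda>(x, t). f x) \<eta> = integral\<^sup>L (lborel \<Otimes>\<^sub>M lborel) (\<lambda>(x, t). f x * \<eta> (x, t))"
    by (simp add: distr_of_def lborel_prod split_beta')
  show "distr_of (\<lambda>(x, t). f x) \<eta> = (LINT t|lborel. distr_of f (\<lambda>x. \<eta> (x, t)))"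
    unfolding eq unfolding distr_of_def by (rule lborel_pair.integral_snd[OF int, symmetric])
  show "distr_of (\<lambda>(x, t). f x) \<eta> = (LINT x|lborel. f x * (LINT t|lborel. \<eta> (x, t)))"
    unfolding eq using lborel_pair.integral_fst[OF int] by simp
  show "integrable lborel (\<lambda>t. distr_of f (\<lambda>x. \<eta> (x, t)))"
    unfolding distr_of_def by (rule lborel_pair.integrable_snd[OF int])
qed

lemma space_slice_sx:
  assumes "test_function (\<eta> :: (real^3) \<times> real \<Rightarrow> real)"
  shows "(\<lambda>x. dir_deriv (sx i) \<eta> (x, t)) = dir_deriv (dx i) (\<lambda>x. \<eta> (x, t))"
  unfolding sx_def dx_def by (rule ext) (rule space_slice(2)[OF assms, symmetric])

lemma distr_of_stationary_time_derivative:
  assumes f: "locally_integrable f" and \<eta>: "test_function \<eta>"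
  shows "distr_of (\<lambda>(x, t). f x) (dir_deriv st \<eta>) = 0"
proof -
  have "(LINT t|lborel. dir_deriv st \<eta> (x, t)) = 0" for x
    using integral_dir_deriv[OF time_slice(1)[OF \<eta>], of 1 x] by (simp add: time_slice(2)[OF \<eta>] st_def)
  then show ?thesis by (simp add: distr_of_stationary(2)[OF f test_function_dir_deriv[OF \<eta>]])
qed

text \<open>The phase \<open>\<omega> t\<close> is of this form, so its weak derivatives are its
  classical ones. Affine functions are closed under \<open>dir_deriv\<close>, a constant being the
  case \<open>v = 0\<close>.\<close>

lemma C_infinity_affine: "C_infinity (\<lambda>z::'a::euclidean_space. c + v \<bullet> z)"
  and dir_deriv_affine: "dir_deriv b (\<lambda>z::'a. c + v \<bullet> z) z = v \<bullet> b"
proof -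
  have D: "((\<lambda>z. c + v \<bullet> z) has_derivative (\<lambda>b. v \<bullet> b)) (at z)" for c and v z :: 'a
    by (auto intro!: derivative_eq_intros)
  note dd = dir_deriv_eqI[OF D]
  show "dir_deriv b (\<lambda>z::'a. c + v \<bullet> z) z = v \<bullet> b" by (rule dd)
  show "C_infinity (\<lambda>z::'a. c + v \<bullet> z)"
  proof (rule C_infinity_coinduct[where P = "\<lambda>h. \<exists>c v. h = (\<lambda>z. c + v \<bullet> z)"])
    fix h :: "'a \<Rightarrow> real" and b x assume "\<exists>c v. h = (\<lambda>z. c + v \<bullet> z)"
    then obtain c v where h: "h = (\<lambda>z. c + v \<bullet> z)" by blast
    show "h differentiable (at x)" unfolding h differentiable_def using D by blast
    have "dir_deriv b h = (\<lambda>z. v \<bullet> b + 0 \<bullet> z)" unfolding h by (rule ext) (simp add: dd)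
    then show "\<exists>c v. dir_deriv b h = (\<lambda>z. c + v \<bullet> z)" by (intro exI)
  qed (intro exI[of _ c] exI[of _ v] refl)
qed

text \<open>The chosen \<open>weak_grad\<close> of the zero function is known to vanish only almost
  everywhere. The continuity in time of a constant curve rests on this.\<close>

lemma state_dist_self: "state_dist E0 x x = 0"
proof -
  have c: "C_infinity (\<lambda>a::real^3. 0)" by (rule C_infinity_const)
  have g: "smooth_grad (\<lambda>a. 0) a = 0" for a
    by (simp add: smooth_grad_def vec_eq_iff) (rule allI, rule dir_deriv_eqI, simp)
  have w: "has_weak_grad (\<lambda>a. 0) (\<lambda>a. 0)"
    using has_weak_grad_smooth[OF c] by (simp add: g[abs_def])
  have "has_weak_grad (\<lambda>a. 0) (weak_grad (\<lambda>a. 0))"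
    unfolding weak_grad_def by (rule someI[of "has_weak_grad (\<lambda>a. 0)", OF w])
  from has_weak_grad_AE_unique[OF this w] have ae: "AE a in lborel. weak_grad (\<lambda>a. 0) a = 0" .
  have "(LINT a|lborel. (norm (weak_grad (\<lambda>a. 0) a))\<^sup>2) = 0"
    by (rule integral_eq_zero_AE) (use ae in \<open>auto elim!: eventually_mono\<close>)
  then show ?thesis by (simp add: state_dist_def state_norm_def state_diff_def)
qed

section \<open>The stationary solution generated by a minimiser\<close>

context minimiser
begin

lemma elec_slices:
  assumes \<eta>: "test_function \<eta>"
  shows "distr_of (\<lambda>(y, t). \<phi> y) (dir_deriv (sx i) \<eta>) = distr_of (\<lambda>(y, t). E y $ i) \<eta>"
proof -
  have li: "locally_integrable \<phi>" "locally_integrable (\<lambda>a. E a $ i)"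
    using has_weak_grad_potential by (auto simp: has_weak_grad_def has_weak_deriv_def
        intro: L2_locally_integrable L2_component parts)
  have "distr_of \<phi> (dir_deriv (dx i) \<zeta>) = distr_of (\<lambda>a. E a $ i) \<zeta>" if "test_function \<zeta>" for \<zeta>
  proof -
    have "- (LINT a|lborel. \<phi> a * dir_deriv (dx i) \<zeta> a) = (LINT a|lborel. (- E a) $ i * \<zeta> a)"
      using has_weak_grad_potential that unfolding has_weak_grad_def has_weak_deriv_iff by blast
    then show ?thesis by (simp add: distr_of_def)
  qed
  then show ?thesis
    unfolding distr_of_stationary(1)[OF li(1) test_function_dir_deriv[OF \<eta>]]
      distr_of_stationary(1)[OF li(2) \<eta>] space_slice_sx[OF \<eta>]
    using space_slice(1)[OF \<eta>] by simp
qed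

text \<open>The fields describe the standing wave \<open>u exp (i \<omega> t)\<close> without vector
  potential. The matter equation is the Schroedinger equation on each slice, the Gauss equation is
  the constraint of the phase space, and in the Ampere equation the current and the time derivative
  of \<open>E\<close> both vanish.\<close>

lemma stationary_field_equations:
  assumes SP: "schroedinger_poisson W V q \<omega> u \<phi>"
  shows "field_equations W V q (\<lambda>(y, t). u y) (\<lambda>(y, t). \<omega> * t) (\<lambda>(y, t). \<phi> y) (\<lambda>(y, t). 0) (\<lambda>_. 0) (\<lambda>_. \<omega>)"
proof -
  have li: "locally_integrable u" "locally_integrable \<phi>" "locally_integrable (\<lambda>y. (u y)\<^sup>2)"
    "locally_integrable (\<lambda>y. V y * u y)" "locally_integrable (\<lambda>y. deriv W (u y))" "locally_integrable (\<lambda>y. \<phi> y * u y)"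
    using SP by (auto simp: schroedinger_poisson_def)
  have liE: "locally_integrable (\<lambda>a. E a $ i)" for i
    by (intro L2_locally_integrable L2_component parts)
  have S: "(\<lambda>(y, t). \<omega> * t) = (\<lambda>z::(real^3) \<times> real. 0 + (0, \<omega>) \<bullet> z)"
    by (auto simp: inner_prod_def)
  have z0: "locally_integrable (\<lambda>_::(real^3) \<times> real. 0::real)"
    by (rule continuous_imp_locally_integrable) (rule continuous_on_const)
  have wS: "has_weak_deriv (\<lambda>(y, t). \<omega> * t) (sx i) (\<lambda>z::(real^3) \<times> real. (0::real^3) $ i)"
    "has_weak_deriv (\<lambda>(y::real^3, t). \<omega> * t) st (\<lambda>_. \<omega>)" for i
  proof -
    have "dir_deriv (sx i) (\<lambda>z::(real^3) \<times> real. 0 + (0, \<omega>) \<bullet> z) = (\<lambda>z. (0::real^3) $ i)"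
      by (rule ext, subst dir_deriv_affine) (simp add: sx_def inner_prod_def)
    then show "has_weak_deriv (\<lambda>(y, t). \<omega> * t) (sx i) (\<lambda>z::(real^3) \<times> real. (0::real^3) $ i)"
      using C_infinity_has_weak_deriv[OF C_infinity_affine[of 0 "(0 :: real^3, \<omega>)"], of "sx i"]
      unfolding S by (simp only:)
    have "dir_deriv st (\<lambda>z::(real^3) \<times> real. 0 + (0, \<omega>) \<bullet> z) = (\<lambda>z. \<omega>)"
      by (rule ext, subst dir_deriv_affine) (simp add: st_def inner_prod_def)
    then show "has_weak_deriv (\<lambda>(y::real^3, t). \<omega> * t) st (\<lambda>_. \<omega>)"
      using C_infinity_has_weak_deriv[OF C_infinity_affine[of 0 "(0 :: real^3, \<omega>)"], of st]
      unfolding S by (simp only:)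
  qed
  let ?G = "\<lambda>y. (1/2 * deriv W (u y) + (\<omega> * u y + q * (\<phi> y * u y))) + V y * u y"
  have liG: "locally_integrable ?G"
    by (intro locally_integrable_add locally_integrable_cmult li)
  have G_eq: "1/2 * deriv W (u y) + (1/2 * (norm ((0::real^3) - q *\<^sub>R 0))\<^sup>2 + (\<omega> + q * \<phi> y + V y)) * u y = ?G y" for y
    by (simp add: algebra_simps)
  have lisum: "locally_integrable (\<lambda>(y, t::real). (\<omega> + q * \<phi> y + V y) * u y)"
  proof -
    have "locally_integrable (\<lambda>y. (\<omega> * u y + q * (\<phi> y * u y)) + V y * u y)"
      by (intro locally_integrable_add locally_integrable_cmult li)
    then have "locally_integrable (\<lambda>y. (\<omega> + q * \<phi> y + V y) * u y)" by (simp add: algebra_simps)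
    then show ?thesis by (rule stationary_locally_integrable)
  qed
  have matter: "- 1/2 * distr_laplacian sx (distr_of (\<lambda>(y, t). u y)) \<eta> + distr_of (\<lambda>(y, t). ?G y) \<eta> = 0"
    if \<eta>: "test_function \<eta>" for \<eta>
  proof -
    have slice: "- 1/2 * distr_laplacian dx (distr_of u) \<zeta> + distr_of ?G \<zeta> = 0" if \<zeta>: "test_function \<zeta>" for \<zeta>
    proof -
      have "distr_of ?G \<zeta> = (LINT y|lborel. (V y * u y + 1/2 * deriv W (u y) + q * \<phi> y * u y) * \<zeta> y + \<omega> * (u y * \<zeta> y))"
        unfolding distr_of_def by (rule Bochner_Integration.integral_cong) (auto simp: algebra_simps)
      also have "\<dots> = distr_of (\<lambda>y. V y * u y + 1/2 * deriv W (u y) + q * \<phi> y * u y) \<zeta> + \<omega> * (LINT y|lborel. u y * \<zeta> y)"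
      proof -
        have "locally_integrable (\<lambda>y. V y * u y + 1/2 * deriv W (u y) + q * (\<phi> y * u y))"
          by (intro locally_integrable_add locally_integrable_cmult li)
        then have "integrable lborel (\<lambda>y. (V y * u y + 1/2 * deriv W (u y) + q * \<phi> y * u y) * \<zeta> y)"
          using locally_integrable_times_test_function[OF _ \<zeta>] by (simp add: mult.assoc)
        then show ?thesis
          using locally_integrable_times_test_function[OF li(1) \<zeta>]
          unfolding distr_of_def by (subst Bochner_Integration.integral_add) auto
      qed
      also have "\<omega> * (LINT y|lborel. u y * \<zeta> y) = - distr_of (\<lambda>y. - \<omega> * u y) \<zeta>"
        by (simp add: distr_of_def mult.assoc)
      finally have "distr_of ?G \<zeta> = distr_of (\<lambda>y. V y * u y + 1/2 * deriv W (u y) + q * \<phi> y * u y) \<zeta>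
          - distr_of (\<lambda>y. - \<omega> * u y) \<zeta>" by simp
      moreover have "- 1/2 * distr_laplacian dx (distr_of u) \<zeta>
          + distr_of (\<lambda>y. V y * u y + 1/2 * deriv W (u y) + q * \<phi> y * u y) \<zeta> = distr_of (\<lambda>y. - \<omega> * u y) \<zeta>"
        using SP \<zeta> unfolding schroedinger_poisson_def distr_eq_def by blast
      ultimately show ?thesis by linarith
    qed
    note d2 = test_function_dir_deriv[OF test_function_dir_deriv[OF \<eta>]]
    have "distr_laplacian sx (distr_of (\<lambda>(y, t). u y)) \<eta> =
        (\<Sum>i\<in>UNIV. LINT t|lborel. distr_of u (dir_deriv (dx i) (dir_deriv (dx i) (\<lambda>y. \<eta> (y, t)))))"
      by (simp add: distr_laplacian_def distr_deriv_def distr_of_stationary(1)[OF li(1) d2]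
          space_slice_sx[OF test_function_dir_deriv[OF \<eta>]] space_slice_sx[OF \<eta>])
    also have "\<dots> = (LINT t|lborel. distr_laplacian dx (distr_of u) (\<lambda>y. \<eta> (y, t)))"
      using distr_of_stationary(3)[OF li(1) d2[of "sx i" "sx i" for i]]
      by (simp add: distr_laplacian_def distr_deriv_def Bochner_Integration.integral_sum
          space_slice_sx[OF test_function_dir_deriv[OF \<eta>]] space_slice_sx[OF \<eta>])
    finally have lap: "distr_laplacian sx (distr_of (\<lambda>(y, t). u y)) \<eta> =
        (LINT t|lborel. distr_laplacian dx (distr_of u) (\<lambda>y. \<eta> (y, t)))" .
    have G: "distr_of ?G (\<lambda>y. \<eta> (y, t)) = 1/2 * distr_laplacian dx (distr_of u) (\<lambda>y. \<eta> (y, t))" for t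
      using slice[OF space_slice(1)[OF \<eta>], of t] by linarith
    have "distr_of (\<lambda>(y, t). ?G y) \<eta> = 1/2 * (LINT t|lborel. distr_laplacian dx (distr_of u) (\<lambda>y. \<eta> (y, t)))"
      unfolding distr_of_stationary(1)[OF liG \<eta>] G by (rule integral_mult_right_zero)
    then show ?thesis unfolding lap by simp
  qed
  define P where "P = (\<lambda>i \<eta>. distr_deriv st (distr_of_vec (\<lambda>(y::real^3, t::real). 0) i) \<eta> + distr_deriv (sx i) (distr_of (\<lambda>(y, t). \<phi> y)) \<eta>)"
  have A0: "distr_of_vec (\<lambda>(y::real^3, t::real). 0) i \<eta> = 0" for i \<eta>
    by (simp add: distr_of_vec_def distr_of_def split_beta')
  have P: "P i \<eta> = - distr_of (\<lambda>(y, t). E y $ i) \<eta>" if "test_function \<eta>" for i \<eta>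
    using elec_slices[OF that, of i] by (simp add: P_def distr_deriv_def A0)
  have gauss: "- distr_div sx P \<eta> = distr_of (\<lambda>(y, t). q * (u y)\<^sup>2) \<eta>" if \<eta>: "test_function \<eta>" for \<eta>
  proof -
    have d: "test_function (dir_deriv (sx i) \<eta>)" for i by (rule test_function_dir_deriv[OF \<eta>])
    have "- distr_div sx P \<eta> = - (\<Sum>i\<in>UNIV. distr_of (\<lambda>(y, t). E y $ i) (dir_deriv (sx i) \<eta>))"
      by (simp add: distr_div_def distr_deriv_def P d sum_negf)
    also have "\<dots> = (LINT t|lborel. - (\<Sum>i\<in>UNIV. distr_of (\<lambda>a. E a $ i) (dir_deriv (dx i) (\<lambda>y. \<eta> (y, t)))))"
      using distr_of_stationary(3)[OF liE d] unfolding space_slice_sx[OF \<eta>]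
      by (simp add: distr_of_stationary(1)[OF liE d] space_slice_sx[OF \<eta>] Bochner_Integration.integral_sum)
    also have "\<dots> = (LINT t|lborel. distr_of (\<lambda>a. q * (u a)\<^sup>2) (\<lambda>y. \<eta> (y, t)))"
    proof (rule Bochner_Integration.integral_cong[OF refl])
      fix t
      have "distr_div dx (distr_of_vec E) (\<lambda>y. \<eta> (y, t)) = distr_of (\<lambda>a. q * (u a)\<^sup>2) (\<lambda>y. \<eta> (y, t))"
        using parts(6) space_slice(1)[OF \<eta>, of t] by (simp add: weak_div_def distr_eq_def)
      then show "- (\<Sum>i\<in>UNIV. distr_of (\<lambda>a. E a $ i) (dir_deriv (dx i) (\<lambda>y. \<eta> (y, t)))) =
          distr_of (\<lambda>a. q * (u a)\<^sup>2) (\<lambda>y. \<eta> (y, t))"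
        by (simp add: distr_div_eq distr_of_def)
    qed
    also have "\<dots> = distr_of (\<lambda>(y, t). q * (u y)\<^sup>2) \<eta>"
      by (rule distr_of_stationary(1)[OF locally_integrable_cmult[OF li(3)] \<eta>, symmetric])
    finally show ?thesis .
  qed
  have ampere: "distr_curl sx (distr_curl sx (distr_of_vec (\<lambda>(y::real^3, t::real). 0))) i \<eta> + distr_deriv st (P i) \<eta> = 0"
    if \<eta>: "test_function \<eta>" for i \<eta>
    using distr_of_stationary_time_derivative[OF liE \<eta>]
    by (simp add: distr_curl_def distr_deriv_def A0 P test_function_dir_deriv[OF \<eta>])
  show ?thesis
    unfolding field_equations_def Let_def P_def[symmetric]
  proof (intro conjI allI)
    show "locally_integrable (\<lambda>(y, t::real). u y)" "locally_integrable (\<lambda>(y, t::real). \<phi> y)"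
      by (intro stationary_locally_integrable li)+
    show "locally_integrable (\<lambda>z. (case z of (y::real^3, t::real) \<Rightarrow> (0::real^3)) $ i)" for i
      using z0 by (simp add: split_beta')
    show "has_weak_deriv (\<lambda>(y, t). \<omega> * t) (sx i) (\<lambda>z. (0::real^3) $ i)" for i by (rule wS)
    show "has_weak_deriv (\<lambda>(y, t). \<omega> * t) st (\<lambda>_. \<omega>)" by (rule wS)
    show "locally_integrable (\<lambda>z. deriv W (case z of (y, t::real) \<Rightarrow> u y))"
      using stationary_locally_integrable[OF li(5)] by (simp add: split_beta')
    show "locally_integrable (\<lambda>z. (norm (0 - q *\<^sub>R (case z of (y::real^3, t::real) \<Rightarrow> (0::real^3))))\<^sup>2 * (case z of (y, t) \<Rightarrow> u y))"
      using z0 by (simp add: split_beta')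
    show "locally_integrable (\<lambda>z. (\<omega> + q * (case z of (y, t::real) \<Rightarrow> \<phi> y) + V (fst z)) * (case z of (y, t) \<Rightarrow> u y))"
      using lisum by (simp add: split_beta')
    show "locally_integrable (\<lambda>z. (case z of (y, t::real) \<Rightarrow> u y)\<^sup>2)"
      using stationary_locally_integrable[OF li(3)] by (simp add: split_beta')
    show "locally_integrable (\<lambda>z. (0 - q *\<^sub>R (case z of (y::real^3, t::real) \<Rightarrow> (0::real^3))) $ i * (case z of (y, t) \<Rightarrow> u y)\<^sup>2)" for i
      using z0 by (simp add: split_beta')
    show "distr_eq (\<lambda>\<eta>. - 1/2 * distr_laplacian sx (distr_of (\<lambda>(y, t). u y)) \<eta>
         + distr_of (\<lambda>z. 1/2 * deriv W (case z of (y, t) \<Rightarrow> u y)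
             + (1/2 * (norm (0 - q *\<^sub>R (case z of (y::real^3, t::real) \<Rightarrow> (0::real^3))))\<^sup>2
                 + (\<omega> + q * (case z of (y, t) \<Rightarrow> \<phi> y) + V (fst z))) * (case z of (y, t) \<Rightarrow> u y)) \<eta>)
       (\<lambda>\<eta>. 0)"
      using matter unfolding distr_eq_def split_beta' G_eq by simp
    show "distr_eq (\<lambda>\<eta>. - distr_div sx P \<eta>) (distr_of (\<lambda>z. q * (case z of (y, t) \<Rightarrow> u y)\<^sup>2))"
      using gauss by (simp add: distr_eq_def split_beta')
    show "distr_eq (\<lambda>\<eta>. distr_curl sx (distr_curl sx (distr_of_vec (\<lambda>(y, t). 0))) i \<eta> + distr_deriv st (P i) \<eta>)
       (distr_of (\<lambda>z. q * (0 - q *\<^sub>R (case z of (y::real^3, t::real) \<Rightarrow> (0::real^3))) $ i * (case z of (y, t) \<Rightarrow> u y)\<^sup>2))" for i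
      using ampere by (simp add: distr_eq_def split_beta' distr_of_def)
  qed
qed

lemma stationary_solves:
  assumes SP: "schroedinger_poisson W V q \<omega> u \<phi>"
  shows "solves E0 W V q (\<lambda>t. x) (\<lambda>(y, t). \<omega> * t) (\<lambda>(y, t). \<phi> y) (\<lambda>(y, t). 0)"
  unfolding solves_def
proof (intro conjI allI)
  show "x \<in> phase_space q" by (rule x_in)
  show "((\<lambda>s. state_dist E0 x x) \<longlongrightarrow> 0) (at t)" for t by (simp add: state_dist_self)
  show "\<exists>p \<sigma>. field_equations W V q (\<lambda>(y, t). u y) (\<lambda>(y, t). \<omega> * t) (\<lambda>(y, t). \<phi> y) (\<lambda>(y, t). 0) p \<sigma> \<and>
     (AE (y, t) in lborel. cur x y = u y *\<^sub>R (p (y, t) - q *\<^sub>R (case (y, t) of (y, t) \<Rightarrow> 0)))"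
  proof (intro exI conjI)
    show "field_equations W V q (\<lambda>(y, t). u y) (\<lambda>(y, t). \<omega> * t) (\<lambda>(y, t). \<phi> y) (\<lambda>(y, t). 0) (\<lambda>_. 0) (\<lambda>_. \<omega>)"
      by (rule stationary_field_equations[OF SP])
    have "AE z in lborel \<Otimes>\<^sub>M lborel. cur x (fst (z :: (real^3) \<times> real)) = 0"
    proof (rule lborel_pair.AE_pair_measure)
      show "{z \<in> space (lborel \<Otimes>\<^sub>M lborel). cur x (fst (z :: (real^3) \<times> real)) = 0} \<in> sets (lborel \<Otimes>\<^sub>M lborel)"
        by measurable
      show "AE y in lborel. AE t in (lborel :: real measure). cur x (fst (y, t)) = 0"
        using cur_magn_zero(1) by eventually_elim simp
    qed
    then show "AE (y, t) in lborel. cur x y = u y *\<^sub>R (0 - q *\<^sub>R (case (y, t :: real) of (y, t) \<Rightarrow> 0))"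
      unfolding lborel_prod by (simp add: split_beta')
  qed
  fix i
  have A0: "distr_of_vec (\<lambda>(y::real^3, t::real). 0) i \<eta> = 0" for i \<eta>
    by (simp add: distr_of_vec_def distr_of_def split_beta')
  have liE: "locally_integrable (\<lambda>a. E a $ i)" by (intro L2_locally_integrable L2_component parts)
  have liH: "locally_integrable (\<lambda>a. magn x a $ i)" by (intro L2_locally_integrable L2_component parts)
  show "locally_integrable (\<lambda>(y, t::real). E y $ i)" by (rule stationary_locally_integrable[OF liE])
  show "locally_integrable (\<lambda>(y, t::real). magn x y $ i)" by (rule stationary_locally_integrable[OF liH])
  show "distr_eq (distr_of (\<lambda>(y, t). E y $ i))
     (\<lambda>\<eta>. - distr_deriv st (distr_of_vec (\<lambda>(y, t). 0) i) \<eta> - distr_deriv (sx i) (distr_of (\<lambda>(y, t). \<phi> y)) \<eta>)"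
    using elec_slices[of _ i] by (simp add: distr_eq_def distr_deriv_def A0)
  have "distr_of (\<lambda>a. magn x a $ i) \<zeta> = 0" for \<zeta>
    unfolding distr_of_def by (rule integral_eq_zero_AE) (use cur_magn_zero(2) in \<open>auto elim!: eventually_mono\<close>)
  then show "distr_eq (distr_of (\<lambda>(y, t). magn x y $ i)) (distr_curl sx (distr_of_vec (\<lambda>(y, t). 0)) i)"
    by (simp add: distr_eq_def distr_curl_def distr_deriv_def A0 distr_of_stationary(1)[OF liH])
qed

end

theorem theorem27:
  fixes W :: "real \<Rightarrow> real" and V :: "real^3 \<Rightarrow> real" and M :: "real^3^3"
    and E0 q \<delta>max :: real
    and \<gamma> :: "real \<Rightarrow> state \<Rightarrow> state" and sol :: "real \<Rightarrow> state"
  assumes "even_extended W" "W_i E0 W" "W_ii E0 W V" "W_iii E0 W" "W_iv E0 W"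
    and "V_i V" "V_ii M V"
    and "q > 0"
    and "well_posed_evolution E0 W V q \<gamma>"
    and "\<delta>max > 0"
    and "\<And>\<delta>. \<delta> \<in> {0<..<\<delta>max} \<Longrightarrow> hylomorphic_soliton E0 W V q \<gamma> (sol \<delta>)"
    and "\<And>\<delta>1 \<delta>2. \<delta>1 \<in> {0<..<\<delta>max} \<Longrightarrow> \<delta>2 \<in> {0<..<\<delta>max} \<Longrightarrow> \<delta>1 < \<delta>2 \<Longrightarrow>
           hylenic_ratio W V (sol \<delta>1) < hylenic_ratio W V (sol \<delta>2) \<and>
           L2_norm (amp (sol \<delta>1)) > L2_norm (amp (sol \<delta>2))"
  shows "\<forall>\<delta>\<in>{0<..<\<delta>max}. \<exists>\<phi> \<omega>.
           (AE x in lborel. cur (sol \<delta>) x = 0) \<and>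
           (AE x in lborel. magn (sol \<delta>) x = 0) \<and>
           has_weak_grad \<phi> (\<lambda>x. - elec (sol \<delta>) x) \<and>
           (\<forall>t. state_eq (\<gamma> t (sol \<delta>)) (sol \<delta>)) \<and>
           solves E0 W V q (\<lambda>t. sol \<delta>) (\<lambda>(x, t). \<omega> * t) (\<lambda>(x, t). \<phi> x) (\<lambda>(x, t). 0) \<and>
           schroedinger_poisson W V q \<omega> (amp (sol \<delta>)) \<phi>"
proof
  fix \<delta> assume \<delta>: "\<delta> \<in> {0<..<\<delta>max}"
  obtain D a b c r l where nl: "nonlinearity W D a b c r l"
    by (rule nonlinearity_exists[OF assms(1,2,4)]) (rule that)
  obtain B where B: "\<And>x. 0 \<le> V x" "\<And>x. V x \<le> B"
    by (rule periodic_potential_bounded[OF assms(6,7)]) (rule that)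
  obtain \<Gamma> e0 c0 where \<Gamma>: "sol \<delta> \<in> \<Gamma>" "\<Gamma> = {y \<in> phase_space q. energy W V y = e0 \<and> \<bar>charge y\<bar> = c0}"
    and least: "\<And>y. y \<in> phase_space q \<Longrightarrow> \<bar>charge y\<bar> = c0 \<Longrightarrow> e0 \<le> energy W V y"
    using assms(11)[OF \<delta>] unfolding hylomorphic_soliton_def by (elim exE conjE) auto
  \<comment> \<open>Positivity of the charge, needed to divide by it, comes from strict
    monotonicity: the soliton with parameter halfway to \<open>\<delta>max\<close> has a smaller
    norm, which is nonnegative.\<close>
  have "L2_norm (amp (sol \<delta>)) > L2_norm (amp (sol ((\<delta> + \<delta>max) / 2)))"
    using assms(12)[of \<delta> "(\<delta> + \<delta>max) / 2"] \<delta> by simp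
  moreover have "L2_norm (amp (sol ((\<delta> + \<delta>max) / 2))) \<ge> 0"
    by (simp add: L2_norm_def)
  ultimately have "L2_norm (amp (sol \<delta>)) > 0" by linarith
  then have pos: "charge (sol \<delta>) > 0" by (simp add: L2_norm_def charge_def)
  interpret minimiser W D a b c r l V B q "sol \<delta>"
  proof (intro minimiser.intro soliton_setting.intro nl)
    show "soliton_setting_axioms V B"
      using assms(6) B by unfold_locales (auto simp: V_i_def)
    show "minimiser_axioms W V q (sol \<delta>)"
      using \<Gamma> least pos by unfold_locales auto
  qed
  note SP = solves_schroedinger_poisson
  note sol = stationary_solves[OF SP, of E0]
  have "state_eq (\<gamma> t (sol \<delta>)) (sol \<delta>)" for t
  proof -
    \<comment> \<open>Uniqueness in the Cauchy problem is applied to the constant curve, whose value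
      at time 0 is \<open>sol \<delta>\<close>.\<close>
    have "state_eq (sol \<delta>) (\<gamma> t (sol \<delta>))"
      using assms(9) sol unfolding well_posed_evolution_def by blast
    then show ?thesis unfolding state_eq_def by (rule eventually_mono) auto
  qed
  then show "\<exists>\<phi> \<omega>.
           (AE x in lborel. cur (sol \<delta>) x = 0) \<and>
           (AE x in lborel. magn (sol \<delta>) x = 0) \<and>
           has_weak_grad \<phi> (\<lambda>x. - elec (sol \<delta>) x) \<and>
           (\<forall>t. state_eq (\<gamma> t (sol \<delta>)) (sol \<delta>)) \<and>
           solves E0 W V q (\<lambda>t. sol \<delta>) (\<lambda>(x, t). \<omega> * t) (\<lambda>(x, t). \<phi> x) (\<lambda>(x, t). 0) \<and>
           schroedinger_poisson W V q \<omega> (amp (sol \<delta>)) \<phi>"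
    using cur_magn_zero has_weak_grad_potential sol SP by blast
qed

end
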